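(* Let $\mathcal{M}$ be a $C^{1,1}$ manifold, $g$ a $C^{0,1}$ Riemannian metric on $\mathcal{M}$, $\mathcal{X}\subset\mathcal{M}$ prox-regular, and $f$ a $C^{0,1}$ vector field on $\mathcal{X}$. Then, for every $x_0\in\mathcal{X}$ there exists a unique Carathéodory solution $x:[0,T)\to\mathcal{X}$, for some $T>0$, that solves $\dot x(t)\in\Pi_{\mathcal{X}}^{g}[f](x(t))$ with $x(0)=x_0$.
   Context: Uniqueness is understood in the sense that any two solutions are equal on the interval on which they are both defined. $C^{0,1}$ means locally Lipschitz; $C^{1,1}$ means $C^1$ with locally Lipschitz derivative. A $C^{1,1}$ manifold is a finite-dimensional locally Euclidean, second countable Hausdorff space with an atlas whose transition maps are $C^{1,1}$ diffeomorphisms. A $C^{0,1}$ metric (vector field) is one that is $C^{0,1}$ in local coordinates; a vector field on $\mathcal{X}$ assigns to $x\in\mathcal{X}$ a vector $f(x)\in T_x\mathcal{M}$. In $\mathbb{R}^n$, for $\mathcal{Y}\subset\mathbb{R}^n$ and $x\in\mathcal{Y}$: the tangent cone $T_x\mathcal{Y}$ is the set of $v$ for which there exist $x_k\in\mathcal{Y}$, $x_k\to x$, $\delta_k\to0^+$ with $(x_k-x)/\delta_k\to v$; the Clarke tangent cone is $T_x^C\mathcal{Y}:=\liminf_{y\to x}T_y\mathcal{Y}$, i.e. the set of $v$ such that for every sequence $x_k\in\mathcal{Y}$, $x_k\to x$, there are (for large $k$) $v_k\in T_{x_k}\mathcal{Y}$ with $v_k\to v$; $\mathcal{Y}$ is Clarke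 regular if it is the intersection of a closed and an open set and $T_x\mathcal{Y}=T^C_x\mathcal{Y}$ for all $x\in\mathcal{Y}$; $N_x\mathcal{Y}:=\{\eta\mid\langle v,\eta\rangle\le0\ \forall v\in T_x^C\mathcal{Y}\}$. A Clarke regular set $\mathcal{Y}$ is prox-regular if for every $x\in\mathcal{Y}$ there is $L>0$ such that for all $z,y\in\mathcal{Y}$ in a neighborhood of $x$ and all $\eta\in N_y\mathcal{Y}$ one has $\langle\eta,z-y\rangle\le L\|\eta\|\|z-y\|^2$. On $\mathcal{M}$: a subset $\mathcal{X}$ is prox-regular if each of its points has a chart $(U,\phi)$ of $\mathcal{M}$ such that $\phi(\mathcal{X}\cap U)$ is prox-regular (this property is preserved under $C^{1,1}$ changes of coordinates). $T_x\mathcal{X}\subset T_x\mathcal{M}$ is the set with $D_x\phi(T_x\mathcal{X})=T_{\phi(x)}\phi(\mathcal{X}\cap U)$ for any chart $(U,\phi)$ at $x$. Projected vector field: $\Pi_{\mathcal{X}}^{g}[f](x):=\arg\min_{v\in T_x\mathcal{X}}\|v-f(x)\|^2_{g(x)}$. A Carathéodory solution is an absolutely continuous curve (i.e. absolutely continuous in every chart domain) $x:[0,T)\to\mathcal{X}$, $T>0$, with $x(0)=x_0$ and $\dot x(t)\in\Pi_{\mathcal{X}}^{g}[f](x(t))$ for almost all $t$. *)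

theory Defs
  imports "HOL-Analysis.Analysis"
begin

section \<open>Regularity of maps\<close>

definition locally_lipschitz_on :: "'a::metric_space set \<Rightarrow> ('a \<Rightarrow> 'b::metric_space) \<Rightarrow> bool" where
  "locally_lipschitz_on S h \<longleftrightarrow>
     (\<forall>x\<in>S. \<exists>r>0. \<exists>L. L-lipschitz_on (S \<inter> ball x r) h)"

definition C11_on :: "'e::euclidean_space set \<Rightarrow> ('e \<Rightarrow> 'e) \<Rightarrow> bool" where
  "C11_on S h \<longleftrightarrow>
     (\<exists>D :: 'e \<Rightarrow> 'e \<Rightarrow>\<^sub>L 'e.
        (\<forall>x\<in>S. (h has_derivative blinfun_apply (D x)) (at x within S)) \<and>
        locally_lipschitz_on S D)"

definition absolutely_continuous_on_interval ::
    "real \<Rightarrow> real \<Rightarrow> (real \<Rightarrow> 'e::real_normed_vector) \<Rightarrow> bool" where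
  "absolutely_continuous_on_interval a b h \<longleftrightarrow>
     (\<forall>\<epsilon>>0. \<exists>\<delta>>0. \<forall>(n::nat) (s :: nat \<Rightarrow> real) (t :: nat \<Rightarrow> real).
        (\<forall>i<n. a \<le> s i \<and> s i \<le> t i \<and> t i \<le> b) \<and>
        (\<forall>i<n. \<forall>j<n. i \<noteq> j \<longrightarrow> {s i<..<t i} \<inter> {s j<..<t j} = {}) \<and>
        (\<Sum>i<n. t i - s i) < \<delta>
        \<longrightarrow> (\<Sum>i<n. norm (h (t i) - h (s i))) < \<epsilon>)"


section \<open>Cones and prox-regularity in Euclidean space\<close>

definition tangent_cone :: "'e::euclidean_space set \<Rightarrow> 'e \<Rightarrow> 'e set" where
  "tangent_cone Y x =
     {v. \<exists>(y :: nat \<Rightarrow> 'e) (\<delta> :: nat \<Rightarrow> real).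
           (\<forall>k. y k \<in> Y) \<and> y \<longlonglongrightarrow> x \<and> (\<forall>k. \<delta> k > 0) \<and> \<delta> \<longlonglongrightarrow> 0 \<and>
           (\<lambda>k. (y k - x) /\<^sub>R \<delta> k) \<longlonglongrightarrow> v}"

definition clarke_tangent_cone :: "'e::euclidean_space set \<Rightarrow> 'e \<Rightarrow> 'e set" where
  "clarke_tangent_cone Y x =
     {v. \<forall>y :: nat \<Rightarrow> 'e. (\<forall>k. y k \<in> Y) \<and> y \<longlonglongrightarrow> x \<longrightarrow>
           (\<exists>w :: nat \<Rightarrow> 'e.
              (\<forall>\<^sub>F k in sequentially. w k \<in> tangent_cone Y (y k)) \<and> w \<longlonglongrightarrow> v)}"

definition clarke_regular :: "'e::euclidean_space set \<Rightarrow> bool" where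
  "clarke_regular Y \<longleftrightarrow>
     (\<exists>C U. closed C \<and> open U \<and> Y = C \<inter> U) \<and>
     (\<forall>x\<in>Y. tangent_cone Y x = clarke_tangent_cone Y x)"

definition normal_cone :: "'e::euclidean_space set \<Rightarrow> 'e \<Rightarrow> 'e set" where
  "normal_cone Y x = {\<eta>. \<forall>v\<in>clarke_tangent_cone Y x. inner v \<eta> \<le> 0}"

definition prox_regular :: "'e::euclidean_space set \<Rightarrow> bool" where
  "prox_regular Y \<longleftrightarrow>
     clarke_regular Y \<and>
     (\<forall>x\<in>Y. \<exists>L>0. \<exists>W. open W \<and> x \<in> W \<and>
        (\<forall>z\<in>Y \<inter> W. \<forall>y\<in>Y \<inter> W. \<forall>\<eta>\<in>normal_cone Y y.
           inner \<eta> (z - y) \<le> L * norm \<eta> * (norm (z - y))\<^sup>2))"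


section \<open>Manifolds with \<open>C\<^sup>1\<^sup>,\<^sup>1\<close> transition maps\<close>

text \<open>
  The manifold is the whole second countable Hausdorff type \<open>'m\<close>. The coordinate space
  \<open>\<real>\<^sup>n\<close> is a linear subspace \<open>E\<close> of a Euclidean type \<open>'e\<close>; \<open>E = UNIV\<close> gives the
  usual charts, and passing to a subspace only serves to include \<open>n = 0\<close>, since \<open>DIM('e) \<ge> 1\<close>.
  For \<open>Y \<subseteq> E\<close> the notions above do not depend on whether they are read in \<open>E\<close> or in \<open>'e\<close>:
  the tangent cones are the same subsets of \<open>E\<close>, \<open>E\<close> is closed, and normal vectors change
  only by vectors orthogonal to \<open>E\<close>, which do not affect prox-regularity.

  A chart is a pair \<open>(U, \<phi>)\<close>; values of \<open>\<phi>\<close> outside \<open>U\<close> are irrelevant.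
\<close>

type_synonym ('m, 'e) chart = "'m set \<times> ('m \<Rightarrow> 'e)"

abbreviation chart_dom :: "('m, 'e) chart \<Rightarrow> 'm set" where
  "chart_dom c \<equiv> fst c"

abbreviation chart_map :: "('m, 'e) chart \<Rightarrow> 'm \<Rightarrow> 'e" where
  "chart_map c \<equiv> snd c"

definition chart_inv :: "('m, 'e) chart \<Rightarrow> 'e \<Rightarrow> 'm" where
  "chart_inv c = inv_into (chart_dom c) (chart_map c)"

definition transition :: "('m, 'e) chart \<Rightarrow> ('m, 'e) chart \<Rightarrow> 'e \<Rightarrow> 'e" where
  "transition c d = chart_map d \<circ> chart_inv c"

definition overlap :: "('m, 'e) chart \<Rightarrow> ('m, 'e) chart \<Rightarrow> 'e set" where
  "overlap c d = chart_map c ` (chart_dom c \<inter> chart_dom d)"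

definition is_chart :: "'e::euclidean_space set \<Rightarrow> ('m::topological_space, 'e) chart \<Rightarrow> bool" where
  "is_chart E c \<longleftrightarrow>
     open (chart_dom c) \<and>
     openin (top_of_set E) (chart_map c ` chart_dom c) \<and>
     homeomorphism (chart_dom c) (chart_map c ` chart_dom c) (chart_map c) (chart_inv c)"

definition C11_compatible ::
    "('m, 'e::euclidean_space) chart \<Rightarrow> ('m, 'e) chart \<Rightarrow> bool" where
  "C11_compatible c d \<longleftrightarrow>
     C11_on (overlap c d) (transition c d) \<and> C11_on (overlap d c) (transition d c)"

definition C11_manifold ::
    "'e::euclidean_space set \<Rightarrow> ('m::{t2_space,second_countable_topology}, 'e) chart set \<Rightarrow> bool" where
  "C11_manifold E A \<longleftrightarrow>
     subspace E \<and>
     (\<forall>c\<in>A. is_chart E c) \<and>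
     (\<Union>c\<in>A. chart_dom c) = UNIV \<and>
     (\<forall>c\<in>A. \<forall>d\<in>A. C11_compatible c d)"

text \<open>The charts of the manifold are those of the maximal atlas generated by \<open>A\<close>.\<close>

definition charts ::
    "'e::euclidean_space set \<Rightarrow> ('m::topological_space, 'e) chart set \<Rightarrow> ('m, 'e) chart set" where
  "charts E A = {c. is_chart E c \<and> (\<forall>d\<in>A. C11_compatible c d)}"

definition charts_at ::
    "'e::euclidean_space set \<Rightarrow> ('m::topological_space, 'e) chart set \<Rightarrow> 'm \<Rightarrow> ('m, 'e) chart set" where
  "charts_at E A x = {c \<in> charts E A. x \<in> chart_dom c}"


section \<open>Tangent vectors, metrics and vector fields\<close>

text \<open>
  A tangent vector at \<open>x\<close> is the family of its coordinate vectors in all charts at \<open>x\<close>, related by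
  the derivatives of the transition maps. Thus \<open>v c\<close> is \<open>D\<^sub>x\<phi> v\<close> for \<open>c = (U, \<phi>)\<close>, and
  vector space operations are pointwise in \<open>c\<close>. The value \<open>0\<close> at all other pairs makes the
  representation unique. On \<open>E\<close> the derivative within a relatively open subset of \<open>E\<close> is
  uniquely determined, so the choice made by \<open>frechet_derivative\<close> does not matter.
\<close>

type_synonym ('m, 'e) tvec = "('m, 'e) chart \<Rightarrow> 'e"

definition transition_deriv ::
    "('m, 'e::euclidean_space) chart \<Rightarrow> ('m, 'e) chart \<Rightarrow> 'm \<Rightarrow> 'e \<Rightarrow> 'e" where
  "transition_deriv c d x =
     frechet_derivative (transition c d) (at (chart_map c x) within overlap c d)"

definition tangent_space ::
    "'e::euclidean_space set \<Rightarrow> ('m::topological_space, 'e) chart set \<Rightarrow> 'm \<Rightarrow> ('m, 'e) tvec set" where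
  "tangent_space E A x =
     {v. (\<forall>c\<in>charts_at E A x. v c \<in> E) \<and>
         (\<forall>c\<in>charts_at E A x. \<forall>d\<in>charts_at E A x. v d = transition_deriv c d x (v c)) \<and>
         (\<forall>c. c \<notin> charts_at E A x \<longrightarrow> v c = 0)}"

text \<open>The tangent vector at \<open>x\<close> with coordinate vector \<open>u \<in> E\<close> in the chart \<open>c\<close>.\<close>

definition tangent_of_coords ::
    "'e::euclidean_space set \<Rightarrow> ('m::topological_space, 'e) chart set \<Rightarrow>
     ('m, 'e) chart \<Rightarrow> 'm \<Rightarrow> 'e \<Rightarrow> ('m, 'e) tvec" where
  "tangent_of_coords E A c x u =
     (\<lambda>d. if d \<in> charts_at E A x then transition_deriv c d x u else 0)"

type_synonym ('m, 'e) metric = "'m \<Rightarrow> ('m, 'e) tvec \<Rightarrow> ('m, 'e) tvec \<Rightarrow> real"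

definition riemannian_metric ::
    "'e::euclidean_space set \<Rightarrow> ('m::topological_space, 'e) chart set \<Rightarrow> ('m, 'e) metric \<Rightarrow> bool" where
  "riemannian_metric E A g \<longleftrightarrow>
     (\<forall>x. \<forall>u\<in>tangent_space E A x. \<forall>v\<in>tangent_space E A x.
        g x u v = g x v u \<and>
        (\<forall>w\<in>tangent_space E A x. g x (\<lambda>c. u c + v c) w = g x u w + g x v w) \<and>
        (\<forall>a::real. g x (\<lambda>c. a *\<^sub>R u c) v = a * g x u v) \<and>
        (u \<noteq> (\<lambda>_. 0) \<longrightarrow> g x u u > 0))"

definition C01_riemannian_metric ::
    "'e::euclidean_space set \<Rightarrow> ('m::topological_space, 'e) chart set \<Rightarrow> ('m, 'e) metric \<Rightarrow> bool" where
  "C01_riemannian_metric E A g \<longleftrightarrow>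
     riemannian_metric E A g \<and>
     (\<forall>c\<in>charts E A. \<forall>u\<in>E. \<forall>w\<in>E.
        locally_lipschitz_on (chart_map c ` chart_dom c)
          (\<lambda>y. g (chart_inv c y) (tangent_of_coords E A c (chart_inv c y) u)
                                 (tangent_of_coords E A c (chart_inv c y) w)))"

definition C01_vector_field_on ::
    "'e::euclidean_space set \<Rightarrow> ('m::topological_space, 'e) chart set \<Rightarrow>
     'm set \<Rightarrow> ('m \<Rightarrow> ('m, 'e) tvec) \<Rightarrow> bool" where
  "C01_vector_field_on E A X f \<longleftrightarrow>
     (\<forall>x\<in>X. f x \<in> tangent_space E A x) \<and>
     (\<forall>c\<in>charts E A.
        locally_lipschitz_on (chart_map c ` (X \<inter> chart_dom c)) (\<lambda>y. f (chart_inv c y) c))"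


section \<open>Projected dynamical systems\<close>

definition manifold_prox_regular ::
    "'e::euclidean_space set \<Rightarrow> ('m::topological_space, 'e) chart set \<Rightarrow> 'm set \<Rightarrow> bool" where
  "manifold_prox_regular E A X \<longleftrightarrow>
     (\<forall>x\<in>X. \<exists>c\<in>charts_at E A x. prox_regular (chart_map c ` (X \<inter> chart_dom c)))"

definition manifold_tangent_cone ::
    "'e::euclidean_space set \<Rightarrow> ('m::topological_space, 'e) chart set \<Rightarrow>
     'm set \<Rightarrow> 'm \<Rightarrow> ('m, 'e) tvec set" where
  "manifold_tangent_cone E A X x =
     {v \<in> tangent_space E A x.
        \<forall>c\<in>charts_at E A x. v c \<in> tangent_cone (chart_map c ` (X \<inter> chart_dom c)) (chart_map c x)}"

definition projected_vector_field ::
    "'e::euclidean_space set \<Rightarrow> ('m::topological_space, 'e) chart set \<Rightarrow> ('m, 'e) metric \<Rightarrow>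
     'm set \<Rightarrow> ('m \<Rightarrow> ('m, 'e) tvec) \<Rightarrow> 'm \<Rightarrow> ('m, 'e) tvec set" where
  "projected_vector_field E A g X f x =
     {v. is_arg_min (\<lambda>w. g x (\<lambda>c. w c - f x c) (\<lambda>c. w c - f x c))
           (\<lambda>w. w \<in> manifold_tangent_cone E A X x) v}"

text \<open>
  A curve on \<open>[0,T)\<close> is absolutely continuous if it is continuous and its coordinate
  representation is absolutely continuous on each compact time interval spent in a chart domain.
  (Coordinates may blow up as the curve leaves a chart domain, hence compact intervals.)
\<close>

definition absolutely_continuous_curve ::
    "'e::euclidean_space set \<Rightarrow> ('m::topological_space, 'e) chart set \<Rightarrow>
     real \<Rightarrow> (real \<Rightarrow> 'm) \<Rightarrow> bool" where
  "absolutely_continuous_curve E A T x \<longleftrightarrow>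
     continuous_on {0..<T} x \<and>
     (\<forall>c\<in>charts E A. \<forall>a b. 0 \<le> a \<and> a \<le> b \<and> b < T \<and> x ` {a..b} \<subseteq> chart_dom c \<longrightarrow>
        absolutely_continuous_on_interval a b (chart_map c \<circ> x))"

definition has_velocity ::
    "'e::euclidean_space set \<Rightarrow> ('m::topological_space, 'e) chart set \<Rightarrow>
     (real \<Rightarrow> 'm) \<Rightarrow> ('m, 'e) tvec \<Rightarrow> real \<Rightarrow> real set \<Rightarrow> bool" where
  "has_velocity E A x v t I \<longleftrightarrow>
     v \<in> tangent_space E A (x t) \<and>
     (\<forall>c\<in>charts_at E A (x t). ((chart_map c \<circ> x) has_vector_derivative v c) (at t within I))"

definition caratheodory_solution ::
    "'e::euclidean_space set \<Rightarrow> ('m::topological_space, 'e) chart set \<Rightarrow> ('m, 'e) metric \<Rightarrow>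
     'm set \<Rightarrow> ('m \<Rightarrow> ('m, 'e) tvec) \<Rightarrow> 'm \<Rightarrow> real \<Rightarrow> (real \<Rightarrow> 'm) \<Rightarrow> bool" where
  "caratheodory_solution E A g X f x0 T x \<longleftrightarrow>
     T > 0 \<and> x 0 = x0 \<and> (\<forall>t\<in>{0..<T}. x t \<in> X) \<and>
     absolutely_continuous_curve E A T x \<and>
     (AE t in lborel. t \<in> {0..<T} \<longrightarrow>
        (\<exists>v\<in>projected_vector_field E A g X f (x t). has_velocity E A x v t {0..<T}))"

end

theory Submission
  imports Defs "HOL-Complex_Analysis.Great_Picard"
begin

text \<open>
  In a chart, a solution is a curve in a prox-regular set whose velocity is the metric projection of \<open>f\<close>
  onto the tangent cone, so that \<open>f\<close> minus the velocity is a normal vector of bounded length. By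
  prox-regularity such normals are hypomonotone, and the squared distance of two solutions, measured in the
  metric at one of them, satisfies a Gronwall inequality; this gives uniqueness.

  For existence, let \<open>y\<^sub>i\<^sub>+\<^sub>1\<close> be a point of the set nearest to \<open>y\<^sub>i + h f(y\<^sub>i)\<close> in the metric at \<open>y\<^sub>i\<close>
  (Moreau's catching-up scheme). A limit for \<open>h \<rightarrow> 0\<close> is a Lipschitz curve that satisfies an integrated
  variational inequality, in which the metric is frozen at the initial point of a short time interval. At
  every time of differentiability, hence almost everywhere, this inequality says that the velocity is the
  projection of \<open>f\<close>.
\<close>

section \<open>Differentiability and growth of real functions\<close>

text \<open>The metric is only Lipschitz in its base point, so the energy of the difference of two
  solutions cannot be differentiated by the chain rule. Instead its increments around almost every
  time are estimated with the metric frozen at that time, and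
  \<open>absolutely_continuous_growth\<close> adds these estimates up. Gronwall's inequality appears
  in its crudest form: on an interval of length at most 1 / (20 * K^6) the largest squared distance
  is at most half of itself.

  For existence the obstacle is that the projected field is discontinuous and that uniform
  convergence of the polygons says nothing about pointwise convergence of their velocities. The
  variational inequality contains positions only, so it survives the limit, and velocities return
  afterwards by differentiating it.

  Two facts about the set are used throughout. It is only locally closed, so everything takes place
  in its compact intersection with a closed ball, and short times keep the curves off the sphere.
  Its tangent cones are convex because of Clarke regularity, which turns the minimisation defining
  the projected field into an orthogonality condition.\<close>

lemma absolutely_continuous_on_intervalE:
  assumes "absolutely_continuous_on_interval a b h" and "e > 0"
  obtains \<delta> where "\<delta> > 0"
    "\<And>(n::nat) s t. \<forall>i<n. a \<le> s i \<and> s i \<le> t i \<and> t i \<le> b \<Longrightarrow>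
      \<forall>i<n. \<forall>j<n. i \<noteq> j \<longrightarrow> {s i<..<t i} \<inter> {s j<..<t j} = {} \<Longrightarrow> (\<Sum>i<n. t i - s i) < \<delta> \<Longrightarrow>
      (\<Sum>i<n. norm (h (t i) - h (s i))) < e"
  using assms(1)[unfolded absolutely_continuous_on_interval_def, rule_format, OF assms(2)]
  by (elim exE conjE) (rule that, blast+)

section \<open>Continuous induction and the measure of closed sets on the line\<close>

text \<open>The times t with \<Psi> a \<le> \<Psi> t form a compact set, and the step hypothesis
  rules out a maximum before b. In the density estimates below this takes the place of a covering
  theorem: it is enough to take one favourable step from each point.\<close>

lemma continuous_induction_up:
  fixes \<Psi> :: "real \<Rightarrow> real"
  assumes "continuous_on {a..b} \<Psi>" and "a \<le> b"
    and step: "\<And>t. a \<le> t \<Longrightarrow> t < b \<Longrightarrow> \<exists>s. t < s \<and> s \<le> b \<and> \<Psi> t \<le> \<Psi> s"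
  shows "\<Psi> a \<le> \<Psi> b"
proof -
  let ?S = "{t \<in> {a..b}. \<Psi> a \<le> \<Psi> t}"
  have "closed ?S"
    using continuous_on_closed_Collect_le[of "{a..b}" "\<lambda>_. \<Psi> a" \<Psi>] assms(1) by simp
  then have "compact ?S"
    by (rule compact_Int_closed[OF compact_Icc, of ?S a b, THEN back_subst[of compact]]) auto
  moreover have "a \<in> ?S" using assms(2) by simp
  ultimately obtain m where m: "m \<in> ?S" "\<And>t. t \<in> ?S \<Longrightarrow> t \<le> m"
    using compact_attains_sup[of ?S] by blast
  show ?thesis
  proof (cases "m < b")
    case True
    then obtain s where "m < s" "s \<le> b" "\<Psi> m \<le> \<Psi> s" using step[of m] m(1) by auto
    then have "s \<in> ?S" using m(1) by auto
    then show ?thesis using m(2)[of s] \<open>m < s\<close> by simp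
  next
    case False
    then show ?thesis using m(1) by auto
  qed
qed

lemma continuous_induction_down:
  fixes \<Psi> :: "real \<Rightarrow> real"
  assumes "continuous_on {a..b} \<Psi>" and "a \<le> b"
    and step: "\<And>t. a < t \<Longrightarrow> t \<le> b \<Longrightarrow> \<exists>s. a \<le> s \<and> s < t \<and> \<Psi> s \<le> \<Psi> t"
  shows "\<Psi> a \<le> \<Psi> b"
proof -
  have "- \<Psi> (- (- b)) \<le> - \<Psi> (- (- a))"
  proof (rule continuous_induction_up[where \<Psi> = "\<lambda>t. - \<Psi> (- t)"])
    show "continuous_on {- b..- a} (\<lambda>t. - \<Psi> (- t))"
      by (intro continuous_on_minus continuous_on_compose2[OF assms(1)] continuous_intros) auto
  next
    fix t assume "- b \<le> t" "t < - a"
    then obtain s where "a \<le> s" "s < - t" "\<Psi> s \<le> \<Psi> (- t)" using step[of "- t"] by auto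
    then show "\<exists>s. t < s \<and> s \<le> - a \<and> - \<Psi> (- t) \<le> - \<Psi> (- s)"
      by (intro exI[of _ "- s"]) auto
  qed (use assms(2) in auto)
  then show ?thesis by simp
qed

lemma lmeasurable_Ioc: "{s<..t::real} \<in> lmeasurable"
  by (rule fmeasurableI2[of "{s..t}"]) auto

lemma measure_Int_Icc_split:
  fixes S :: "real set"
  assumes "S \<in> sets lebesgue" "a \<le> s" "s \<le> t"
  shows "measure lebesgue (S \<inter> {a..t}) = measure lebesgue (S \<inter> {a..s}) + measure lebesgue (S \<inter> {s<..t})"
proof -
  have "S \<inter> {a..s} \<in> lmeasurable" "S \<inter> {s<..t} \<in> lmeasurable"
    using fmeasurable_Int_fmeasurable[OF _ assms(1), of "{a..s}"]
      fmeasurable_Int_fmeasurable[OF lmeasurable_Ioc assms(1), of s t]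
    by (auto simp: inf_commute)
  then have "measure lebesgue ((S \<inter> {a..s}) \<union> (S \<inter> {s<..t})) =
      measure lebesgue (S \<inter> {a..s}) + measure lebesgue (S \<inter> {s<..t})"
    by (subst measure_Un3) (auto intro!: arg_cong[where f = "measure lebesgue", THEN trans, OF _ measure_empty])
  moreover have "(S \<inter> {a..s}) \<union> (S \<inter> {s<..t}) = S \<inter> {a..t}" using assms(2,3) by auto
  ultimately show ?thesis by simp
qed

lemma measure_Int_Ioc_le:
  fixes S :: "real set"
  assumes "S \<in> sets lebesgue" "s \<le> t"
  shows "measure lebesgue (S \<inter> {s<..t}) \<le> t - s"
proof -
  have "measure lebesgue (S \<inter> {s<..t}) \<le> measure lebesgue {s<..t}"
    using assms by (intro measure_mono_fmeasurable lmeasurable_Ioc) auto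
  then show ?thesis using assms by simp
qed

lemma continuous_on_measure_Int_Icc:
  fixes S :: "real set"
  assumes "S \<in> sets lebesgue"
  shows "continuous_on {a..b} (\<lambda>t. measure lebesgue (S \<inter> {a..t}))"
proof (rule lipschitz_on_continuous_on[of 1], rule lipschitz_on_leI)
  fix s t :: real assume "s \<in> {a..b}" "t \<in> {a..b}" "s \<le> t"
  then show "dist (measure lebesgue (S \<inter> {a..s})) (measure lebesgue (S \<inter> {a..t})) \<le> 1 * dist s t"
    using measure_Int_Icc_split[OF assms, of a s t] measure_Int_Ioc_le[OF assms, of s t]
    by (simp add: dist_real_def)
qed simp

text \<open>Continuous induction on F t minus q times the measure of C up to t. From a point of C
  one moves along a steep interval, on which the measure grows by at most its length; from a point
  outside the closed set C there is a gap where the measure is constant and F does not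
  decrease.\<close>

lemma measure_mult_le_increment_right:
  fixes F :: "real \<Rightarrow> real"
  assumes F: "mono F" "continuous_on UNIV F" and "closed C" and "0 \<le> q" and "a \<le> b"
    and slope: "\<And>t \<delta>. t \<in> C \<Longrightarrow> \<delta> > 0 \<Longrightarrow> \<exists>h. 0 < h \<and> h < \<delta> \<and> F (t + h) - F t > q * h"
  shows "q * measure lebesgue (C \<inter> {a..b}) \<le> F b - F a"
proof -
  let ?m = "\<lambda>t. measure lebesgue (C \<inter> {a..t})"
  have C: "C \<in> sets lebesgue" using \<open>closed C\<close> by simp
  have "F a - q * ?m a \<le> F b - q * ?m b"
  proof (rule continuous_induction_up[where \<Psi> = "\<lambda>t. F t - q * ?m t"])
    show "continuous_on {a..b} (\<lambda>t. F t - q * ?m t)"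
      by (intro continuous_intros continuous_on_measure_Int_Icc C continuous_on_subset[OF F(2)]) auto
  next
    fix t assume t: "a \<le> t" "t < b"
    show "\<exists>s>t. s \<le> b \<and> F t - q * ?m t \<le> F s - q * ?m s"
    proof (cases "t \<in> C")
      case True
      then obtain h where h: "0 < h" "h < b - t" "F (t + h) - F t > q * h"
        using slope[of t "b - t"] t by auto
      have "?m (t + h) \<le> ?m t + h"
        using measure_Int_Icc_split[OF C, of a t "t + h"] measure_Int_Ioc_le[OF C, of t "t + h"] t h by simp
      then have "q * ?m (t + h) \<le> q * (?m t + h)" using \<open>0 \<le> q\<close> by (rule mult_left_mono)
      then show ?thesis using h by (intro exI[of _ "t + h"]) (auto simp: algebra_simps)
    next
      case False
      then obtain e where e: "e > 0" "ball t e \<subseteq> - C"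
        using \<open>closed C\<close> by (metis ComplI open_Compl open_contains_ball)
      define s where "s = t + min (e/2) (b - t)"
      have s: "t < s" "s \<le> b" "s < t + e" using t e by (auto simp: s_def min_def)
      then have "C \<inter> {t<..s} = {}" using e by (auto simp: subset_iff dist_real_def)
      then have "?m s = ?m t" using measure_Int_Icc_split[OF C, of a t s] t s by simp
      then show ?thesis using s monoD[OF F(1), of t s] by (intro exI[of _ s]) auto
    qed
  qed fact
  moreover have "?m a = 0" 
  proof -
    have "negligible (C \<inter> {a..a})" by (rule negligible_subset[of "{a}"]) auto
    then show ?thesis by (simp add: negligible_imp_measure0)
  qed
  ultimately show ?thesis by simp
qed

text \<open>The steep intervals now end at t, so the induction runs backwards from b.\<close>

lemma measure_mult_le_increment_left:
  fixes F :: "real \<Rightarrow> real"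
  assumes F: "mono F" "continuous_on UNIV F" and "closed C" and "0 \<le> q" and "a \<le> b"
    and slope: "\<And>t \<delta>. t \<in> C \<Longrightarrow> \<delta> > 0 \<Longrightarrow> \<exists>h. 0 < h \<and> h < \<delta> \<and> F t - F (t - h) > q * h"
  shows "q * measure lebesgue (C \<inter> {a..b}) \<le> F b - F a"
proof -
  let ?m = "\<lambda>t. measure lebesgue (C \<inter> {a..t})"
  have C: "C \<in> sets lebesgue" using \<open>closed C\<close> by simp
  have "F a - q * ?m a \<le> F b - q * ?m b"
  proof (rule continuous_induction_down[where \<Psi> = "\<lambda>t. F t - q * ?m t"])
    show "continuous_on {a..b} (\<lambda>t. F t - q * ?m t)"
      by (intro continuous_intros continuous_on_measure_Int_Icc C continuous_on_subset[OF F(2)]) auto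
  next
    fix t assume t: "a < t" "t \<le> b"
    show "\<exists>s\<ge>a. s < t \<and> F s - q * ?m s \<le> F t - q * ?m t"
    proof (cases "t \<in> C")
      case True
      then obtain h where h: "0 < h" "h < t - a" "F t - F (t - h) > q * h"
        using slope[of t "t - a"] t by auto
      have "?m t \<le> ?m (t - h) + h"
        using measure_Int_Icc_split[OF C, of a "t - h" t] measure_Int_Ioc_le[OF C, of "t - h" t] t h by simp
      then have "q * ?m t \<le> q * (?m (t - h) + h)" using \<open>0 \<le> q\<close> by (rule mult_left_mono)
      then show ?thesis using h by (intro exI[of _ "t - h"]) (auto simp: algebra_simps)
    next
      case False
      then obtain e where e: "e > 0" "ball t e \<subseteq> - C"
        using \<open>closed C\<close> by (metis ComplI open_Compl open_contains_ball)
      define s where "s = t - min (e/2) (t - a)"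
      have s: "s < t" "a \<le> s" "t - e < s" using t e by (auto simp: s_def min_def)
      then have "C \<inter> {s<..t} = {}" using e by (auto simp: subset_iff dist_real_def)
      then have "?m t = ?m s" using measure_Int_Icc_split[OF C, of a s t] t s by simp
      then show ?thesis using s monoD[OF F(1), of s t] by (intro exI[of _ s]) auto
    qed
  qed fact
  moreover have "?m a = 0" 
  proof -
    have "negligible (C \<inter> {a..a})" by (rule negligible_subset[of "{a}"]) auto
    then show ?thesis by (simp add: negligible_imp_measure0)
  qed
  ultimately show ?thesis by simp
qed

text \<open>Let U be an open set around C with excess measure below e. Starting from a point of C, U
  gains the full length of a short interval while C gains at most the fraction \<theta> of it, so
  continuous induction yields |C| \<le> \<theta> |U| \<le> \<theta> (|C| + e) within {a..b}. As
  \<theta> < 1 and e is arbitrary, |C| = 0.\<close>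

lemma negligible_if_density_bounded:
  fixes C :: "real set"
  assumes "closed C" and \<theta>: "0 \<le> \<theta>" "\<theta> < 1"
    and bound: "\<And>a b. a \<le> b \<Longrightarrow> measure lebesgue (C \<inter> {a..b}) \<le> \<theta> * (b - a)"
  shows "negligible C"
proof -
  have C: "C \<in> sets lebesgue" using \<open>closed C\<close> by simp
  have meas: "S \<inter> {a..b} \<in> lmeasurable" if "S \<in> sets lebesgue" for S and a b :: real
    using that fmeasurable_Int_fmeasurable[of "{a..b}" lebesgue S] by (auto simp: inf_commute)
  have "measure lebesgue (C \<inter> {a..b}) = 0" if "a \<le> b" for a b
  proof -
    let ?\<mu> = "measure lebesgue (C \<inter> {a..b})"
    have "?\<mu> * (1 - \<theta>) \<le> e" if "e > 0" for e
    proof -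
      obtain U where U: "open U" "C \<subseteq> U" "emeasure lborel (U - C) < e"
        using outer_regular_lborel[of C e] \<open>closed C\<close> \<open>e > 0\<close> by auto
      have US: "U \<in> sets lebesgue" using U by simp
      have UC: "emeasure lebesgue (U - C) < e" 
        using U \<open>closed C\<close> by (simp add: emeasure_completion)
      let ?u = "\<lambda>t. measure lebesgue (U \<inter> {a..t})" and ?m = "\<lambda>t. measure lebesgue (C \<inter> {a..t})"
      have "\<theta> * ?u a - ?m a \<le> \<theta> * ?u b - ?m b"
      proof (rule continuous_induction_up[where \<Psi> = "\<lambda>t. \<theta> * ?u t - ?m t"])
        show "continuous_on {a..b} (\<lambda>t. \<theta> * ?u t - ?m t)"
          by (intro continuous_intros continuous_on_measure_Int_Icc C US)
      next
        fix t assume t: "a \<le> t" "t < b"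
        show "\<exists>s>t. s \<le> b \<and> \<theta> * ?u t - ?m t \<le> \<theta> * ?u s - ?m s"
        proof (cases "t \<in> C")
          case True
          then obtain e where e: "e > 0" "ball t e \<subseteq> U" using U by (meson open_contains_ball subsetD)
          define s where "s = t + min (e/2) (b - t)"
          have s: "t < s" "s \<le> b" "s < t + e" using t e by (auto simp: s_def min_def)
          have "{t<..s} \<subseteq> U" using e s by (auto simp: subset_iff dist_real_def)
          then have "U \<inter> {t<..s} = {t<..s}" by auto
          then have u: "?u s = ?u t + (s - t)" using measure_Int_Icc_split[OF US, of a t s] t s by simp
          have "measure lebesgue (C \<inter> {t<..s}) \<le> measure lebesgue (C \<inter> {t..s})"
            by (intro measure_mono_fmeasurable meas) (use C in auto)
          then have "?m s \<le> ?m t + \<theta> * (s - t)"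
            using measure_Int_Icc_split[OF C, of a t s] t s bound[of t s] by simp
          moreover have "\<theta> * ?u s = \<theta> * ?u t + \<theta> * (s - t)" by (simp add: u distrib_left)
          ultimately show ?thesis using s by (intro exI[of _ s]) auto
        next
          case False
          then obtain e where e: "e > 0" "ball t e \<subseteq> - C"
            using \<open>closed C\<close> by (metis ComplI open_Compl open_contains_ball)
          define s where "s = t + min (e/2) (b - t)"
          have s: "t < s" "s \<le> b" "s < t + e" using t e by (auto simp: s_def min_def)
          then have "C \<inter> {t<..s} = {}" using e by (auto simp: subset_iff dist_real_def)
          then have m: "?m s = ?m t" using measure_Int_Icc_split[OF C, of a t s] t s by simp
          have "?u t \<le> ?u s" using measure_Int_Icc_split[OF US, of a t s] t s by simp
          then have "\<theta> * ?u t \<le> \<theta> * ?u s" using \<theta> by (intro mult_left_mono) auto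
          then show ?thesis using m s by (intro exI[of _ s]) auto
        qed
      qed fact
      moreover have "?u a = 0" "?m a = 0"
      proof -
        have "negligible (S \<inter> {a..a})" for S by (rule negligible_subset[of "{a}"]) auto
        then show "?u a = 0" "?m a = 0" by (simp_all add: negligible_imp_measure0)
      qed
      ultimately have 1: "?\<mu> \<le> \<theta> * ?u b" by simp
      have "?u b \<le> ?\<mu> + measure lebesgue (U - C)"
      proof -
        have fm: "U - C \<in> lmeasurable" using UC US C by (intro fmeasurableI) (auto intro: less_trans)
        have "?u b \<le> measure lebesgue ((C \<inter> {a..b}) \<union> (U - C))"
          by (intro measure_mono_fmeasurable fmeasurable.Un meas fm) (use C US in auto)
        also have "\<dots> \<le> ?\<mu> + measure lebesgue (U - C)"
          by (intro measure_Un_le) (use C US in auto)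
        finally show ?thesis .
      qed
      moreover have "measure lebesgue (U - C) \<le> e"
        using UC \<open>e > 0\<close> by (simp add: measure_def enn2real_leI)
      ultimately have "?u b \<le> ?\<mu> + e" by simp
      then have "\<theta> * ?u b \<le> \<theta> * (?\<mu> + e)" using \<theta> by (intro mult_left_mono) auto
      moreover have "\<theta> * e \<le> e" using \<theta> \<open>e > 0\<close> by simp
      ultimately show ?thesis using 1 by (simp add: algebra_simps)
    qed
    then have "?\<mu> * (1 - \<theta>) \<le> 0" by (rule field_le_epsilon[where y=0, simplified])
    then show ?thesis using \<theta> by (simp add: mult_le_0_iff zero_le_mult_iff order_antisym)
  qed
  then have "negligible (C \<inter> {a..b})" for a b
    by (cases "a \<le> b") (use meas[OF C] in \<open>auto simp: negligible_iff_measure\<close>)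
  then show ?thesis using negligible_on_intervals[of C] by simp
qed

section \<open>Almost everywhere differentiability of Lipschitz functions\<close>

definition steep_right :: "(real \<Rightarrow> real) \<Rightarrow> real \<Rightarrow> real set" where
  "steep_right F q = {t. \<forall>\<delta>>0. \<exists>h. 0 < h \<and> h < \<delta> \<and> F (t + h) - F t > q * h}"

text \<open>\<open>steep_right\<close> and \<open>steep_left\<close> are superlevel sets of the
  upper Dini derivatives, up to the boundary value: an upper derivative above q implies membership,
  and membership implies an upper derivative of at least q.\<close>

definition steep_left :: "(real \<Rightarrow> real) \<Rightarrow> real \<Rightarrow> real set" where
  "steep_left F q = {t. \<forall>\<delta>>0. \<exists>h. 0 < h \<and> h < \<delta> \<and> F t - F (t - h) > q * h}"

lemma not_steep_rightD:
  "t \<notin> steep_right F q \<Longrightarrow> \<exists>\<delta>>0. \<forall>h. 0 < h \<longrightarrow> h < \<delta> \<longrightarrow> F (t + h) - F t \<le> q * h"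
  unfolding steep_right_def using not_less by blast

lemma not_steep_leftD:
  "t \<notin> steep_left F q \<Longrightarrow> \<exists>\<delta>>0. \<forall>h. 0 < h \<longrightarrow> h < \<delta> \<longrightarrow> F t - F (t - h) \<le> q * h"
  unfolding steep_left_def using not_less by blast

text \<open>The set is a countable intersection of open sets: it is enough to test \<delta> =
  1/(n+1), and the union over h, though uncountable, is open.\<close>

lemma borel_arbitrarily_small:
  fixes R :: "real \<Rightarrow> real set"
  assumes "\<And>h. open (R h)"
  shows "{t. \<forall>\<delta>>0. \<exists>h. 0 < h \<and> h < \<delta> \<and> t \<in> R h} \<in> sets borel"
proof -
  let ?U = "\<lambda>n::nat. \<Union>h\<in>{0<..<1/real (Suc n)}. R h"
  have "{t. \<forall>\<delta>>0. \<exists>h. 0 < h \<and> h < \<delta> \<and> t \<in> R h} = (\<Inter>n. ?U n)"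
  proof (intro equalityI subsetI CollectI allI impI)
    fix t \<delta> assume t: "t \<in> (\<Inter>n. ?U n)" and "\<delta> > (0::real)"
    then obtain n where n: "1 / real (Suc n) < \<delta>" using nat_approx_posE by blast
    from t have "t \<in> ?U n" by blast
    then obtain h where "0 < h" "h < 1 / real (Suc n)" "t \<in> R h" by auto
    then show "\<exists>h. 0 < h \<and> h < \<delta> \<and> t \<in> R h" using n by (intro exI[of _ h]) auto
  next
    fix t assume t: "t \<in> {t. \<forall>\<delta>>0. \<exists>h. 0 < h \<and> h < \<delta> \<and> t \<in> R h}"
    have "t \<in> ?U n" for n
    proof -
      have "0 < 1 / real (Suc n)" by simp
      then have "\<exists>h. 0 < h \<and> h < 1 / real (Suc n) \<and> t \<in> R h" using t by blast
      then show ?thesis by auto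
    qed
    then show "t \<in> (\<Inter>n. ?U n)" by blast
  qed
  moreover have "open (?U n)" for n using assms by blast
  ultimately show ?thesis by (auto intro!: sets.countable_INT)
qed

lemma steep_borel:
  assumes F: "continuous_on UNIV F"
  shows "steep_right F q \<in> sets borel" "steep_left F q \<in> sets borel"
proof -
  have "open {t. F (t + h) - F t > q * h}" "open {t. F t - F (t - h) > q * h}" for h
    by (intro open_Collect_less continuous_intros continuous_on_compose2[OF F] continuous_on_subset[OF F]; simp)+
  from borel_arbitrarily_small[of "\<lambda>h. {t. F (t + h) - F t > q * h}", OF this(1)]
    borel_arbitrarily_small[of "\<lambda>h. {t. F t - F (t - h) > q * h}", OF this(2)]
  show "steep_right F q \<in> sets borel" "steep_left F q \<in> sets borel"
    by (simp_all add: steep_right_def steep_left_def)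
qed

text \<open>The slopes of \<open>F\<close> and \<open>G\<close> add up to \<open>M\<close>. Where both exceed \<open>q\<close> and \<open>q'\<close> along arbitrarily small
  intervals, the increments show that the set has density at most \<open>M / (q + q') < 1\<close> in every interval.\<close>

lemma negligible_steep_Int:
  fixes F G :: "real \<Rightarrow> real"
  assumes F: "mono F" "continuous_on UNIV F" and G: "mono G" "continuous_on UNIV G"
    and FG: "\<And>t. F t + G t = M * t" and q: "0 \<le> q" "0 \<le> q'" "M < q + q'" and "M > 0"
    and S: "S = steep_right F q \<or> S = steep_left F q"
    and S': "S' = steep_right G q' \<or> S' = steep_left G q'"
  shows "negligible (S \<inter> S')"
proof -
  have closed_case: "negligible C" if C: "closed C" "C \<subseteq> S \<inter> S'" for C
  proof (rule negligible_if_density_bounded[OF C(1), of "M / (q + q')"])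
    fix a b :: real assume ab: "a \<le> b"
    have "q * measure lebesgue (C \<inter> {a..b}) \<le> F b - F a"
      using S
    proof
      assume "S = steep_right F q"
      with C(2) show ?thesis
        by (intro measure_mult_le_increment_right F C(1) q ab) (auto simp: steep_right_def)
    next
      assume "S = steep_left F q"
      with C(2) show ?thesis
        by (intro measure_mult_le_increment_left F C(1) q ab) (auto simp: steep_left_def)
    qed
    moreover have "q' * measure lebesgue (C \<inter> {a..b}) \<le> G b - G a"
      using S'
    proof
      assume "S' = steep_right G q'"
      with C(2) show ?thesis
        by (intro measure_mult_le_increment_right G C(1) q ab) (auto simp: steep_right_def)
    next
      assume "S' = steep_left G q'"
      with C(2) show ?thesis
        by (intro measure_mult_le_increment_left G C(1) q ab) (auto simp: steep_left_def)
    qed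
    \<comment> \<open>The increments of F and G over {a..b} add up to M * (b - a), so the two
      measure bounds can be added.\<close>
    ultimately have "(q + q') * measure lebesgue (C \<inter> {a..b}) \<le> M * (b - a)"
      using FG[of a] FG[of b] by (simp add: algebra_simps)
    then show "measure lebesgue (C \<inter> {a..b}) \<le> M / (q + q') * (b - a)"
      using q \<open>M > 0\<close> by (simp add: field_simps)
  qed (use q \<open>M > 0\<close> in auto)
  have SS: "S \<inter> S' \<in> sets lebesgue"
  proof -
    have "S \<in> sets lborel" "S' \<in> sets lborel"
      unfolding sets_lborel using S S' steep_borel[OF F(2), of q] steep_borel[OF G(2), of q'] by blast+
    then show ?thesis by (intro sets.Int sets_completionI_sets)
  qed
  \<comment> \<open>The density argument needs gaps around outside points and therefore treats
    closed sets only; inner regularity passes from closed subsets to the Borel set itself.\<close>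
  have "emeasure lebesgue (S \<inter> S') \<le> ennreal e" if "e > 0" for e
  proof -
    obtain C where C: "closed C" "C \<subseteq> S \<inter> S'" "S \<inter> S' - C \<in> lmeasurable"
      "emeasure lebesgue (S \<inter> S' - C) < ennreal e"
      by (rule sets_lebesgue_inner_closed[OF SS \<open>e > 0\<close>])
    have "emeasure lebesgue C = 0"
      using closed_case[OF C(1,2)] by (simp add: negligible_iff_null_sets null_setsD1)
    moreover have "emeasure lebesgue (S \<inter> S') \<le> emeasure lebesgue C + emeasure lebesgue (S \<inter> S' - C)"
    proof -
      have "S \<inter> S' = C \<union> (S \<inter> S' - C)" using C(2) by auto
      then show ?thesis 
        using emeasure_subadditive[of C lebesgue "S \<inter> S' - C"] C(1) SS
        by (metis sets.Diff sets_completionI_sets borel_closed sets_lborel)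
    qed
    ultimately show ?thesis using C(4) by (simp add: order.strict_implies_order order.trans)
  qed
  then have "emeasure lebesgue (S \<inter> S') = 0"
    by (metis ennreal_le_epsilon add_0 zero_le le_zero_eq)
  then show ?thesis using SS by (simp add: negligible_iff_null_sets null_sets_def)
qed

text \<open>P and Q are increasing with P + Q linear of slope M, so the lower derivatives of P are M
  minus the upper derivatives of Q. Outside a null set an upper derivative of P and one of Q, on
  whichever sides, cannot add up to more than M. Hence no lower derivative of P lies below any upper
  derivative of P, and P is differentiable there. The extra 1 in the slope K + 1 makes P strictly
  increasing and M positive.\<close>

lemma lipschitz_real_differentiable_AE:
  fixes F :: "real \<Rightarrow> real"
  assumes "K-lipschitz_on UNIV F"
  shows "AE t in lborel. F differentiable (at t)"
proof -
  define M where "M = 2 * (K + 1)"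
  define P where "P t = F t + (K + 1) * t" for t
  define Q where "Q t = (K + 1) * t - F t" for t
  have K: "K \<ge> 0" "M > 0" using lipschitz_on_nonneg[OF assms] by (auto simp: M_def dest: lipschitz_on_nonneg)
  have lip: "\<bar>F s - F t\<bar> \<le> K * \<bar>s - t\<bar>" for s t
    using lipschitz_onD[OF assms, of s t] by (simp add: dist_real_def)
  have inc: "\<bar>F (t + h) - F t\<bar> \<le> K * h" "\<bar>F t - F (t - h)\<bar> \<le> K * h" if "h \<ge> 0" for t h
    using lip[of "t + h" t] lip[of t "t - h"] that by auto
  have "continuous_on UNIV F" using assms by (rule lipschitz_on_continuous_on)
  then have cont: "continuous_on UNIV P" "continuous_on UNIV Q"
    unfolding P_def Q_def by (intro continuous_intros; simp)+
  have mono: "mono P" "mono Q"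
  proof -
    have "\<bar>F t - F s\<bar> \<le> (K + 1) * (t - s)" if "s \<le> t" for s t
      using lip[of t s] that by (auto simp: algebra_simps)
    then show "mono P" "mono Q"
      by (force simp: mono_def P_def Q_def algebra_simps abs_le_iff)+
  qed
  have PQ: "P t + Q t = M * t" for t by (simp add: P_def Q_def M_def algebra_simps)
  \<comment> \<open>Rational levels suffice because any violation of the bound M is strict, and they
    keep the union countable.\<close>
  define N where "N = (\<Union>q\<in>\<rat> \<inter> {0..}. \<Union>q'\<in>{q' \<in> \<rat> \<inter> {0..}. M < q + q'}.
    (steep_right P q \<union> steep_left P q) \<inter> (steep_right Q q' \<union> steep_left Q q'))"
  have UN: "negligible (\<Union>i\<in>I. B i)" if "countable I" "\<And>i. i \<in> I \<Longrightarrow> negligible (B i)" for I :: "real set" and B :: "real \<Rightarrow> real set"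
    using that by (intro negligible_countable_Union) auto
  have "negligible N" unfolding N_def
  proof (intro UN)
    show "countable (\<rat> \<inter> {0::real..})" by (intro countable_Int1 countable_rat)
    show "countable {q' \<in> \<rat> \<inter> {0..}. M < q + q'}" for q
      by (rule countable_subset[OF _ countable_rat]) auto
    fix q q' assume q: "q \<in> \<rat> \<inter> {0..}" "q' \<in> {q' \<in> \<rat> \<inter> {0..}. M < q + q'}"
    have "negligible (S \<inter> S')" if "S = steep_right P q \<or> S = steep_left P q"
      "S' = steep_right Q q' \<or> S' = steep_left Q q'" for S S'
      using negligible_steep_Int[OF mono(1) cont(1) mono(2) cont(2) PQ _ _ _ K(2) that] q by auto
    then show "negligible ((steep_right P q \<union> steep_left P q) \<inter> (steep_right Q q' \<union> steep_left Q q'))"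
      by (simp add: Int_Un_distrib Int_Un_distrib2)
  qed
  then have "AE t in lebesgue. t \<notin> N" by (simp add: negligible_iff_null_sets AE_not_in)
  then have "AE t in lborel. t \<notin> N" by (simp add: AE_completion_iff)
  moreover have "F differentiable (at t)" if t: "t \<notin> N" for t
  proof -
    let ?SP = "\<lambda>q. steep_right P q \<union> steep_left P q" and ?SQ = "\<lambda>q. steep_right Q q \<union> steep_left Q q"
    \<comment> \<open>D is the larger of the two upper Dini derivatives of P at t, approached
      through rational levels; it is the candidate for the derivative.\<close>
    define A where "A = {q \<in> \<rat>. 0 \<le> q \<and> t \<in> ?SP q}"
    define D where "D = Sup A"
    have A_le: "q \<le> M" if "q \<in> A" for q
    proof -
      from that have "t \<in> ?SP q" by (simp add: A_def)
      then obtain h where "h > 0" "P (t + h) - P t > q * h \<or> P t - P (t - h) > q * h"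
        unfolding steep_right_def steep_left_def by (auto dest!: spec[of _ 1])
      then have "q * h < M * h" using inc[of h t] K
        by (auto simp: P_def M_def algebra_simps abs_le_iff) 
      then show ?thesis using \<open>h > 0\<close> by simp
    qed
    \<comment> \<open>This is where the surplus slope enters: P rises by at least h over an interval
      of length h.\<close>
    have "0 \<in> A"
    proof -
      have "t \<in> steep_right P 0" unfolding steep_right_def
      proof (intro CollectI allI impI)
        fix \<delta> :: real assume "\<delta> > 0"
        have "F t - F (t + \<delta>/2) \<le> K * (\<delta>/2)" using inc(1)[of "\<delta>/2" t] \<open>\<delta> > 0\<close> unfolding abs_le_iff by linarith
        moreover have "P (t + \<delta>/2) - P t = F (t + \<delta>/2) - F t + K * (\<delta>/2) + \<delta>/2"
          by (simp add: P_def algebra_simps)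
        ultimately have "0 < P (t + \<delta>/2) - P t" using \<open>\<delta> > 0\<close> by linarith
        then show "\<exists>h>0. h < \<delta> \<and> 0 * h < P (t + h) - P t"
          using \<open>\<delta> > 0\<close> by (intro exI[of _ "\<delta>/2"]) auto
      qed
      then show ?thesis by (simp add: A_def)
    qed
    have bdd: "bdd_above A" using A_le by (auto simp: bdd_above_def)
    have D: "0 \<le> D" "D \<le> M" 
      using cSup_upper[OF \<open>0 \<in> A\<close> bdd] cSup_least[of A M] A_le \<open>0 \<in> A\<close> by (auto simp: D_def)
    have up: "\<exists>\<delta>>0. \<forall>h. 0 < h \<and> h < \<delta> \<longrightarrow> P (t + h) - P t \<le> (D + e) * h \<and> P t - P (t - h) \<le> (D + e) * h"
      if "e > 0" for e
    proof -
      obtain q where q: "q \<in> \<rat>" "D < q" "q < D + e" using Rats_dense_in_real[of D "D + e"] \<open>e > 0\<close> by auto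
      have "q \<notin> A" using q cSup_upper[OF _ bdd] by (force simp: D_def)
      then have "t \<notin> ?SP q" using q D by (auto simp: A_def)
      then have "t \<notin> steep_right P q" "t \<notin> steep_left P q" by auto
      then obtain \<delta>1 \<delta>2 where \<delta>: "\<delta>1 > 0" "\<forall>h. 0 < h \<longrightarrow> h < \<delta>1 \<longrightarrow> P (t + h) - P t \<le> q * h"
        "\<delta>2 > 0" "\<forall>h. 0 < h \<longrightarrow> h < \<delta>2 \<longrightarrow> P t - P (t - h) \<le> q * h"
        by (elim not_steep_rightD[elim_format] not_steep_leftD[elim_format] exE conjE) (rule that)
      have "q * h \<le> (D + e) * h" if "h > 0" for h using that q by (intro mult_right_mono) auto
      then have "P (t + h) - P t \<le> (D + e) * h \<and> P t - P (t - h) \<le> (D + e) * h"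
        if "0 < h" "h < \<delta>1" "h < \<delta>2" for h
        using \<delta>(2,4)[rule_format, of h] that by (meson order_trans)
      then show ?thesis using \<delta>(1,3) by (intro exI[of _ "min \<delta>1 \<delta>2"]) auto
    qed
    have low: "\<exists>\<delta>>0. \<forall>h. 0 < h \<and> h < \<delta> \<longrightarrow> P (t + h) - P t \<ge> (D - e) * h \<and> P t - P (t - h) \<ge> (D - e) * h"
      if "e > 0" for e
    proof -
      obtain q where q: "q \<in> A" "D - e / 2 < q"
        using less_cSup_iff[OF _ bdd, of "D - e/2"] \<open>0 \<in> A\<close> \<open>e > 0\<close> by (auto simp: D_def)
      \<comment> \<open>With q + q' > M, t cannot be steep for Q at level q'. Since q' exceeds M - q
        by less than e/2 and q > D - e/2, the resulting lower bound M - q' for the slopes of P is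
        above D - e.\<close>
      obtain q' where q': "q' \<in> \<rat>" "M - q < q'" "q' < M - q + e / 2"
        using Rats_dense_in_real[of "M - q" "M - q + e/2"] \<open>e > 0\<close> by auto
      have "q' \<ge> 0" using q' A_le[OF q(1)] by simp
      have "t \<notin> ?SQ q'"
      proof
        assume "t \<in> ?SQ q'"
        then have "t \<in> N" unfolding N_def using q q' \<open>q' \<ge> 0\<close>
          by (intro UN_I[of q] UN_I[of q']) (auto simp: A_def)
        then show False using t by simp
      qed
      then have "t \<notin> steep_right Q q'" "t \<notin> steep_left Q q'" by auto
      then obtain \<delta>1 \<delta>2 where \<delta>: "\<delta>1 > 0" "\<forall>h. 0 < h \<longrightarrow> h < \<delta>1 \<longrightarrow> Q (t + h) - Q t \<le> q' * h"
        "\<delta>2 > 0" "\<forall>h. 0 < h \<longrightarrow> h < \<delta>2 \<longrightarrow> Q t - Q (t - h) \<le> q' * h"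
        by (elim not_steep_rightD[elim_format] not_steep_leftD[elim_format] exE conjE) (rule that)
      have le: "(D - e) * h \<le> M * h - q' * h" if "h > 0" for h
        using mult_right_mono[of "D - e" "M - q'" h] that q q' by (simp add: left_diff_distrib)
      have "M * (t + h) = M * t + M * h" "M * (t - h) = M * t - M * h" for h by (simp_all add: algebra_simps)
      then have "P (t + h) - P t = M * h - (Q (t + h) - Q t)" "P t - P (t - h) = M * h - (Q t - Q (t - h))" for h
        using PQ[of "t + h"] PQ[of t] PQ[of "t - h"] by (simp_all add: algebra_simps)
      then have "P (t + h) - P t \<ge> (D - e) * h \<and> P t - P (t - h) \<ge> (D - e) * h"
        if "0 < h" "h < \<delta>1" "h < \<delta>2" for h
        using \<delta>(2,4)[rule_format, of h] le[of h] that by simp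
      then show ?thesis using \<delta>(1,3) by (intro exI[of _ "min \<delta>1 \<delta>2"]) auto
    qed
    have "(P has_field_derivative D) (at t)"
      unfolding has_field_derivative_iff
    proof (rule LIM_I)
      fix e :: real assume "e > 0"
      then obtain \<delta>1 \<delta>2 where \<delta>: "\<delta>1 > 0" "\<delta>2 > 0"
        "\<And>h. 0 < h \<and> h < \<delta>1 \<Longrightarrow> P (t + h) - P t \<le> (D + e/2) * h \<and> P t - P (t - h) \<le> (D + e/2) * h"
        "\<And>h. 0 < h \<and> h < \<delta>2 \<Longrightarrow> P (t + h) - P t \<ge> (D - e/2) * h \<and> P t - P (t - h) \<ge> (D - e/2) * h"
        using up[of "e/2"] low[of "e/2"] by (metis half_gt_zero)
      have "norm ((P x - P t) / (x - t) - D) < e" if x: "x \<noteq> t" "norm (x - t) < min \<delta>1 \<delta>2" for x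
      proof (cases "x > t")
        case True
        then have "(D - e/2) * (x - t) \<le> P x - P t" "P x - P t \<le> (D + e/2) * (x - t)"
          using \<delta>(3,4)[of "x - t"] x by auto
        then have "D - e/2 \<le> (P x - P t) / (x - t)" "(P x - P t) / (x - t) \<le> D + e/2"
          using True by (simp_all add: pos_le_divide_eq pos_divide_le_eq)
        then show ?thesis using \<open>e > 0\<close> unfolding real_norm_def by linarith
      next
        case False
        then have xt: "x < t" using x by simp
        then have "(D - e/2) * (t - x) \<le> P t - P x" "P t - P x \<le> (D + e/2) * (t - x)"
          using \<delta>(3,4)[of "t - x"] x by auto
        then have "D - e/2 \<le> (P t - P x) / (t - x)" "(P t - P x) / (t - x) \<le> D + e/2"
          using xt by (simp_all add: pos_le_divide_eq pos_divide_le_eq)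
        moreover have "(P x - P t) / (x - t) = (P t - P x) / (t - x)"
          by (metis minus_diff_eq minus_divide_divide)
        ultimately show ?thesis using \<open>e > 0\<close> unfolding real_norm_def by linarith
      qed
      then show "\<exists>s>0. \<forall>x. x \<noteq> t \<and> norm (x - t) < s \<longrightarrow> norm ((P x - P t) / (x - t) - D) < e"
        using \<delta>(1,2) by (intro exI[of _ "min \<delta>1 \<delta>2"]) auto
    qed
    then have "((\<lambda>t. P t - (K + 1) * t) has_field_derivative (D - (K + 1))) (at t)"
      by (auto intro!: derivative_eq_intros)
    moreover have "(\<lambda>t. P t - (K + 1) * t) = F" by (simp add: P_def fun_eq_iff)
    ultimately show ?thesis using differentiableI[OF has_field_derivative_imp_has_derivative] by metis
  qed
  ultimately show ?thesis by (auto elim: eventually_mono)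
qed

lemma lipschitz_differentiable_AE:
  fixes F :: "real \<Rightarrow> 'b::euclidean_space"
  assumes "K-lipschitz_on UNIV F"
  shows "AE t in lborel. F differentiable (at t)"
proof -
  have "AE t in lborel. (\<lambda>t. F t \<bullet> i) differentiable (at t)" if "i \<in> Basis" for i
  proof (rule lipschitz_real_differentiable_AE[of K], rule lipschitz_onI)
    fix s t
    have "\<bar>(F s - F t) \<bullet> i\<bar> \<le> norm (F s - F t)" using that by (rule Basis_le_norm)
    also have "\<dots> \<le> K * dist s t" using lipschitz_onD[OF assms, of s t] by (simp add: dist_norm)
    finally show "dist (F s \<bullet> i) (F t \<bullet> i) \<le> K * dist s t"
      by (simp add: dist_real_def inner_diff_left)
  qed (use lipschitz_on_nonneg[OF assms] in simp)
  then have "AE t in lborel. \<forall>i\<in>Basis. (\<lambda>t. F t \<bullet> i) differentiable (at t)"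
    by (simp add: AE_ball_countable countable_finite)
  then show ?thesis by (simp add: differentiable_componentwise_within[symmetric])
qed

text \<open>By Cousin's lemma there is a tagged partition into small intervals: those tagged outside \<open>N\<close>
  contribute at most \<open>(M + \<epsilon>) * (b - a)\<close>, those tagged in \<open>N\<close> lie in an open set of small measure.\<close>

lemma absolutely_continuous_growth:
  fixes \<Psi> :: "real \<Rightarrow> real"
  assumes ac: "absolutely_continuous_on_interval a b \<Psi>" and "a \<le> b" and N: "N \<in> null_sets lborel"
    and growth: "\<And>t \<epsilon>. t \<in> {a..b} - N \<Longrightarrow> \<epsilon> > 0 \<Longrightarrow> \<exists>\<delta>>0. \<forall>u v.
      a \<le> u \<and> u \<le> t \<and> t \<le> v \<and> v \<le> b \<and> t - u < \<delta> \<and> v - t < \<delta> \<longrightarrow> \<Psi> v - \<Psi> u \<le> (M + \<epsilon>) * (v - u)"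
    and "0 \<le> M"
  shows "\<Psi> b - \<Psi> a \<le> M * (b - a)"
proof -
  have "\<Psi> b - \<Psi> a \<le> M * (b - a) + e * (b - a + 1)" if "e > 0" for e
  proof -
    obtain d where d: "d > 0" and acd: "\<And>(n::nat) s t. \<forall>i<n. a \<le> s i \<and> s i \<le> t i \<and> t i \<le> b \<Longrightarrow>
        \<forall>i<n. \<forall>j<n. i \<noteq> j \<longrightarrow> {s i<..<t i} \<inter> {s j<..<t j} = {} \<Longrightarrow> (\<Sum>i<n. t i - s i) < d \<Longrightarrow>
        (\<Sum>i<n. norm (\<Psi> (t i) - \<Psi> (s i))) < e"
      by (rule absolutely_continuous_on_intervalE[OF ac \<open>e > 0\<close>]) (rule that)
    obtain U where U: "open U" "N \<subseteq> U" "emeasure lborel (U - N) < d"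
      using outer_regular_lborel[of N d] null_setsD2[OF N] d by (metis sets_lborel)
    have "emeasure lborel U = emeasure lborel (U - N)"
      using N U emeasure_Diff_null_set[of N lborel U] by auto
    then have Ud: "emeasure lborel U < d" using U by simp
    then have Uf: "U \<in> fmeasurable lborel" using U by (intro fmeasurableI) (auto intro: less_trans)
    have Um: "measure lborel U < d" using Ud Uf d by (simp add: emeasure_eq_measure2 fmeasurableD2 ennreal_less_iff)
    \<comment> \<open>Admissible radii of the gauge: a tag in N needs its ball inside U, a tag in
      {a..b} outside N needs the growth estimate at scale r, and for any other tag every positive
      radius will do.\<close>
    define good where "good t r \<longleftrightarrow> r > 0 \<and> (t \<in> N \<longrightarrow> ball t r \<subseteq> U) \<and>
      (t \<in> {a..b} - N \<longrightarrow> (\<forall>u v. a \<le> u \<and> u \<le> t \<and> t \<le> v \<and> v \<le> b \<and> t - u < r \<and> v - t < r \<longrightarrow>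
        \<Psi> v - \<Psi> u \<le> (M + e) * (v - u)))" for t r
    have "\<exists>r. good t r" for t
    proof (cases "t \<in> N")
      case True
      then have "\<exists>r>0. ball t r \<subseteq> U" using U by (meson open_contains_ball subsetD)
      then show ?thesis using True by (auto simp: good_def)
    next
      case False
      show ?thesis
      proof (cases "t \<in> {a..b}")
        case True
        then have "t \<in> {a..b} - N" using False by simp
        from growth[OF this \<open>e > 0\<close>] obtain r where "r > 0" "\<forall>u v. a \<le> u \<and> u \<le> t \<and> t \<le> v \<and> v \<le> b \<and>
          t - u < r \<and> v - t < r \<longrightarrow> \<Psi> v - \<Psi> u \<le> (M + e) * (v - u)" by (elim exE conjE) (rule that)
        then show ?thesis using False unfolding good_def by (intro exI[of _ r] conjI impI) simp_all
      next
        case out: False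
        then show ?thesis using False unfolding good_def by (intro exI[of _ 1]) auto
      qed
    qed
    then obtain g where g: "good t (g t)" for t by metis
    have gN: "ball t (g t) \<subseteq> U" if "t \<in> N" for t using g[of t] that by (simp add: good_def)
    have gI: "\<Psi> v - \<Psi> u \<le> (M + e) * (v - u)"
      if "t \<in> {a..b} - N" "a \<le> u" "u \<le> t" "t \<le> v" "v \<le> b" "t - u < g t" "v - t < g t" for t u v
      using g[of t] that unfolding good_def by blast
    have "g t > 0" for t using g[of t] by (simp add: good_def)
    then have "gauge (\<lambda>t. ball t (g t))" by (simp add: gauge_def)
    then obtain p where p: "p tagged_division_of {a..b}" "(\<lambda>t. ball t (g t)) fine p"
      using fine_division_exists_real by blast
    have fin: "finite p" using p(1) by (rule tagged_division_of_finite)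
    have cell: "\<exists>u v. K = {u..v} \<and> a \<le> u \<and> u \<le> x \<and> x \<le> v \<and> v \<le> b \<and> Inf K = u \<and> Sup K = v
      \<and> {u..v} \<subseteq> ball x (g x)" if "(x, K) \<in> p" for x K
    proof -
      obtain u v where K: "K = cbox u v" using p(1) \<open>(x, K) \<in> p\<close> by blast
      have "x \<in> K" "K \<subseteq> {a..b}" using tagged_division_ofD(2,3)[OF p(1) that] by auto
      moreover have "K \<subseteq> ball x (g x)" using p(2) that by (auto simp: fine_def)
      ultimately show ?thesis using K by (intro exI[of _ u] exI[of _ v]) auto
    qed
    let ?lo = "\<lambda>z::real \<times> real set. Inf (snd z)" and ?hi = "\<lambda>z::real \<times> real set. Sup (snd z)"
    have cell': "snd z = {?lo z..?hi z} \<and> a \<le> ?lo z \<and> ?lo z \<le> fst z \<and> fst z \<le> ?hi z \<and> ?hi z \<le> b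
      \<and> {?lo z..?hi z} \<subseteq> ball (fst z) (g (fst z))" if "z \<in> p" for z
      using cell[of "fst z" "snd z"] that by (metis prod.collapse)
    have disj: "{?lo z<..<?hi z} \<inter> {?lo w<..<?hi w} = {}" if "z \<in> p" "w \<in> p" "z \<noteq> w" for z w
    proof -
      have "interior (snd z) \<inter> interior (snd w) = {}"
        using tagged_division_ofD(5)[OF p(1), of "fst z" "snd z" "fst w" "snd w"] that by simp
      then show ?thesis using cell'[OF that(1)] cell'[OF that(2)] by (metis interior_atLeastAtMost_real)
    qed
    define pN where "pN = {z \<in> p. fst z \<in> N}"
    have pN: "finite pN" "pN \<subseteq> p" using fin by (auto simp: pN_def)
    \<comment> \<open>The open cells tagged in N are disjoint and lie in U, so their total length is
      below d; absolute continuity then bounds the sum of their increments by e.\<close>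
    have sumN: "(\<Sum>z\<in>pN. \<Psi> (?hi z) - \<Psi> (?lo z)) \<le> e"
    proof -
      obtain \<phi> where \<phi>: "bij_betw \<phi> {..<card pN} pN"
        using ex_bij_betw_nat_finite[OF pN(1)] by (auto simp: atLeast0LessThan)
      have \<phi>p: "\<phi> i \<in> p" "\<phi> i \<in> pN" if "i < card pN" for i
        using \<phi> that pN(2) by (auto simp: bij_betw_def)
      have lborel_Ioo: "{u<..<v} \<in> fmeasurable lborel" for u v :: real
        by (rule fmeasurableI) (cases "u \<le> v"; simp)+
      have "(\<Sum>z\<in>pN. ?hi z - ?lo z) = (\<Sum>z\<in>pN. measure lborel {?lo z<..<?hi z})"
        using cell' pN(2) by (intro sum.cong) force+
      also have "\<dots> = measure lborel (\<Union>z\<in>pN. {?lo z<..<?hi z})"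
      proof (rule measure_UNION'[symmetric])
        show "pairwise (\<lambda>z w. disjnt {?lo z<..<?hi z} {?lo w<..<?hi w}) pN"
          unfolding pairwise_def disjnt_def using disj pN(2) by blast
      qed (use pN in \<open>simp_all add: lborel_Ioo\<close>)
      also have "\<dots> \<le> measure lborel U"
      proof (rule measure_mono_fmeasurable[OF _ _ Uf])
        have "{?lo z<..<?hi z} \<subseteq> U" if "z \<in> pN" for z
        proof -
          have "{?lo z<..<?hi z} \<subseteq> {?lo z..?hi z}" by auto
          also have "\<dots> \<subseteq> U" using cell'[of z] gN[of "fst z"] that pN(2) by (auto simp: pN_def)
          finally show ?thesis .
        qed
        then show "(\<Union>z\<in>pN. {?lo z<..<?hi z}) \<subseteq> U" by blast
      qed (use pN in auto)
      finally have "(\<Sum>z\<in>pN. ?hi z - ?lo z) < d" using Um by simp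
      then have lt: "(\<Sum>i<card pN. ?hi (\<phi> i) - ?lo (\<phi> i)) < d"
        by (simp add: sum.reindex_bij_betw[OF \<phi>, of "\<lambda>z. ?hi z - ?lo z"])
      have "\<phi> i \<noteq> \<phi> j" if "i < card pN" "j < card pN" "i \<noteq> j" for i j
        using \<phi> that by (auto simp: bij_betw_def inj_on_def)
      then have "\<forall>i<card pN. \<forall>j<card pN. i \<noteq> j \<longrightarrow>
          {?lo (\<phi> i)<..<?hi (\<phi> i)} \<inter> {?lo (\<phi> j)<..<?hi (\<phi> j)} = {}"
        using disj \<phi>p(1) by blast
      moreover have "\<forall>i<card pN. a \<le> ?lo (\<phi> i) \<and> ?lo (\<phi> i) \<le> ?hi (\<phi> i) \<and> ?hi (\<phi> i) \<le> b"
        using cell' \<phi>p(1) by (meson order_trans)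
      ultimately have "(\<Sum>i<card pN. norm (\<Psi> (?hi (\<phi> i)) - \<Psi> (?lo (\<phi> i)))) < e"
        using lt by (intro acd)
      then have "(\<Sum>z\<in>pN. norm (\<Psi> (?hi z) - \<Psi> (?lo z))) < e"
        by (simp only: sum.reindex_bij_betw[OF \<phi>, of "\<lambda>z. norm (\<Psi> (?hi z) - \<Psi> (?lo z))"])
      moreover have "(\<Sum>z\<in>pN. \<Psi> (?hi z) - \<Psi> (?lo z)) \<le> (\<Sum>z\<in>pN. norm (\<Psi> (?hi z) - \<Psi> (?lo z)))"
        by (intro sum_mono) simp
      ultimately show ?thesis by simp
    qed
    have "(\<Sum>z\<in>p - pN. \<Psi> (?hi z) - \<Psi> (?lo z)) \<le> (\<Sum>z\<in>p - pN. (M + e) * (?hi z - ?lo z))"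
    proof (rule sum_mono)
      fix z assume z: "z \<in> p - pN"
      then have c: "a \<le> ?lo z" "?lo z \<le> fst z" "fst z \<le> ?hi z" "?hi z \<le> b" "{?lo z..?hi z} \<subseteq> ball (fst z) (g (fst z))"
        using cell'[of z] by auto
      have "?lo z \<in> {?lo z..?hi z}" "?hi z \<in> {?lo z..?hi z}" using c by auto
      then have "?lo z \<in> ball (fst z) (g (fst z))" "?hi z \<in> ball (fst z) (g (fst z))" using c(5) by blast+
      then have "fst z - ?lo z < g (fst z)" "?hi z - fst z < g (fst z)" by (auto simp: dist_real_def)
      moreover have "fst z \<in> {a..b} - N" using z c by (auto simp: pN_def)
      ultimately show "\<Psi> (?hi z) - \<Psi> (?lo z) \<le> (M + e) * (?hi z - ?lo z)"
        using gI[of "fst z"] c by simp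
    qed
    \<comment> \<open>The cells tagged in N are put back only to make the lengths add up to b - a;
      their terms are nonnegative because 0 \<le> M.\<close>
    also have "\<dots> \<le> (\<Sum>z\<in>p. (M + e) * (?hi z - ?lo z))"
      using fin cell' \<open>0 \<le> M\<close> \<open>e > 0\<close> by (intro sum_mono2) (force intro!: mult_nonneg_nonneg)+
    also have "\<dots> = (M + e) * (b - a)"
      using additive_tagged_division_1[OF \<open>a \<le> b\<close> p(1), of "\<lambda>x. x"]
      by (simp add: sum_distrib_left[symmetric] case_prod_unfold)
    finally have "(\<Sum>z\<in>p - pN. \<Psi> (?hi z) - \<Psi> (?lo z)) \<le> (M + e) * (b - a)" .
    moreover have "\<Psi> b - \<Psi> a = (\<Sum>z\<in>p. \<Psi> (?hi z) - \<Psi> (?lo z))"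
      using additive_tagged_division_1[OF \<open>a \<le> b\<close> p(1), of \<Psi>] by (simp add: case_prod_unfold)
    moreover have "\<dots> = (\<Sum>z\<in>p - pN. \<Psi> (?hi z) - \<Psi> (?lo z)) + (\<Sum>z\<in>pN. \<Psi> (?hi z) - \<Psi> (?lo z))"
      by (rule sum.subset_diff[OF pN(2) fin])
    ultimately show ?thesis using sumN by (simp add: algebra_simps)
  qed
  from this[of "e / (b - a + 1)" for e] \<open>a \<le> b\<close>
  have "\<Psi> b - \<Psi> a \<le> M * (b - a) + e" if "e > 0" for e using that by simp
  then show ?thesis by (rule field_le_epsilon)
qed

section \<open>Tangent cones\<close>

text \<open>A form without sequences, in which one e controls the step, the distance and the
  relative error. Tangent vectors can then be produced from a single good point for each e.\<close>

lemma tangent_cone_iff: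
  "v \<in> tangent_cone Y x \<longleftrightarrow>
    (\<forall>e>0. \<exists>y\<in>Y. \<exists>\<delta>. 0 < \<delta> \<and> \<delta> < e \<and> dist y x < e \<and> norm (y - x - \<delta> *\<^sub>R v) \<le> e * \<delta>)"
proof
  assume "v \<in> tangent_cone Y x"
  then obtain y \<delta> where y: "\<And>k. y k \<in> Y" "y \<longlonglongrightarrow> x" "\<And>k. \<delta> k > 0" "\<delta> \<longlonglongrightarrow> 0"
    "(\<lambda>k. (y k - x) /\<^sub>R \<delta> k) \<longlonglongrightarrow> v" by (auto simp: tangent_cone_def)
  show "\<forall>e>0. \<exists>y\<in>Y. \<exists>\<delta>. 0 < \<delta> \<and> \<delta> < e \<and> dist y x < e \<and> norm (y - x - \<delta> *\<^sub>R v) \<le> e * \<delta>"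
  proof (intro allI impI)
    fix e :: real assume "e > 0"
    then have "\<forall>\<^sub>F k in sequentially. dist (y k) x < e \<and> dist (\<delta> k) 0 < e \<and> dist ((y k - x) /\<^sub>R \<delta> k) v < e"
      using y by (intro eventually_conj tendstoD)
    then obtain k where k: "dist (y k) x < e" "dist (\<delta> k) 0 < e" "dist ((y k - x) /\<^sub>R \<delta> k) v < e"
      by (auto dest: eventually_happens)
    have "y k - x - \<delta> k *\<^sub>R v = \<delta> k *\<^sub>R ((y k - x) /\<^sub>R \<delta> k - v)"
      using y(3)[of k] by (simp add: scaleR_diff_right)
    then have "norm (y k - x - \<delta> k *\<^sub>R v) = \<delta> k * norm ((y k - x) /\<^sub>R \<delta> k - v)"
      using y(3)[of k] by simp
    also have "\<dots> \<le> \<delta> k * e" using k y(3)[of k] by (intro mult_left_mono) (auto simp: dist_norm)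
    finally show "\<exists>y\<in>Y. \<exists>\<delta>. 0 < \<delta> \<and> \<delta> < e \<and> dist y x < e \<and> norm (y - x - \<delta> *\<^sub>R v) \<le> e * \<delta>"
      using y(1)[of k] y(3)[of k] k by (intro bexI[of _ "y k"] exI[of _ "\<delta> k"]) (auto simp: mult.commute)
  qed
next
  assume R: "\<forall>e>0. \<exists>y\<in>Y. \<exists>\<delta>. 0 < \<delta> \<and> \<delta> < e \<and> dist y x < e \<and> norm (y - x - \<delta> *\<^sub>R v) \<le> e * \<delta>"
  have "\<forall>k::nat. \<exists>y \<delta>. y \<in> Y \<and> 0 < \<delta> \<and> \<delta> < 1 / real (Suc k) \<and> dist y x < 1 / real (Suc k) \<and>
      norm (y - x - \<delta> *\<^sub>R v) \<le> 1 / real (Suc k) * \<delta>"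
  proof
    fix k :: nat
    have "0 < 1 / real (Suc k)" by simp
    from R[rule_format, OF this] show "\<exists>y \<delta>. y \<in> Y \<and> 0 < \<delta> \<and> \<delta> < 1 / real (Suc k) \<and>
        dist y x < 1 / real (Suc k) \<and> norm (y - x - \<delta> *\<^sub>R v) \<le> 1 / real (Suc k) * \<delta>" by blast
  qed
  then obtain y \<delta> where y: "\<And>k. y k \<in> Y" "\<And>k. 0 < \<delta> k" "\<And>k. \<delta> k < 1 / real (Suc k)"
    "\<And>k. dist (y k) x < 1 / real (Suc k)" "\<And>k. norm (y k - x - \<delta> k *\<^sub>R v) \<le> 1 / real (Suc k) * \<delta> k"
    by metis
  have lim: "(\<lambda>k. 1 / real (Suc k)) \<longlonglongrightarrow> 0" by (rule LIMSEQ_Suc[OF lim_inverse_n'])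
  have "y \<longlonglongrightarrow> x"
    by (rule metric_tendsto_imp_tendsto[OF lim]) (use y(4) in \<open>auto intro!: always_eventually simp: less_imp_le\<close>)
  moreover have "\<delta> \<longlonglongrightarrow> 0"
    by (rule metric_tendsto_imp_tendsto[OF lim])
       (use y(2,3) in \<open>auto intro!: always_eventually simp: less_imp_le dist_real_def abs_of_pos\<close>)
  moreover have "(\<lambda>k. (y k - x) /\<^sub>R \<delta> k) \<longlonglongrightarrow> v"
  proof (rule metric_tendsto_imp_tendsto[OF lim], intro always_eventually allI)
    fix k
    have "(y k - x) /\<^sub>R \<delta> k - v = (y k - x - \<delta> k *\<^sub>R v) /\<^sub>R \<delta> k"
      using y(2)[of k] by (simp add: scaleR_diff_right)
    then have "dist ((y k - x) /\<^sub>R \<delta> k) v = norm (y k - x - \<delta> k *\<^sub>R v) / \<delta> k"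
      using y(2)[of k] by (simp add: dist_norm divide_inverse mult.commute)
    also have "\<dots> \<le> 1 / real (Suc k)"
      unfolding pos_divide_le_eq[OF y(2)] by (rule y(5))
    finally show "dist ((y k - x) /\<^sub>R \<delta> k) v \<le> dist (1 / real (Suc k)) 0" by simp
  qed
  ultimately show "v \<in> tangent_cone Y x" unfolding tangent_cone_def using y(1,2) by blast
qed

lemma tangent_cone_scale:
  assumes v: "v \<in> tangent_cone Y x" and "c > 0"
  shows "c *\<^sub>R v \<in> tangent_cone Y x"
proof -
  from v obtain y \<delta> where y: "\<And>k. y k \<in> Y" "y \<longlonglongrightarrow> x" "\<And>k. \<delta> k > 0" "\<delta> \<longlonglongrightarrow> 0"
    "(\<lambda>k. (y k - x) /\<^sub>R \<delta> k) \<longlonglongrightarrow> v" by (auto simp: tangent_cone_def)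
  have "(\<lambda>k. \<delta> k / c) \<longlonglongrightarrow> 0" using tendsto_divide[OF y(4) tendsto_const[of c]] \<open>c > 0\<close> by simp
  moreover have "(\<lambda>k. (y k - x) /\<^sub>R (\<delta> k / c)) \<longlonglongrightarrow> c *\<^sub>R v"
    using tendsto_scaleR[OF tendsto_const[of c] y(5)] by (simp add: divide_inverse mult.commute)
  ultimately show ?thesis
    unfolding tangent_cone_def using y(1,2,3) \<open>c > 0\<close> 
    by (intro CollectI exI[of _ y] exI[of _ "\<lambda>k. \<delta> k / c"]) auto
qed

text \<open>If this failed, bad points at distance below 1/(k+1) would form a sequence contradicting
  the definition. The uniform radius is what allows a direction to be followed for a positive
  time.\<close>

lemma clarke_tangent_cone_uniform:
  assumes v: "v \<in> clarke_tangent_cone Y x" and "e > 0"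
  shows "\<exists>r>0. \<forall>y\<in>Y. dist y x < r \<longrightarrow> (\<exists>w\<in>tangent_cone Y y. norm (w - v) < e)"
proof (rule ccontr)
  assume contr: "\<not> ?thesis"
  have "\<exists>y. y \<in> Y \<and> dist y x < 1 / real (Suc k) \<and> (\<forall>w\<in>tangent_cone Y y. \<not> norm (w - v) < e)" for k
  proof -
    have "0 < 1 / real (Suc k)" by simp
    then show ?thesis using contr by blast
  qed
  then obtain y where y: "\<And>k. y k \<in> Y" "\<And>k. dist (y k) x < 1 / real (Suc k)"
    "\<And>k w. w \<in> tangent_cone Y (y k) \<Longrightarrow> \<not> norm (w - v) < e" by metis
  have lim: "(\<lambda>k. 1 / real (Suc k)) \<longlonglongrightarrow> 0" by (rule LIMSEQ_Suc[OF lim_inverse_n'])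
  have "y \<longlonglongrightarrow> x"
    by (rule metric_tendsto_imp_tendsto[OF lim]) (use y(2) in \<open>auto intro!: always_eventually simp: less_imp_le\<close>)
  then obtain w where "\<forall>\<^sub>F k in sequentially. w k \<in> tangent_cone Y (y k)" "w \<longlonglongrightarrow> v"
    using v y(1) unfolding clarke_tangent_cone_def by blast
  then have "\<forall>\<^sub>F k in sequentially. w k \<in> tangent_cone Y (y k) \<and> dist (w k) v < e"
    using \<open>e > 0\<close> by (intro eventually_conj tendstoD)
  then obtain k where "w k \<in> tangent_cone Y (y k)" "dist (w k) v < e" by (auto dest: eventually_happens)
  then show False using y(3) by (simp add: dist_norm)
qed

text \<open>A point of \<open>Y\<close> can be pushed along \<open>v\<close> for the whole time \<open>t\<close>: at a maximal reachable
  time one more tangential step would be possible.\<close>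

lemma tangent_direction_viable:
  assumes K: "compact (Y \<inter> cball x r)"
    and dir: "\<And>y. y \<in> Y \<inter> cball x r \<Longrightarrow> \<exists>w\<in>tangent_cone Y y. norm (w - v) < e"
    and z0: "z0 \<in> Y" and "0 < e" and t: "0 \<le> t" "dist z0 x + t * (norm v + e) < r"
  shows "\<exists>z\<in>Y. norm (z - z0 - t *\<^sub>R v) \<le> e * t"
proof -
  define S where "S = {0..t} \<times> (Y \<inter> cball x r)"
  define R where "R = S \<inter> {p. norm (snd p - z0 - fst p *\<^sub>R v) \<le> e * fst p}"
  have "compact S" unfolding S_def by (intro compact_Times K compact_Icc)
  moreover have "closed {p :: real \<times> 'a. norm (snd p - z0 - fst p *\<^sub>R v) \<le> e * fst p}"
    by (intro closed_Collect_le continuous_intros)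
  ultimately have "compact R" unfolding R_def by (rule compact_Int_closed)
  moreover have "(0, z0) \<in> R"
  proof -
    have "0 \<le> t * (norm v + e)" using t \<open>0 < e\<close> by (intro mult_nonneg_nonneg) auto
    then have "z0 \<in> cball x r" using t by (simp add: dist_commute)
    then show ?thesis using z0 t by (simp add: R_def S_def)
  qed
  ultimately have R: "compact (fst ` R)" "fst ` R \<noteq> {}"
    by (auto intro!: compact_continuous_image continuous_intros)
  obtain s where s: "s \<in> fst ` R" "\<And>u. u \<in> fst ` R \<Longrightarrow> u \<le> s"
    using compact_attains_sup[OF R] by blast
  then obtain z where z: "(s, z) \<in> R" by auto
  then have sz: "0 \<le> s" "s \<le> t" "z \<in> Y" "z \<in> cball x r" "norm (z - z0 - s *\<^sub>R v) \<le> e * s"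
    by (auto simp: R_def S_def)
  show ?thesis
  proof (cases "s = t")
    case True
    then show ?thesis using sz by auto
  next
    case False
    then have "s < t" using sz by simp
    have "dist z x < r"
    proof -
      have "z - z0 = (z - z0 - s *\<^sub>R v) + s *\<^sub>R v" by simp
      then have "dist z z0 \<le> e * s + s * norm v"
        using norm_triangle_ineq[of "z - z0 - s *\<^sub>R v" "s *\<^sub>R v"] sz by (simp add: dist_norm)
      also have "\<dots> \<le> t * (norm v + e)"
        using mult_right_mono[of s t "norm v + e"] sz \<open>0 < e\<close> by (simp add: algebra_simps)
      finally show ?thesis using dist_triangle[of z x z0] t by simp
    qed
    obtain w where w: "w \<in> tangent_cone Y z" "norm (w - v) < e" using dir sz by blast
    \<comment> \<open>The three entries keep the accumulated error within e per unit time, the new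
      time at most t and the new point in the ball.\<close>
    define e' where "e' = Min {e - norm (w - v), t - s, r - dist z x}"
    have "e' > 0" using w \<open>s < t\<close> \<open>dist z x < r\<close> by (simp add: e'_def)
    then obtain y \<delta> where y: "y \<in> Y" "0 < \<delta>" "\<delta> < e'" "dist y z < e'" "norm (y - z - \<delta> *\<^sub>R w) \<le> e' * \<delta>"
      using w(1) unfolding tangent_cone_iff by blast
    have e': "e' \<le> e - norm (w - v)" "e' \<le> t - s" "e' \<le> r - dist z x" by (auto simp: e'_def)
    have eq: "y - z0 - (s + \<delta>) *\<^sub>R v = (y - z - \<delta> *\<^sub>R w) + (z - z0 - s *\<^sub>R v) + \<delta> *\<^sub>R (w - v)"
      by (simp add: algebra_simps)
    have "norm (y - z0 - (s + \<delta>) *\<^sub>R v) \<le> norm (y - z - \<delta> *\<^sub>R w) + norm (z - z0 - s *\<^sub>R v) + norm (\<delta> *\<^sub>R (w - v))"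
      unfolding eq by (intro norm_triangle_mono order_refl)
    also have "\<dots> \<le> e' * \<delta> + e * s + \<delta> * norm (w - v)" using y sz by (intro add_mono) auto
    also have "\<dots> \<le> e * (s + \<delta>)"
      using mult_right_mono[OF e'(1), of \<delta>] y(2) by (simp add: algebra_simps)
    finally have "norm (y - z0 - (s + \<delta>) *\<^sub>R v) \<le> e * (s + \<delta>)" .
    moreover have "dist x y \<le> r" using dist_triangle[of x y z] y(4) e'(3) by (simp add: dist_commute)
    ultimately have "(s + \<delta>, y) \<in> R" using y sz e' by (simp add: R_def S_def)
    then have "s + \<delta> \<le> s" using s(2) by force
    then show ?thesis using y(2) by simp
  qed
qed

text \<open>For Clarke regular sets this gives convexity of the tangent cone: starting from a point close to
  \<open>x + \<delta> *\<^sub>R v\<close>, follow the direction \<open>w\<close> for time \<open>\<delta>\<close>.\<close>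

lemma tangent_cone_add_clarke:
  assumes K: "compact (Y \<inter> cball x r)" "r > 0"
    and v: "v \<in> tangent_cone Y x" and w: "w \<in> clarke_tangent_cone Y x"
  shows "v + w \<in> tangent_cone Y x"
  unfolding tangent_cone_iff
proof (intro allI impI)
  fix e :: real assume "e > 0"
  obtain r1 where r1: "r1 > 0" "\<And>y. y \<in> Y \<Longrightarrow> dist y x < r1 \<Longrightarrow> \<exists>u\<in>tangent_cone Y y. norm (u - w) < e/2"
    using clarke_tangent_cone_uniform[OF w, of "e/2"] \<open>e > 0\<close> by auto
  define r' where "r' = min r (r1/2)"
  have r': "r' > 0" "r' \<le> r" "r' < r1" using K r1 by (auto simp: r'_def)
  have "Y \<inter> cball x r' = (Y \<inter> cball x r) \<inter> cball x r'" using r' by auto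
  then have K': "compact (Y \<inter> cball x r')" using K(1) by (metis compact_Int_closed closed_cball)
  define c where "c = norm w + e/2 + 1"
  have c: "c \<ge> 1" using \<open>e > 0\<close> by (simp add: c_def)
  \<comment> \<open>The bound e/2 serves the final error estimate. The factor 2 * c provides room
    for both displacements, from x to y and then along w for time \<delta>, since each of them is
    below e' * c.\<close>
  define e' where "e' = min (e/2) (min r' e / (2 * c))"
  have "min r' e / (2 * c) > 0" using r' c \<open>e > 0\<close> by (intro divide_pos_pos) auto
  then have "e' > 0" using \<open>e > 0\<close> by (simp add: e'_def)
  have ce: "e' * (2 * c) \<le> min r' e"
  proof -
    have "e' \<le> min r' e / (2 * c)" by (simp add: e'_def)
    then show ?thesis using c by (simp add: pos_le_divide_eq)
  qed
  then obtain y \<delta> where y: "y \<in> Y" "0 < \<delta>" "\<delta> < e'" "dist y x < e'" "norm (y - x - \<delta> *\<^sub>R v) \<le> e' * \<delta>"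
    using v \<open>e' > 0\<close> unfolding tangent_cone_iff by blast
  have "e' \<le> e' * c" using c \<open>e' > 0\<close> by simp
  have \<delta>c: "\<delta> * c < e' * c" using y(3) c by (intro mult_strict_right_mono) auto
  have small: "dist y x + \<delta> * c < min r' e" using y(4) \<delta>c \<open>e' \<le> e' * c\<close> ce by simp
  have \<delta>w: "\<delta> * (norm w + e/2) \<le> \<delta> * c" using y by (intro mult_left_mono) (auto simp: c_def)
  have "\<exists>z\<in>Y. norm (z - y - \<delta> *\<^sub>R w) \<le> e/2 * \<delta>"
  proof (rule tangent_direction_viable[OF K'])
    show "dist y x + \<delta> * (norm w + e/2) < r'" using small \<delta>w by simp
  qed (use r1(2) r' y \<open>e > 0\<close> in \<open>auto simp: dist_commute\<close>)
  then obtain z where z: "z \<in> Y" "norm (z - y - \<delta> *\<^sub>R w) \<le> e/2 * \<delta>" by blast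
  have eq: "z - x - \<delta> *\<^sub>R (v + w) = (z - y - \<delta> *\<^sub>R w) + (y - x - \<delta> *\<^sub>R v)" by (simp add: algebra_simps)
  have "norm (z - x - \<delta> *\<^sub>R (v + w)) \<le> e/2 * \<delta> + e' * \<delta>"
    unfolding eq using z y by (intro norm_triangle_mono) auto
  also have "\<dots> \<le> e/2 * \<delta> + e/2 * \<delta>" using y by (intro add_mono mult_right_mono) (auto simp: e'_def)
  finally have "norm (z - x - \<delta> *\<^sub>R (v + w)) \<le> e * \<delta>" by (simp add: mult.commute)
  moreover have "dist z x < e"
  proof -
    have "z - y = (z - y - \<delta> *\<^sub>R w) + \<delta> *\<^sub>R w" by simp
    then have "dist z y \<le> e/2 * \<delta> + \<delta> * norm w"
      using norm_triangle_ineq[of "z - y - \<delta> *\<^sub>R w" "\<delta> *\<^sub>R w"] z y(2) by (simp add: dist_norm)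
    also have "\<dots> = \<delta> * (norm w + e/2)" by (simp add: algebra_simps)
    finally show ?thesis using dist_triangle[of z x y] small \<delta>w by simp
  qed
  moreover have "\<delta> < e" using y(3) \<open>e > 0\<close> by (simp add: e'_def)
  ultimately show "\<exists>y\<in>Y. \<exists>\<delta>. 0 < \<delta> \<and> \<delta> < e \<and> dist y x < e \<and> norm (y - x - \<delta> *\<^sub>R (v + w)) \<le> e * \<delta>"
    using z y by (intro bexI[of _ z] exI[of _ \<delta>]) auto
qed

text \<open>First-order expansion of \<tau> along the approximating points. Only a derivative within
  S is assumed, because transition maps are differentiated relative to the coordinate space. The
  lemma is used for the sets being compared and for the coordinate space itself.\<close>

lemma tangent_cone_has_derivative:
  assumes \<tau>: "(\<tau> has_derivative D) (at x within S)"
    and S: "Y \<inter> ball x d \<subseteq> S" "d > 0" and Y': "\<tau> ` (Y \<inter> ball x d) \<subseteq> Y'"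
    and v: "v \<in> tangent_cone Y x"
  shows "D v \<in> tangent_cone Y' (\<tau> x)"
  unfolding tangent_cone_iff
proof (intro allI impI)
  fix e :: real assume "e > 0"
  have "bounded_linear D" using \<tau> by (rule has_derivative_bounded_linear)
  then obtain B where B: "B > 0" "\<And>u. norm (D u) \<le> norm u * B" using bounded_linear.pos_bounded by blast
  \<comment> \<open>The differentiation error contributes e1 * (norm v + 1) and the image of the
    tangency error e1 * B, both per unit of \<delta>; c is the sum of these coefficients.\<close>
  define c where "c = norm v + B + 1"
  have c: "c \<ge> 1" using B by (simp add: c_def)
  define e1 where "e1 = min 1 (e / (4 * c))"
  have e1: "e1 > 0" "e1 \<le> 1" "e1 * c \<le> e/4"
  proof -
    have "e1 \<le> e / (4 * c)" by (simp add: e1_def)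
    then have "e1 * (4 * c) \<le> e" using c by (simp add: pos_le_divide_eq)
    then show "e1 * c \<le> e/4" by simp
  qed (use c \<open>e > 0\<close> in \<open>auto simp: e1_def\<close>)
  obtain d1 where d1: "d1 > 0" "\<And>y. y \<in> S \<Longrightarrow> norm (y - x) < d1 \<Longrightarrow>
      norm (\<tau> y - \<tau> x - D (y - x)) \<le> e1 * norm (y - x)"
    using \<tau> e1(1) unfolding has_derivative_within_alt by blast
  define e2 where "e2 = Min {e1, d, d1, e, e / (B + 1)}"
  have e2: "e2 > 0" "e2 \<le> e1" "e2 \<le> d" "e2 \<le> d1" "e2 \<le> e" using e1 d1 S B \<open>e > 0\<close> by (auto simp: e2_def)
  have eB: "e2 * (B + 1) \<le> e"
  proof -
    have "e2 \<le> e / (B + 1)" by (simp add: e2_def)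
    then show ?thesis using B by (simp add: pos_le_divide_eq)
  qed
  obtain y \<delta> where y: "y \<in> Y" "0 < \<delta>" "\<delta> < e2" "dist y x < e2" "norm (y - x - \<delta> *\<^sub>R v) \<le> e2 * \<delta>"
    using v e2(1) unfolding tangent_cone_iff by blast
  have yS: "y \<in> Y \<inter> ball x d" using y e2 by (auto simp: dist_commute)
  have 1: "norm (\<tau> y - \<tau> x - D (y - x)) \<le> e1 * norm (y - x)"
    using d1(2)[of y] yS S y e2 by (auto simp: dist_norm)
  interpret D: bounded_linear D by fact
  have "norm (y - x) \<le> norm (y - x - \<delta> *\<^sub>R v) + norm (\<delta> *\<^sub>R v)" using norm_triangle_sub by (metis diff_add_cancel norm_triangle_ineq)
  also have "\<dots> \<le> 1 * \<delta> + \<delta> * norm v" using y e2 e1 by (intro add_mono order_trans[OF y(5)] mult_right_mono) auto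
  finally have 2: "norm (y - x) \<le> \<delta> * (norm v + 1)" by (simp add: algebra_simps)
  have eq: "\<tau> y - \<tau> x - \<delta> *\<^sub>R D v = (\<tau> y - \<tau> x - D (y - x)) + D (y - x - \<delta> *\<^sub>R v)"
    by (simp add: D.diff D.scaleR)
  have "norm (\<tau> y - \<tau> x - \<delta> *\<^sub>R D v) \<le> e1 * norm (y - x) + norm (y - x - \<delta> *\<^sub>R v) * B"
    unfolding eq by (intro norm_triangle_mono 1 B(2))
  also have "\<dots> \<le> e1 * (\<delta> * (norm v + 1)) + (e1 * \<delta>) * B"
  proof (intro add_mono mult_left_mono mult_right_mono 2)
    show "norm (y - x - \<delta> *\<^sub>R v) \<le> e1 * \<delta>"
      using y(5) mult_right_mono[OF e2(2), of \<delta>] y(2) by linarith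
  qed (use e1 B in auto)
  also have "\<dots> = (e1 * c) * \<delta>" by (simp add: c_def algebra_simps)
  also have "\<dots> \<le> e * \<delta>" using e1(3) y(2) \<open>e > 0\<close> by (intro mult_right_mono) auto
  finally have "norm (\<tau> y - \<tau> x - \<delta> *\<^sub>R D v) \<le> e * \<delta>" .
  moreover have "dist (\<tau> y) (\<tau> x) < e"
  proof -
    have "norm (\<tau> y - \<tau> x) \<le> norm (\<tau> y - \<tau> x - D (y - x)) + norm (D (y - x))"
      by (metis diff_add_cancel norm_triangle_ineq)
    also have "\<dots> \<le> 1 * norm (y - x) + norm (y - x) * B"
      using 1 B(2)[of "y - x"] e1 by (intro add_mono order_trans[OF 1] mult_right_mono) auto
    also have "\<dots> = dist y x * (B + 1)" by (simp add: dist_norm algebra_simps)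
    also have "\<dots> < e2 * (B + 1)" using y B by (intro mult_strict_right_mono) auto
    finally show ?thesis using eB by (simp add: dist_norm)
  qed
  ultimately show "\<exists>z\<in>Y'. \<exists>\<delta>. 0 < \<delta> \<and> \<delta> < e \<and> dist z (\<tau> x) < e \<and> norm (z - \<tau> x - \<delta> *\<^sub>R D v) \<le> e * \<delta>"
    using Y' yS y e2 by (intro bexI[of _ "\<tau> y"] exI[of _ \<delta>]) auto
qed

text \<open>Points of the curve after and before t approximate \<open>v\<close> and
  \<open>- v\<close> respectively. Having both turns the normality inequality for a velocity into
  orthogonality.\<close>

lemma velocity_in_tangent_cone:
  assumes y: "(y has_vector_derivative v) (at t)" and "d > 0" and Y: "\<And>s. \<bar>s - t\<bar> < d \<Longrightarrow> y s \<in> Y"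
  shows "v \<in> tangent_cone Y (y t)" "- v \<in> tangent_cone Y (y t)"
proof -
  have "\<sigma> *\<^sub>R v \<in> tangent_cone Y (y t)" if \<sigma>: "\<bar>\<sigma>\<bar> = 1" for \<sigma> :: real
    unfolding tangent_cone_iff
  proof (intro allI impI)
    fix e :: real assume "e > 0"
    obtain d1 where d1: "d1 > 0" "\<And>s. norm (s - t) < d1 \<Longrightarrow> norm (y s - y t - (s - t) *\<^sub>R v) \<le> e * norm (s - t)"
      using y \<open>e > 0\<close> unfolding has_vector_derivative_def has_derivative_at_alt by blast
    have "isCont y t" using y has_vector_derivative_continuous by blast
    then obtain d2 where d2: "d2 > 0" "\<And>s. dist s t < d2 \<Longrightarrow> dist (y s) (y t) < e"
      using \<open>e > 0\<close> unfolding continuous_at_eps_delta by blast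
    define \<delta> where "\<delta> = Min {d, d1, d2, e} / 2"
    have "Min {d, d1, d2, e} > 0" using \<open>d > 0\<close> d1 d2 \<open>e > 0\<close> by simp
    moreover have "Min {d, d1, d2, e} \<le> d" "Min {d, d1, d2, e} \<le> d1" "Min {d, d1, d2, e} \<le> d2" "Min {d, d1, d2, e} \<le> e" by auto
    ultimately have \<delta>: "\<delta> > 0" "\<delta> < d" "\<delta> < d1" "\<delta> < d2" "\<delta> < e" unfolding \<delta>_def by linarith+
    let ?s = "t + \<delta> * \<sigma>"
    have s: "\<bar>?s - t\<bar> = \<delta>" using \<sigma> \<delta> by (simp add: abs_mult)
    have "norm (y ?s - y t - \<delta> *\<^sub>R (\<sigma> *\<^sub>R v)) \<le> e * \<delta>"
      using d1(2)[of ?s] s \<delta> by simp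
    moreover have "dist (y ?s) (y t) < e" using d2(2)[of ?s] s \<delta> by (simp add: dist_real_def)
    ultimately show "\<exists>z\<in>Y. \<exists>\<delta>. 0 < \<delta> \<and> \<delta> < e \<and> dist z (y t) < e \<and> norm (z - y t - \<delta> *\<^sub>R (\<sigma> *\<^sub>R v)) \<le> e * \<delta>"
      using Y[of ?s] s \<delta> by (intro bexI[of _ "y ?s"] exI[of _ \<delta>]) auto
  qed
  from this[of 1] this[of "- 1"] show "v \<in> tangent_cone Y (y t)" "- v \<in> tangent_cone Y (y t)" by auto
qed

text \<open>After division by the step \<delta> the quadratic term is of order \<delta> and vanishes
  in the limit. This recovers normal vectors from minimality and from the limiting variational
  inequality.\<close>

lemma tangent_cone_quadratic_bound:
  assumes \<phi>: "bounded_linear \<phi>" and "d > 0"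
    and bound: "\<And>z. z \<in> Y \<Longrightarrow> dist z x < d \<Longrightarrow> \<phi> (z - x) \<le> K * (norm (z - x))\<^sup>2"
    and w: "w \<in> tangent_cone Y x"
  shows "\<phi> w \<le> (0::real)"
proof -
  interpret bounded_linear \<phi> by fact
  from w obtain y \<delta> where y: "\<And>k. y k \<in> Y" "y \<longlonglongrightarrow> x" "\<And>k. \<delta> k > 0" "\<delta> \<longlonglongrightarrow> 0"
    and lim: "(\<lambda>k. (y k - x) /\<^sub>R \<delta> k) \<longlonglongrightarrow> w" by (auto simp: tangent_cone_def)
  let ?w = "\<lambda>k. (y k - x) /\<^sub>R \<delta> k"
  have "(\<lambda>k. \<phi> (?w k)) \<longlonglongrightarrow> \<phi> w" using lim by (rule tendsto)
  moreover have "(\<lambda>k. K * (norm (?w k))\<^sup>2 * \<delta> k) \<longlonglongrightarrow> K * (norm w)\<^sup>2 * 0"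
    by (intro tendsto_intros lim y(4))
  moreover have "\<forall>\<^sub>F k in sequentially. \<phi> (?w k) \<le> K * (norm (?w k))\<^sup>2 * \<delta> k"
    using tendstoD[OF y(2) \<open>d > 0\<close>]
  proof eventually_elim
    case (elim k)
    have "\<phi> (?w k) = \<phi> (y k - x) / \<delta> k" by (simp add: scaleR divide_inverse mult.commute)
    also have "\<dots> \<le> K * (norm (y k - x))\<^sup>2 / \<delta> k"
      using bound[OF y(1) elim] y(3)[of k] by (intro divide_right_mono) auto
    also have "\<dots> = K * (norm (?w k))\<^sup>2 * \<delta> k"
      using y(3)[of k] by (simp add: power2_eq_square divide_inverse)
    finally show ?case .
  qed
  ultimately show ?thesis using tendsto_le[OF sequentially_bot] by fastforce
qed

section \<open>Uniqueness in coordinates\<close>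

lemma absolutely_continuous_on_subinterval:
  assumes "absolutely_continuous_on_interval a b h" "a \<le> c" "d \<le> b"
  shows "absolutely_continuous_on_interval c d h"
  unfolding absolutely_continuous_on_interval_def
proof (intro allI impI)
  fix e :: real assume "e > 0"
  obtain \<delta> where \<delta>: "\<delta> > 0" "\<And>(n::nat) s t. \<forall>i<n. a \<le> s i \<and> s i \<le> t i \<and> t i \<le> b \<Longrightarrow>
        \<forall>i<n. \<forall>j<n. i \<noteq> j \<longrightarrow> {s i<..<t i} \<inter> {s j<..<t j} = {} \<Longrightarrow> (\<Sum>i<n. t i - s i) < \<delta> \<Longrightarrow>
        (\<Sum>i<n. norm (h (t i) - h (s i))) < e"
    by (rule absolutely_continuous_on_intervalE[OF assms(1) \<open>e > 0\<close>]) (rule that)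
  show "\<exists>\<delta>>0. \<forall>(n::nat) s t. (\<forall>i<n. c \<le> s i \<and> s i \<le> t i \<and> t i \<le> d) \<and>
        (\<forall>i<n. \<forall>j<n. i \<noteq> j \<longrightarrow> {s i<..<t i} \<inter> {s j<..<t j} = {}) \<and> (\<Sum>i<n. t i - s i) < \<delta>
        \<longrightarrow> (\<Sum>i<n. norm (h (t i) - h (s i))) < e"
  proof (intro exI[of _ \<delta>] conjI \<delta>(1) allI impI, elim conjE)
    fix n :: nat and s t :: "nat \<Rightarrow> real"
    assume "\<forall>i<n. c \<le> s i \<and> s i \<le> t i \<and> t i \<le> d"
      and *: "\<forall>i<n. \<forall>j<n. i \<noteq> j \<longrightarrow> {s i<..<t i} \<inter> {s j<..<t j} = {}" "(\<Sum>i<n. t i - s i) < \<delta>"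
    then have "\<forall>i<n. a \<le> s i \<and> s i \<le> t i \<and> t i \<le> b" using assms(2,3) by force
    then show "(\<Sum>i<n. norm (h (t i) - h (s i))) < e" using * by (intro \<delta>(2))
  qed
qed

text \<open>Two dominating functions are allowed because the energy of a difference depends on both
  solutions.\<close>

lemma absolutely_continuous_on_interval_dominated:
  fixes h1 :: "real \<Rightarrow> 'b::real_normed_vector" and h2 :: "real \<Rightarrow> 'c::real_normed_vector"
  assumes ac: "absolutely_continuous_on_interval a b h1" "absolutely_continuous_on_interval a b h2"
    and dom: "\<And>s t. a \<le> s \<Longrightarrow> s \<le> t \<Longrightarrow> t \<le> b \<Longrightarrow>
      norm (h t - h s) \<le> L * (norm (h1 t - h1 s) + norm (h2 t - h2 s))"
  shows "absolutely_continuous_on_interval a b h"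
  unfolding absolutely_continuous_on_interval_def
proof (intro allI impI)
  fix e :: real assume "e > 0"
  define e' where "e' = e / (2 * (\<bar>L\<bar> + 1))"
  have "e' > 0" using \<open>e > 0\<close> by (simp add: e'_def)
  obtain \<delta>1 where \<delta>1: "\<delta>1 > 0" "\<And>(n::nat) s t. \<forall>i<n. a \<le> s i \<and> s i \<le> t i \<and> t i \<le> b \<Longrightarrow>
        \<forall>i<n. \<forall>j<n. i \<noteq> j \<longrightarrow> {s i<..<t i} \<inter> {s j<..<t j} = {} \<Longrightarrow> (\<Sum>i<n. t i - s i) < \<delta>1 \<Longrightarrow>
        (\<Sum>i<n. norm (h1 (t i) - h1 (s i))) < e'"
    by (rule absolutely_continuous_on_intervalE[OF ac(1) \<open>e' > 0\<close>]) (rule that)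
  obtain \<delta>2 where \<delta>2: "\<delta>2 > 0" "\<And>(n::nat) s t. \<forall>i<n. a \<le> s i \<and> s i \<le> t i \<and> t i \<le> b \<Longrightarrow>
        \<forall>i<n. \<forall>j<n. i \<noteq> j \<longrightarrow> {s i<..<t i} \<inter> {s j<..<t j} = {} \<Longrightarrow> (\<Sum>i<n. t i - s i) < \<delta>2 \<Longrightarrow>
        (\<Sum>i<n. norm (h2 (t i) - h2 (s i))) < e'"
    by (rule absolutely_continuous_on_intervalE[OF ac(2) \<open>e' > 0\<close>]) (rule that)
  show "\<exists>\<delta>>0. \<forall>(n::nat) s t. (\<forall>i<n. a \<le> s i \<and> s i \<le> t i \<and> t i \<le> b) \<and>
        (\<forall>i<n. \<forall>j<n. i \<noteq> j \<longrightarrow> {s i<..<t i} \<inter> {s j<..<t j} = {}) \<and> (\<Sum>i<n. t i - s i) < \<delta>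
        \<longrightarrow> (\<Sum>i<n. norm (h (t i) - h (s i))) < e"
  proof (intro exI[of _ "min \<delta>1 \<delta>2"] conjI allI impI, goal_cases)
    case 1 then show ?case using \<delta>1(1) \<delta>2(1) by simp
  next
    case (2 n s t)
    then have "(\<Sum>i<n. norm (h1 (t i) - h1 (s i))) < e'" "(\<Sum>i<n. norm (h2 (t i) - h2 (s i))) < e'"
      using \<delta>1(2)[of n s t] \<delta>2(2)[of n s t] by auto
    then have S: "(\<Sum>i<n. norm (h1 (t i) - h1 (s i)) + norm (h2 (t i) - h2 (s i))) < 2 * e'" (is "?S < _")
      by (simp add: sum.distrib)
    have "(\<Sum>i<n. norm (h (t i) - h (s i))) \<le> (\<Sum>i<n. (\<bar>L\<bar> + 1) * (norm (h1 (t i) - h1 (s i)) + norm (h2 (t i) - h2 (s i))))"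
    proof (rule sum_mono)
      fix i assume "i \<in> {..<n}"
      then have "norm (h (t i) - h (s i)) \<le> L * (norm (h1 (t i) - h1 (s i)) + norm (h2 (t i) - h2 (s i)))"
        using 2 by (intro dom) auto
      also have "\<dots> \<le> (\<bar>L\<bar> + 1) * (norm (h1 (t i) - h1 (s i)) + norm (h2 (t i) - h2 (s i)))"
        by (intro mult_right_mono) auto
      finally show "norm (h (t i) - h (s i)) \<le> \<dots>" .
    qed
    also have "\<dots> = (\<bar>L\<bar> + 1) * ?S" by (simp add: sum_distrib_left)
    also have "\<dots> < (\<bar>L\<bar> + 1) * (2 * e')" using S by (intro mult_strict_left_mono) auto
    also have "\<dots> = e" by (simp add: e'_def field_simps)
    finally show ?case .
  qed
qed

lemma lipschitz_on_imp_absolutely_continuous: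
  fixes h :: "real \<Rightarrow> 'b::real_normed_vector"
  assumes "L-lipschitz_on {a..b} h"
  shows "absolutely_continuous_on_interval a b h"
proof (rule absolutely_continuous_on_interval_dominated[where ?h1.0 = "\<lambda>t. t" and ?h2.0 = "\<lambda>t. t" and L = L])
  show "absolutely_continuous_on_interval a b (\<lambda>t::real. t)"
    unfolding absolutely_continuous_on_interval_def
  proof (intro allI impI)
    fix e :: real assume "e > 0"
    show "\<exists>\<delta>>0. \<forall>(n::nat) s t. (\<forall>i<n. a \<le> s i \<and> s i \<le> t i \<and> t i \<le> b) \<and>
        (\<forall>i<n. \<forall>j<n. i \<noteq> j \<longrightarrow> {s i<..<t i} \<inter> {s j<..<t j} = {}) \<and> (\<Sum>i<n. t i - s i) < \<delta>
        \<longrightarrow> (\<Sum>i<n. norm (t i - s i)) < e"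
    proof (intro exI[of _ e] conjI \<open>e > 0\<close> allI impI)
      fix n :: nat and s t :: "nat \<Rightarrow> real"
      assume *: "(\<forall>i<n. a \<le> s i \<and> s i \<le> t i \<and> t i \<le> b) \<and>
        (\<forall>i<n. \<forall>j<n. i \<noteq> j \<longrightarrow> {s i<..<t i} \<inter> {s j<..<t j} = {}) \<and> (\<Sum>i<n. t i - s i) < e"
      then have "(\<Sum>i<n. norm (t i - s i)) = (\<Sum>i<n. t i - s i)" by (intro sum.cong) auto
      then show "(\<Sum>i<n. norm (t i - s i)) < e" using * by simp
    qed
  qed
  then show "absolutely_continuous_on_interval a b (\<lambda>t::real. t)" .
next
  fix s t assume "a \<le> s" "s \<le> t" "t \<le> b"
  then have "norm (h t - h s) \<le> L * norm (t - s)"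
    using lipschitz_onD[OF assms, of t s] by (simp add: dist_norm)
  also have "\<dots> \<le> L * (norm (t - s) + norm (t - s))"
    using lipschitz_on_nonneg[OF assms] by (intro mult_left_mono) auto
  finally show "norm (h t - h s) \<le> L * (norm (t - s) + norm (t - s))" .
qed

text \<open>Divide by 2 * \<epsilon> and let \<epsilon> tend to 0. The restriction \<epsilon> < 1
  lets the perturbation (1 - \<epsilon>) v of a minimiser v stay a positive multiple of v.\<close>

lemma quadratic_nonneg_imp:
  fixes a b :: real
  assumes "\<And>\<epsilon>. 0 < \<epsilon> \<Longrightarrow> \<epsilon> < 1 \<Longrightarrow> 0 \<le> 2 * \<epsilon> * a + \<epsilon>\<^sup>2 * b"
  shows "0 \<le> a"
proof (rule ccontr)
  assume "\<not> 0 \<le> a"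
  define \<epsilon> where "\<epsilon> = min (1/2) (- a / (\<bar>b\<bar> + 1))"
  have "- a / (\<bar>b\<bar> + 1) > 0" using \<open>\<not> 0 \<le> a\<close> by (intro divide_pos_pos) auto
  then have \<epsilon>: "0 < \<epsilon>" "\<epsilon> < 1" by (auto simp: \<epsilon>_def)
  have "\<epsilon> \<le> - a / (\<bar>b\<bar> + 1)" by (simp add: \<epsilon>_def)
  then have eb: "\<epsilon> * (\<bar>b\<bar> + 1) \<le> - a" by (subst (asm) pos_le_divide_eq) auto
  have "\<epsilon> * b \<le> \<epsilon> * (\<bar>b\<bar> + 1)" using \<epsilon> by (intro mult_left_mono) auto
  with eb have "2 * a + \<epsilon> * b < 0" using \<open>\<not> 0 \<le> a\<close> by linarith
  then have "\<epsilon> * (2 * a + \<epsilon> * b) < 0" using \<epsilon> by (intro mult_pos_neg) auto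
  then show False using assms[OF \<epsilon>] by (simp add: power2_eq_square algebra_simps)
qed

text \<open>A local coordinate representation of the problem around \<open>y0\<close>: \<open>B y\<close> is the metric at \<open>y\<close>,
  and the single constant \<open>K\<close> serves for all bounds.\<close>

locale projected_system =
  fixes Y :: "'e::euclidean_space set" and y0 :: 'e and r :: real
    and B :: "'e \<Rightarrow> 'e \<Rightarrow> 'e \<Rightarrow> real" and f :: "'e \<Rightarrow> 'e" and K :: real
  assumes r: "r > 0" and y0: "y0 \<in> Y" and K: "K \<ge> 1"
    and compact: "compact (Y \<inter> cball y0 r)"
    and B_bilinear: "\<And>y. y \<in> Y \<inter> cball y0 r \<Longrightarrow> bilinear (B y)"
    and B_sym: "\<And>y u w. y \<in> Y \<inter> cball y0 r \<Longrightarrow> B y u w = B y w u"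
    and B_pos: "\<And>y u. y \<in> Y \<inter> cball y0 r \<Longrightarrow> (norm u)\<^sup>2 \<le> K * B y u u"
    and B_bound: "\<And>y u w. y \<in> Y \<inter> cball y0 r \<Longrightarrow> \<bar>B y u w\<bar> \<le> K * norm u * norm w"
    and B_lip: "\<And>y z u w. y \<in> Y \<inter> cball y0 r \<Longrightarrow> z \<in> Y \<inter> cball y0 r \<Longrightarrow>
      \<bar>B y u w - B z u w\<bar> \<le> K * norm (y - z) * norm u * norm w"
    and f_bound: "\<And>y. y \<in> Y \<inter> cball y0 r \<Longrightarrow> norm (f y) \<le> K"
    and f_lip: "\<And>y z. y \<in> Y \<inter> cball y0 r \<Longrightarrow> z \<in> Y \<inter> cball y0 r \<Longrightarrow>
      norm (f y - f z) \<le> K * norm (y - z)"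
    and prox: "\<And>y z \<eta>. y \<in> Y \<inter> cball y0 r \<Longrightarrow> z \<in> Y \<inter> cball y0 r \<Longrightarrow>
      (\<And>w. w \<in> tangent_cone Y y \<Longrightarrow> inner \<eta> w \<le> 0) \<Longrightarrow>
      inner \<eta> (z - y) \<le> K * norm \<eta> * (norm (z - y))\<^sup>2"
    and cone_add: "\<And>y v w. y \<in> Y \<inter> cball y0 r \<Longrightarrow> v \<in> tangent_cone Y y \<Longrightarrow>
      w \<in> tangent_cone Y y \<Longrightarrow> v + w \<in> tangent_cone Y y"
begin

abbreviation Yr :: "'e set" where "Yr \<equiv> Y \<inter> cball y0 r"

text \<open>The variational characterisation of the projection onto a closed convex cone, by
  Moreau's decomposition: the residual f - v lies in the polar cone and is orthogonal to v. The
  estimates use this form; its equivalence with the minimisation is proved below.\<close>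

definition projected_velocity :: "'e \<Rightarrow> 'e \<Rightarrow> bool" where
  "projected_velocity y v \<longleftrightarrow> v \<in> tangent_cone Y y \<and>
     (\<forall>w\<in>tangent_cone Y y. B y (f y - v) w \<le> 0) \<and> B y (f y - v) v = 0"

lemma B_simps:
  assumes "y \<in> Yr"
  shows "B y (u + v) w = B y u w + B y v w" "B y w (u + v) = B y w u + B y w v"
    "B y (u - v) w = B y u w - B y v w" "B y w (u - v) = B y w u - B y w v"
    "B y (c *\<^sub>R u) w = c * B y u w" "B y w (c *\<^sub>R u) = c * B y w u"
    "B y (- u) w = - B y u w" "B y w (- u) = - B y w u"
  using B_bilinear[OF assms]
  by (simp_all add: bilinear_ladd bilinear_radd bilinear_lsub bilinear_rsub bilinear_lmul
      bilinear_rmul bilinear_lneg bilinear_rneg)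

lemma B_square_expand:
  assumes y: "y \<in> Yr"
  shows "B y (u + w) (u + w) = B y u u + 2 * B y u w + B y w w"
    "B y (u - w) (u - w) = B y u u - 2 * B y u w + B y w w"
  using B_sym[OF y, of w u] by (simp_all add: B_simps[OF y])

lemma K_powers: "1 \<le> K ^ n" "m \<le> n \<Longrightarrow> K ^ m \<le> K ^ n" "0 \<le> K ^ n" "0 < K"
  using K by (auto intro: one_le_power power_increasing)

text \<open>In one direction the square is expanded around v. In the other, a minimiser is perturbed
  in two ways inside the cone: adding \<epsilon> w uses \<open>cone_add\<close>, that is, convexity,
  and gives the inequality; shrinking v gives the missing half of the orthogonality.\<close>

lemma projected_velocity_iff_min:
  assumes y: "y \<in> Yr"
  shows "projected_velocity y v \<longleftrightarrow> v \<in> tangent_cone Y y \<and>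
    (\<forall>w\<in>tangent_cone Y y. B y (v - f y) (v - f y) \<le> B y (w - f y) (w - f y))"
proof
  assume pv: "projected_velocity y v"
  have "B y (v - f y) (v - f y) \<le> B y (w - f y) (w - f y)" if w: "w \<in> tangent_cone Y y" for w
  proof -
    have "B y (w - f y) (w - f y) = B y (v - f y) (v - f y) - 2 * B y (f y - v) w + 2 * B y (f y - v) v + B y (w - v) (w - v)"
      using B_sym[OF y, of w v] B_sym[OF y, of "f y" v] B_sym[OF y, of "f y" w] by (simp add: B_simps[OF y])
    moreover have "0 \<le> K * B y (w - v) (w - v)" using B_pos[OF y, of "w - v"] by (meson order_trans zero_le_power2)
    then have "0 \<le> B y (w - v) (w - v)" using K by (simp add: zero_le_mult_iff)
    moreover have "B y (f y - v) w \<le> 0" "B y (f y - v) v = 0" using pv w by (auto simp: projected_velocity_def)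
    ultimately show ?thesis by linarith
  qed
  then show "v \<in> tangent_cone Y y \<and> (\<forall>w\<in>tangent_cone Y y. B y (v - f y) (v - f y) \<le> B y (w - f y) (w - f y))"
    using pv by (simp add: projected_velocity_def)
next
  assume "v \<in> tangent_cone Y y \<and> (\<forall>w\<in>tangent_cone Y y. B y (v - f y) (v - f y) \<le> B y (w - f y) (w - f y))"
  then have v: "v \<in> tangent_cone Y y"
    and min: "\<And>w. w \<in> tangent_cone Y y \<Longrightarrow> B y (v - f y) (v - f y) \<le> B y (w - f y) (w - f y)" by auto
  have expand: "B y (v + \<epsilon> *\<^sub>R w - f y) (v + \<epsilon> *\<^sub>R w - f y) =
      B y (v - f y) (v - f y) + (2 * \<epsilon> * (- B y (f y - v) w) + \<epsilon>\<^sup>2 * B y w w)" for \<epsilon> w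
    using B_sym[OF y, of w v] B_sym[OF y, of "f y" w]
    by (simp add: B_simps[OF y] power2_eq_square algebra_simps)
  have 1: "B y (f y - v) w \<le> 0" if w: "w \<in> tangent_cone Y y" for w
  proof -
    have "0 \<le> - B y (f y - v) w"
    proof (rule quadratic_nonneg_imp)
      fix \<epsilon> :: real assume "0 < \<epsilon>"
      then have "v + \<epsilon> *\<^sub>R w \<in> tangent_cone Y y" by (intro cone_add y v tangent_cone_scale w)
      from min[OF this] show "0 \<le> 2 * \<epsilon> * (- B y (f y - v) w) + \<epsilon>\<^sup>2 * B y w w"
        unfolding expand by simp
    qed
    then show ?thesis by simp
  qed
  have "0 \<le> - B y (f y - v) (- v)"
  proof (rule quadratic_nonneg_imp)
    fix \<epsilon> :: real assume "0 < \<epsilon>" "\<epsilon> < 1"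
    then have "(1 - \<epsilon>) *\<^sub>R v \<in> tangent_cone Y y" by (intro tangent_cone_scale v) auto
    then have "v + \<epsilon> *\<^sub>R (- v) \<in> tangent_cone Y y" by (simp add: algebra_simps)
    from min[OF this] show "0 \<le> 2 * \<epsilon> * (- B y (f y - v) (- v)) + \<epsilon>\<^sup>2 * B y (- v) (- v)"
      unfolding expand by simp
  qed
  then have "0 \<le> B y (f y - v) v" by (simp add: B_simps[OF y])
  then show "projected_velocity y v"
    unfolding projected_velocity_def using v 1 by (auto intro: order_antisym)
qed

text \<open>Prox-regularity speaks of Euclidean normals, so u is replaced by the vector \<eta> that
  represents B y u in the inner product. The base point y of the metric is independent of the foot
  point x, since the catching-up scheme projects in the metric of the previous point.\<close>

lemma prox_metric:
  assumes y: "y \<in> Yr" and x: "x \<in> Yr" and z: "z \<in> Yr"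
    and normal: "\<And>w. w \<in> tangent_cone Y x \<Longrightarrow> B y u w \<le> 0"
  shows "B y u (z - x) \<le> K\<^sup>2 * norm u * (norm (z - x))\<^sup>2"
proof -
  define \<eta> where "\<eta> = (\<Sum>b\<in>Basis. B y u b *\<^sub>R b)"
  have lin: "linear (B y u)" using B_bilinear[OF y] by (simp add: bilinear_def)
  have \<eta>: "inner \<eta> w = B y u w" for w
  proof -
    have "B y u w = B y u (\<Sum>b\<in>Basis. (w \<bullet> b) *\<^sub>R b)" by (simp add: euclidean_representation)
    also have "\<dots> = (\<Sum>b\<in>Basis. (w \<bullet> b) * B y u b)"
      using lin by (simp add: linear_sum linear_scale)
    also have "\<dots> = inner \<eta> w" by (simp add: \<eta>_def inner_sum_left inner_commute[of w] mult.commute)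
    finally show ?thesis by simp
  qed
  have "norm \<eta> \<le> K * norm u"
  proof (cases "\<eta> = 0")
    case False
    have "norm \<eta> * norm \<eta> = B y u \<eta>" using \<eta>[of \<eta>] by (simp add: dot_square_norm power2_eq_square)
    also have "\<dots> \<le> K * norm u * norm \<eta>" using B_bound[OF y, of u \<eta>] by simp
    finally show ?thesis using False by simp
  qed (use K in simp)
  have "B y u (z - x) \<le> K * norm \<eta> * (norm (z - x))\<^sup>2"
    using prox[OF x z, of \<eta>] normal by (simp add: \<eta>)
  also have "\<dots> \<le> K * (K * norm u) * (norm (z - x))\<^sup>2"
    using \<open>norm \<eta> \<le> K * norm u\<close> K by (intro mult_right_mono mult_left_mono) auto
  finally show ?thesis by (simp add: power2_eq_square mult.assoc)
qed

text \<open>Orthogonality replaces B (f - v) (f - v) by B (f - v) f, which is linear in f - v. The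
  uniform bound on the normal parts makes the prox-regularity error quadratic in the distance with a
  fixed constant.\<close>

lemma projected_velocity_bound:
  assumes y: "y \<in> Yr" and v: "projected_velocity y v"
  shows "norm (f y - v) \<le> K ^ 3" "norm v \<le> 2 * K ^ 3"
proof -
  have "(norm (f y - v))\<^sup>2 \<le> K * B y (f y - v) (f y - v)" by (rule B_pos[OF y])
  also have "B y (f y - v) (f y - v) = B y (f y - v) (f y)"
    using v B_simps(4)[OF y, of "f y - v" "f y" v] by (simp add: projected_velocity_def)
  also have "\<dots> \<le> K * norm (f y - v) * norm (f y)" using B_bound[OF y, of "f y - v" "f y"] by simp
  also have "\<dots> \<le> K * norm (f y - v) * K" using f_bound[OF y] K by (intro mult_left_mono) auto
  finally have *: "(norm (f y - v))\<^sup>2 \<le> K ^ 3 * norm (f y - v)"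
    using K by (simp add: power3_eq_cube mult_ac)
  show "norm (f y - v) \<le> K ^ 3"
  proof (cases "norm (f y - v) = 0")
    case False
    then show ?thesis using * by (simp add: power2_eq_square)
  qed (use K in simp)
  then show "norm v \<le> 2 * K ^ 3"
    using norm_triangle_ineq4[of "f y" "f y - v"] f_bound[OF y] K_powers(2)[of 1 3] by simp
qed

text \<open>v - w is split into f p - f q and the two normal parts, each of which is paired with the
  direction to the other point and bounded by \<open>prox_metric\<close>. The four contributions
  K^2, K^5, K^5 and K^4 are each at most K^5.\<close>

lemma one_sided_lipschitz:
  assumes p: "p \<in> Yr" and q: "q \<in> Yr"
    and v: "projected_velocity p v" and w: "projected_velocity q w"
  shows "B p (v - w) (p - q) \<le> 4 * K ^ 5 * (norm (p - q))\<^sup>2"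
proof -
  let ?e = "p - q" and ?n = "(norm (p - q))\<^sup>2"
  have "B p (v - w) ?e = B p (f p - f q) ?e + B p (f p - v) (q - p) + B p (f q - w) ?e"
    by (simp add: B_simps[OF p])
  also have "B p (f p - f q) ?e \<le> K ^ 2 * ?n"
  proof -
    have "B p (f p - f q) ?e \<le> K * norm (f p - f q) * norm ?e" using B_bound[OF p, of "f p - f q" ?e] by simp
    also have "\<dots> \<le> K * (K * norm ?e) * norm ?e"
      using f_lip[OF p q] K by (intro mult_right_mono mult_left_mono) auto
    finally show ?thesis by (simp add: power2_eq_square mult_ac)
  qed
  also have "B p (f p - v) (q - p) \<le> K ^ 5 * ?n"
  proof -
    have "B p (f p - v) (q - p) \<le> K\<^sup>2 * norm (f p - v) * (norm (q - p))\<^sup>2"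
      using v by (intro prox_metric p q) (auto simp: projected_velocity_def)
    also have "\<dots> \<le> K\<^sup>2 * K ^ 3 * (norm (q - p))\<^sup>2"
      using projected_velocity_bound(1)[OF p v] K by (intro mult_right_mono mult_left_mono) auto
    also have "\<dots> = K ^ 5 * ?n" by (simp add: norm_minus_commute power_add[symmetric])
    finally show ?thesis .
  qed
  \<comment> \<open>f q - w is normal for the metric at q; moving it to the metric at p costs the
    K^4 term.\<close>
  also have "B p (f q - w) ?e \<le> K ^ 5 * ?n + K ^ 4 * ?n"
  proof -
    have "B q (f q - w) (p - q) \<le> K\<^sup>2 * norm (f q - w) * ?n"
      using w by (intro prox_metric p q) (auto simp: projected_velocity_def)
    also have "\<dots> \<le> K\<^sup>2 * K ^ 3 * ?n"
      using projected_velocity_bound(1)[OF q w] K by (intro mult_right_mono mult_left_mono) auto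
    also have "\<dots> = K ^ 5 * ?n" by (simp add: power_add[symmetric])
    finally have "B q (f q - w) (p - q) \<le> K ^ 5 * ?n" .
    moreover have "B p (f q - w) ?e - B q (f q - w) ?e \<le> K * norm ?e * norm (f q - w) * norm ?e"
      using B_lip[OF p q, of "f q - w" ?e] by simp
    moreover have "K * norm ?e * norm (f q - w) * norm ?e \<le> K * norm ?e * K ^ 3 * norm ?e"
      using projected_velocity_bound(1)[OF q w] K by (intro mult_right_mono mult_left_mono) auto
    moreover have "K * norm ?e * K ^ 3 * norm ?e = K ^ 4 * ?n"
      by (simp add: power2_eq_square power_numeral_reduce mult_ac)
    ultimately show ?thesis by linarith
  qed
  finally have "B p (v - w) ?e \<le> K ^ 2 * ?n + K ^ 5 * ?n + (K ^ 5 * ?n + K ^ 4 * ?n)" by simp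
  moreover have "K ^ 2 * ?n \<le> K ^ 5 * ?n" "K ^ 4 * ?n \<le> K ^ 5 * ?n"
    by (intro mult_right_mono K_powers(2); simp)+
  ultimately show ?thesis by simp
qed

text \<open>The energy with the metric frozen at u1 t is differentiable, with derivative at most 8 *
  K^5 times the squared distance. Unfreezing the metric costs about K * norm v1 \<le> 2 * K^4 times
  the squared distance per unit time, by Lipschitz continuity alone. Together this is the factor 10
  * K^5.\<close>

lemma difference_energy_growth:
  assumes u1: "(u1 has_vector_derivative v1) (at t)" and u2: "(u2 has_vector_derivative v2) (at t)"
    and v1: "projected_velocity (u1 t) v1" and v2: "projected_velocity (u2 t) v2"
    and Yr: "\<And>s. s \<in> {a..b} \<Longrightarrow> u1 s \<in> Yr" "\<And>s. s \<in> {a..b} \<Longrightarrow> u2 s \<in> Yr"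
    and t: "t \<in> {a..b}" and M: "10 * K ^ 5 * (norm (u1 t - u2 t))\<^sup>2 \<le> M" and "\<epsilon> > 0"
  shows "\<exists>\<delta>>0. \<forall>c d. a \<le> c \<and> c \<le> t \<and> t \<le> d \<and> d \<le> b \<and> t - c < \<delta> \<and> d - t < \<delta> \<longrightarrow>
    B (u1 d) (u1 d - u2 d) (u1 d - u2 d) - B (u1 c) (u1 c - u2 c) (u1 c - u2 c) \<le> (M + \<epsilon>) * (d - c)"
proof -
  let ?p = "u1 t" and ?e = "\<lambda>s. u1 s - u2 s"
  let ?h = "\<lambda>s. B ?p (?e s) (?e s)" and ?\<Phi> = "\<lambda>s. B (u1 s) (?e s) (?e s)"
  have p: "?p \<in> Yr" "u2 t \<in> Yr" using Yr t by auto
  have bb: "bounded_bilinear (B ?p)" using B_bilinear[OF p(1)] by (simp add: bilinear_conv_bounded_bilinear)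
  have e': "(?e has_vector_derivative (v1 - v2)) (at t)" using u1 u2 by (rule has_vector_derivative_diff)
  define h' where "h' = 2 * B ?p (v1 - v2) (?e t)"
  have h': "(?h has_real_derivative h') (at t)"
  proof -
    have "(?h has_vector_derivative (B ?p (?e t) (v1 - v2) + B ?p (v1 - v2) (?e t))) (at t)"
      by (rule bounded_bilinear.has_vector_derivative[OF bb e' e'])
    then show ?thesis
      unfolding h'_def B_sym[OF p(1), of "?e t"] by (simp add: has_real_derivative_iff_has_vector_derivative)
  qed
  have h'_le: "h' \<le> 8 * K ^ 5 * (norm (?e t))\<^sup>2"
    unfolding h'_def using one_sided_lipschitz[OF p v1 v2] by simp
  \<comment> \<open>The denominator collects the coefficients of all remainder terms, so that
    together they amount to at most \<epsilon>.\<close>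
  define \<epsilon>1 where "\<epsilon>1 = min 1 (\<epsilon> / (1 + K * (norm v1 + (norm (?e t))\<^sup>2 + 1)))"
  have den: "1 + K * (norm v1 + (norm (?e t))\<^sup>2 + 1) > 0" using K by (intro add_pos_nonneg mult_nonneg_nonneg) auto
  have \<epsilon>1: "\<epsilon>1 > 0" "\<epsilon>1 \<le> 1" "\<epsilon>1 * (1 + K * (norm v1 + (norm (?e t))\<^sup>2 + 1)) \<le> \<epsilon>"
  proof -
    have "\<epsilon>1 \<le> \<epsilon> / (1 + K * (norm v1 + (norm (?e t))\<^sup>2 + 1))" by (simp add: \<epsilon>1_def)
    then show "\<epsilon>1 * (1 + K * (norm v1 + (norm (?e t))\<^sup>2 + 1)) \<le> \<epsilon>" using den by (simp add: pos_le_divide_eq)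
  qed (use den \<open>\<epsilon> > 0\<close> in \<open>auto simp: \<epsilon>1_def\<close>)
  obtain \<delta>1 where \<delta>1: "\<delta>1 > 0" "\<And>s. norm (s - t) < \<delta>1 \<Longrightarrow> norm (?h s - ?h t - h' * (s - t)) \<le> \<epsilon>1 * norm (s - t)"
    using h' \<epsilon>1(1) unfolding has_field_derivative_def has_derivative_at_alt by blast
  obtain \<delta>2 where \<delta>2: "\<delta>2 > 0" "\<And>s. norm (s - t) < \<delta>2 \<Longrightarrow> norm (u1 s - u1 t - (s - t) *\<^sub>R v1) \<le> \<epsilon>1 * norm (s - t)"
    using u1 \<epsilon>1(1) unfolding has_vector_derivative_def has_derivative_at_alt by blast
  have "isCont (\<lambda>s. (norm (?e s))\<^sup>2) t"
    using has_vector_derivative_continuous[OF e'] by (intro continuous_power continuous_norm)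
  then obtain \<delta>3 where \<delta>3: "\<delta>3 > 0" "\<And>s. dist s t < \<delta>3 \<Longrightarrow> dist ((norm (?e s))\<^sup>2) ((norm (?e t))\<^sup>2) < \<epsilon>1"
    using \<epsilon>1(1) unfolding continuous_at_eps_delta by blast
  define \<delta> where "\<delta> = min \<delta>1 (min \<delta>2 \<delta>3)"
  have est: "\<bar>?\<Phi> s - ?\<Phi> t - h' * (s - t)\<bar> \<le> (2 * K ^ 4 * (norm (?e t))\<^sup>2 + \<epsilon>) * \<bar>s - t\<bar>"
    if s: "s \<in> {a..b}" "\<bar>s - t\<bar> < \<delta>" for s
  proof -
    have u1s: "norm (u1 s - u1 t) \<le> (norm v1 + \<epsilon>1) * \<bar>s - t\<bar>"
    proof -
      have "norm (u1 s - u1 t) \<le> norm (u1 s - u1 t - (s - t) *\<^sub>R v1) + norm ((s - t) *\<^sub>R v1)"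
        by (metis diff_add_cancel norm_triangle_ineq)
      also have "\<dots> \<le> \<epsilon>1 * norm (s - t) + norm ((s - t) *\<^sub>R v1)"
        using \<delta>2(2)[of s] s by (intro add_right_mono) (simp add: \<delta>_def)
      finally show ?thesis by (simp add: distrib_right distrib_left add.commute mult.commute)
    qed
    have es: "(norm (?e s))\<^sup>2 \<le> (norm (?e t))\<^sup>2 + \<epsilon>1"
      using \<delta>3(2)[of s] s by (simp add: \<delta>_def dist_real_def)
    have "\<bar>?\<Phi> s - ?h s\<bar> \<le> K * norm (u1 s - u1 t) * norm (?e s) * norm (?e s)"
      by (rule B_lip) (use Yr s t in auto)
    also have "\<dots> = K * (norm (u1 s - u1 t) * (norm (?e s))\<^sup>2)" by (simp add: power2_eq_square mult_ac)
    also have "\<dots> \<le> K * (((norm v1 + \<epsilon>1) * \<bar>s - t\<bar>) * ((norm (?e t))\<^sup>2 + \<epsilon>1))"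
      using K \<epsilon>1 by (intro mult_left_mono mult_mono u1s es) auto
    also have "\<dots> = (K * norm v1 * (norm (?e t))\<^sup>2 + \<epsilon>1 * (K * (norm v1 + (norm (?e t))\<^sup>2 + \<epsilon>1))) * \<bar>s - t\<bar>"
      by (simp add: algebra_simps)
    finally have 1: "\<bar>?\<Phi> s - ?h s\<bar> \<le> \<dots>" .
    have 2: "\<bar>?h s - ?h t - h' * (s - t)\<bar> \<le> \<epsilon>1 * \<bar>s - t\<bar>" using \<delta>1(2)[of s] s by (simp add: \<delta>_def)
    have "\<bar>?\<Phi> s - ?\<Phi> t - h' * (s - t)\<bar> \<le> \<bar>?\<Phi> s - ?h s\<bar> + \<bar>?h s - ?h t - h' * (s - t)\<bar>"
      by linarith
    also have "\<dots> \<le> (K * norm v1 * (norm (?e t))\<^sup>2 + \<epsilon>1 * (K * (norm v1 + (norm (?e t))\<^sup>2 + \<epsilon>1))) * \<bar>s - t\<bar> +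
        \<epsilon>1 * \<bar>s - t\<bar>" by (intro add_mono 1 2)
    also have "\<dots> = (K * norm v1 * (norm (?e t))\<^sup>2 + \<epsilon>1 * (1 + K * (norm v1 + (norm (?e t))\<^sup>2 + \<epsilon>1))) * \<bar>s - t\<bar>"
      by (simp add: algebra_simps)
    also have "\<dots> \<le> (2 * K ^ 4 * (norm (?e t))\<^sup>2 + \<epsilon>) * \<bar>s - t\<bar>"
    proof (intro mult_right_mono add_mono)
      have "K * norm v1 \<le> K * (2 * K ^ 3)"
        using projected_velocity_bound(2)[OF p(1) v1] K by (intro mult_left_mono) auto
      also have "\<dots> = 2 * K ^ 4" by (simp add: power_numeral_reduce)
      finally show "K * norm v1 \<le> 2 * K ^ 4" .
      have "\<epsilon>1 * (1 + K * (norm v1 + (norm (?e t))\<^sup>2 + \<epsilon>1)) \<le> \<epsilon>1 * (1 + K * (norm v1 + (norm (?e t))\<^sup>2 + 1))"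
        using \<epsilon>1 K by (intro mult_left_mono add_left_mono) auto
      then show "\<epsilon>1 * (1 + K * (norm v1 + (norm (?e t))\<^sup>2 + \<epsilon>1)) \<le> \<epsilon>" using \<epsilon>1(3) by simp
    qed auto
    finally show ?thesis .
  qed
  have coef: "h' + (2 * K ^ 4 * (norm (?e t))\<^sup>2 + \<epsilon>) \<le> M + \<epsilon>"
  proof -
    have "2 * K ^ 4 * (norm (?e t))\<^sup>2 \<le> 2 * K ^ 5 * (norm (?e t))\<^sup>2"
      using K_powers(2)[of 4 5] by (intro mult_right_mono) auto
    then show ?thesis using h'_le M by simp
  qed
  have "\<delta> > 0" using \<delta>1 \<delta>2 \<delta>3 by (simp add: \<delta>_def)
  then show ?thesis
  proof (intro exI[of _ \<delta>] conjI allI impI; (elim conjE)?)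
    fix c d assume cd: "a \<le> c" "c \<le> t" "t \<le> d" "d \<le> b" "t - c < \<delta>" "d - t < \<delta>"
    let ?R = "2 * K ^ 4 * (norm (?e t))\<^sup>2 + \<epsilon>"
    have "?\<Phi> d - ?\<Phi> t \<le> h' * (d - t) + ?R * (d - t)" using est[of d] cd t by simp
    moreover have "?\<Phi> t - ?\<Phi> c \<le> h' * (t - c) + ?R * (t - c)"
      using est[of c] cd t by (simp add: algebra_simps)
    ultimately have "?\<Phi> d - ?\<Phi> c \<le> (h' + ?R) * (d - c)" by (simp add: algebra_simps)
    also have "\<dots> \<le> (M + \<epsilon>) * (d - c)" using coef cd by (intro mult_right_mono) auto
    finally show "?\<Phi> d - ?\<Phi> c \<le> (M + \<epsilon>) * (d - c)" .
  qed
qed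

text \<open>Let s be the time of greatest distance. The growth estimate on {a..s} bounds the energy
  at s by 10 * K^5 * (s - a) times the squared distance at s; coercivity contributes another K. With
  s - a \<le> 1 / (20 * K^6) the squared distance is at most half of itself.\<close>

theorem local_uniqueness:
  assumes ac: "absolutely_continuous_on_interval a b u1" "absolutely_continuous_on_interval a b u2"
    and cont: "continuous_on {a..b} u1" "continuous_on {a..b} u2"
    and Yr: "\<And>s. s \<in> {a..b} \<Longrightarrow> u1 s \<in> Yr" "\<And>s. s \<in> {a..b} \<Longrightarrow> u2 s \<in> Yr"
    and start: "u1 a = u2 a" and N: "N \<in> null_sets lborel"
    and v1: "\<And>t. t \<in> {a<..<b} - N \<Longrightarrow> \<exists>v. projected_velocity (u1 t) v \<and> (u1 has_vector_derivative v) (at t)"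
    and v2: "\<And>t. t \<in> {a<..<b} - N \<Longrightarrow> \<exists>v. projected_velocity (u2 t) v \<and> (u2 has_vector_derivative v) (at t)"
    and ab: "a \<le> b" "b \<le> a + 1 / (20 * K ^ 6)" and t: "t \<in> {a..b}"
  shows "u1 t = u2 t"
proof -
  let ?e = "\<lambda>s. u1 s - u2 s"
  let ?\<Phi> = "\<lambda>s. B (u1 s) (?e s) (?e s)"
  have "continuous_on {a..b} (\<lambda>s. (norm (?e s))\<^sup>2)" by (intro continuous_intros cont)
  then obtain s where s: "s \<in> {a..b}" "\<And>t. t \<in> {a..b} \<Longrightarrow> (norm (?e t))\<^sup>2 \<le> (norm (?e s))\<^sup>2"
    using continuous_attains_sup[of "{a..b}" "\<lambda>s. (norm (?e s))\<^sup>2"] ab by auto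
  define M where "M = 10 * K ^ 5 * (norm (?e s))\<^sup>2"
  have e_le: "norm (?e t) \<le> 2 * r" if "t \<in> {a..b}" for t
    using Yr[OF that] dist_triangle2[of "u1 t" "u2 t" y0] by (auto simp: dist_norm[symmetric] dist_commute)
  have ac\<Phi>: "absolutely_continuous_on_interval a s ?\<Phi>"
  proof (rule absolutely_continuous_on_interval_dominated)
    show "absolutely_continuous_on_interval a s u1" "absolutely_continuous_on_interval a s u2"
      using ac s by (auto elim!: absolutely_continuous_on_subinterval)
    fix c d assume cd: "a \<le> c" "c \<le> d" "d \<le> s"
    then have mem: "c \<in> {a..b}" "d \<in> {a..b}" using s by auto
    note c = Yr(1)[OF mem(1)] and d = Yr(1)[OF mem(2)]
    have "?\<Phi> d - ?\<Phi> c = (B (u1 d) (?e d) (?e d) - B (u1 c) (?e d) (?e d)) +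
        (B (u1 c) (?e d - ?e c) (?e d) + B (u1 c) (?e c) (?e d - ?e c))"
      by (simp add: B_simps[OF c])
    then have "\<bar>?\<Phi> d - ?\<Phi> c\<bar> \<le> \<bar>B (u1 d) (?e d) (?e d) - B (u1 c) (?e d) (?e d)\<bar> +
        (\<bar>B (u1 c) (?e d - ?e c) (?e d)\<bar> + \<bar>B (u1 c) (?e c) (?e d - ?e c)\<bar>)" by linarith
    also have "\<dots> \<le> K * norm (u1 d - u1 c) * norm (?e d) * norm (?e d) +
        (K * norm (?e d - ?e c) * norm (?e d) + K * norm (?e c) * norm (?e d - ?e c))"
      by (intro add_mono B_lip B_bound c d)
    also have "\<dots> \<le> K * norm (u1 d - u1 c) * (2 * r) * (2 * r) +
        (K * norm (?e d - ?e c) * (2 * r) + K * (2 * r) * norm (?e d - ?e c))"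
      using e_le[OF mem(1)] e_le[OF mem(2)] K r
      by (intro add_mono mult_mono mult_left_mono mult_right_mono) auto
    also have "\<dots> \<le> K * norm (u1 d - u1 c) * (2 * r) * (2 * r) +
        (K * (norm (u1 d - u1 c) + norm (u2 d - u2 c)) * (2 * r) + K * (2 * r) * (norm (u1 d - u1 c) + norm (u2 d - u2 c)))"
    proof -
      have "?e d - ?e c = (u1 d - u1 c) - (u2 d - u2 c)" by simp
      then have "norm (?e d - ?e c) \<le> norm (u1 d - u1 c) + norm (u2 d - u2 c)"
        by (metis norm_triangle_ineq4)
      then show ?thesis using K r by (intro add_mono mult_left_mono mult_right_mono) auto
    qed
    also have "\<dots> \<le> (K * (4 * r * r + 4 * r)) * (norm (u1 d - u1 c) + norm (u2 d - u2 c))"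
      using K r by (simp add: algebra_simps)
    finally show "norm (?\<Phi> d - ?\<Phi> c) \<le> (K * (4 * r * r + 4 * r)) * (norm (u1 d - u1 c) + norm (u2 d - u2 c))"
      by simp
  qed
  have "?\<Phi> s - ?\<Phi> a \<le> M * (s - a)"
  proof (rule absolutely_continuous_growth[OF ac\<Phi>])
    \<comment> \<open>Velocities are known only at interior times, so the two end points join the
      null set.\<close>
    show "N \<union> {a, s} \<in> null_sets lborel" by (intro null_sets.Un N) (simp add: countable_imp_null_set_lborel)
    fix t \<epsilon> :: real assume t: "t \<in> {a..s} - (N \<union> {a, s})" and "\<epsilon> > 0"
    then have tab: "t \<in> {a<..<b} - N" "t \<in> {a..s}" "t \<in> {a..b}" using s(1) by auto
    obtain w1 w2 where w: "projected_velocity (u1 t) w1" "(u1 has_vector_derivative w1) (at t)"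
      "projected_velocity (u2 t) w2" "(u2 has_vector_derivative w2) (at t)"
      using v1[OF tab(1)] v2[OF tab(1)] by blast
    have "10 * K ^ 5 * (norm (u1 t - u2 t))\<^sup>2 \<le> M"
      unfolding M_def using s(2)[OF tab(3)] K by (intro mult_left_mono) auto
    then show "\<exists>\<delta>>0. \<forall>c d. a \<le> c \<and> c \<le> t \<and> t \<le> d \<and> d \<le> s \<and> t - c < \<delta> \<and> d - t < \<delta> \<longrightarrow>
        ?\<Phi> d - ?\<Phi> c \<le> (M + \<epsilon>) * (d - c)"
      using difference_energy_growth[OF w(2,4,1,3), of a s M \<epsilon>] Yr s(1) tab(2) \<open>\<epsilon> > 0\<close> by auto
  qed (use s K in \<open>auto simp: M_def\<close>)
  moreover have "?\<Phi> a = 0"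
  proof -
    have "\<bar>?\<Phi> a\<bar> \<le> K * norm (?e a) * norm (?e a)" by (rule B_bound) (use Yr ab in auto)
    then show ?thesis using start by simp
  qed
  ultimately have "?\<Phi> s \<le> M * (s - a)" by simp
  have "(norm (?e s))\<^sup>2 \<le> K * ?\<Phi> s" by (rule B_pos) (use Yr s in auto)
  also have "\<dots> \<le> K * (M * (s - a))" using \<open>?\<Phi> s \<le> M * (s - a)\<close> K by (intro mult_left_mono) auto
  also have "\<dots> = 10 * K ^ 6 * (s - a) * (norm (?e s))\<^sup>2"
    by (simp add: M_def power_numeral_reduce mult_ac)
  also have "\<dots> \<le> 1/2 * (norm (?e s))\<^sup>2"
  proof (rule mult_right_mono)
    have "s - a \<le> 1 / (20 * K ^ 6)" using s(1) ab by simp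
    then show "10 * K ^ 6 * (s - a) \<le> 1/2"
      using K_powers(1)[of 6] by (subst (asm) pos_le_divide_eq) (auto simp: mult_ac)
  qed simp
  finally have "(norm (?e s))\<^sup>2 \<le> 0" by simp
  then have "(norm (?e t))\<^sup>2 \<le> 0" using s(2)[OF t] by linarith
  then show ?thesis by simp
qed

end

section \<open>Existence in coordinates by the catching-up scheme\<close>

text \<open>\<open>clamp01 (t / h - real i)\<close> is the fraction of step i completed at time
  t.\<close>

definition clamp01 :: "real \<Rightarrow> real" where
  "clamp01 a = max 0 (min 1 a)"

lemma sum_clamp01: "(\<Sum>i<N. clamp01 (a - real i)) = max 0 (min (real N) a)"
  by (induction N) (auto simp: clamp01_def)

lemma clamp01_mono: "a \<le> b \<Longrightarrow> clamp01 a \<le> clamp01 b"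
  by (auto simp: clamp01_def)

text \<open>The polygon is a sum of increments weighted by their completed fractions. Every weight
  is monotone in time and their total grows by at most (t - s) / h, which gives the Lipschitz bound
  without distinguishing the subintervals containing s and t.\<close>

lemma lipschitz_interpolation:
  fixes y :: "nat \<Rightarrow> 'b::real_normed_vector"
  assumes "h > 0" "c \<ge> 0" and step: "\<And>i. i < N \<Longrightarrow> norm (y (Suc i) - y i) \<le> c * h"
  obtains X where "c-lipschitz_on UNIV X" "\<And>i. i \<le> N \<Longrightarrow> X (real i * h) = y i"
proof -
  define X where "X t = y 0 + (\<Sum>i<N. clamp01 (t / h - real i) *\<^sub>R (y (Suc i) - y i))" for t
  have lip: "norm (X t - X s) \<le> c * (t - s)" if "s \<le> t" for s t
  proof -
    have st: "s / h \<le> t / h" using that \<open>h > 0\<close> by (simp add: divide_right_mono)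
    have "X t - X s = (\<Sum>i<N. (clamp01 (t / h - real i) - clamp01 (s / h - real i)) *\<^sub>R (y (Suc i) - y i))"
      by (simp add: X_def sum_subtractf[symmetric] scaleR_diff_left)
    also have "norm \<dots> \<le> (\<Sum>i<N. (clamp01 (t / h - real i) - clamp01 (s / h - real i)) * (c * h))"
    proof (rule sum_norm_le)
      fix i assume "i \<in> {..<N}"
      moreover have "clamp01 (s / h - real i) \<le> clamp01 (t / h - real i)" using st by (intro clamp01_mono) simp
      ultimately show "norm ((clamp01 (t / h - real i) - clamp01 (s / h - real i)) *\<^sub>R (y (Suc i) - y i))
          \<le> (clamp01 (t / h - real i) - clamp01 (s / h - real i)) * (c * h)"
        using step[of i] by (simp add: mult_left_mono)
    qed
    also have "\<dots> = (max 0 (min (real N) (t / h)) - max 0 (min (real N) (s / h))) * (c * h)"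
      by (simp add: sum_distrib_right[symmetric] sum_subtractf sum_clamp01)
    also have "\<dots> \<le> (t / h - s / h) * (c * h)"
      using st assms by (intro mult_right_mono) (auto simp: max_def min_def)
    also have "\<dots> = c * (t - s)" using \<open>h > 0\<close> by (simp add: field_simps)
    finally show ?thesis .
  qed
  show thesis
  proof (rule that)
    show "c-lipschitz_on UNIV X"
      by (rule lipschitz_on_leI) (use lip \<open>c \<ge> 0\<close> in \<open>auto simp: dist_norm norm_minus_commute\<close>)
    fix j assume "j \<le> N"
    have "(\<Sum>i<N. clamp01 (real j - real i) *\<^sub>R (y (Suc i) - y i)) = (\<Sum>i<j. y (Suc i) - y i)"
      using \<open>j \<le> N\<close> by (intro sum.mono_neutral_cong_right) (auto simp: clamp01_def min_def max_def)
    then show "X (real j * h) = y j" using \<open>h > 0\<close> by (simp add: X_def sum_lessThan_telescope)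
  qed
qed

context projected_system
begin

lemma catching_up_step_exists:
  assumes y: "y \<in> Yr"
  shows "\<exists>z\<in>Yr. \<forall>z'\<in>Yr. B y (y + h *\<^sub>R f y - z) (y + h *\<^sub>R f y - z) \<le> B y (y + h *\<^sub>R f y - z') (y + h *\<^sub>R f y - z')"
proof -
  have bb: "bounded_bilinear (B y)" using B_bilinear[OF y] by (simp add: bilinear_conv_bounded_bilinear)
  have "continuous_on Yr (\<lambda>z. B y (y + h *\<^sub>R f y - z) (y + h *\<^sub>R f y - z))"
    by (intro bounded_bilinear.continuous_on[OF bb] continuous_intros)
  then show ?thesis using continuous_attains_inf[OF compact] y by blast
qed

text \<open>Minimising over the compact \<open>Yr\<close> secures existence; a nearest point need
  not be unique, hence the choice. The price is that normality to \<open>Y\<close> needs the chosen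
  point to lie inside the open ball.\<close>

definition catching_up :: "real \<Rightarrow> 'e \<Rightarrow> 'e" where
  "catching_up h y = (SOME z. z \<in> Yr \<and> (\<forall>z'\<in>Yr. B y (y + h *\<^sub>R f y - z) (y + h *\<^sub>R f y - z) \<le>
     B y (y + h *\<^sub>R f y - z') (y + h *\<^sub>R f y - z')))"

lemma catching_up_step:
  assumes y: "y \<in> Yr"
  shows "catching_up h y \<in> Yr"
    and "z' \<in> Yr \<Longrightarrow> B y (y + h *\<^sub>R f y - catching_up h y) (y + h *\<^sub>R f y - catching_up h y) \<le>
      B y (y + h *\<^sub>R f y - z') (y + h *\<^sub>R f y - z')"
proof -
  have "\<exists>z. z \<in> Yr \<and> (\<forall>z'\<in>Yr. B y (y + h *\<^sub>R f y - z) (y + h *\<^sub>R f y - z) \<le>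
     B y (y + h *\<^sub>R f y - z') (y + h *\<^sub>R f y - z'))" using catching_up_step_exists[OF y, of h] by blast
  from someI_ex[OF this] have *: "catching_up h y \<in> Yr \<and> (\<forall>z'\<in>Yr. B y (y + h *\<^sub>R f y - catching_up h y) (y + h *\<^sub>R f y - catching_up h y) \<le>
     B y (y + h *\<^sub>R f y - z') (y + h *\<^sub>R f y - z'))" unfolding catching_up_def .
  then show "catching_up h y \<in> Yr" by blast
  show "z' \<in> Yr \<Longrightarrow> B y (y + h *\<^sub>R f y - catching_up h y) (y + h *\<^sub>R f y - catching_up h y) \<le>
      B y (y + h *\<^sub>R f y - z') (y + h *\<^sub>R f y - z')" using * by blast
qed

text \<open>The point y itself competes in the minimisation, so the residual is no longer than h f y
  in the metric at y. This gives the speed bound 2 * K^2 for the whole scheme.\<close>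

lemma catching_up_bounds:
  assumes y: "y \<in> Yr" and h: "0 \<le> h"
  shows "norm (y + h *\<^sub>R f y - catching_up h y) \<le> h * K\<^sup>2"
    and "norm (catching_up h y - y) \<le> 2 * K\<^sup>2 * h"
proof -
  let ?\<zeta> = "y + h *\<^sub>R f y - catching_up h y"
  have 1: "(norm ?\<zeta>)\<^sup>2 \<le> K * B y ?\<zeta> ?\<zeta>" by (rule B_pos[OF y])
  have 2: "K * B y ?\<zeta> ?\<zeta> \<le> K * B y (h *\<^sub>R f y) (h *\<^sub>R f y)"
    using catching_up_step(2)[OF y y, of h] K by (intro mult_left_mono) auto
  have 3: "K * B y (h *\<^sub>R f y) (h *\<^sub>R f y) \<le> K * (K * norm (h *\<^sub>R f y) * norm (h *\<^sub>R f y))"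
    using B_bound[OF y, of "h *\<^sub>R f y" "h *\<^sub>R f y"] K by (intro mult_left_mono) auto
  have 4: "K * (K * norm (h *\<^sub>R f y) * norm (h *\<^sub>R f y)) = (K * norm (h *\<^sub>R f y))\<^sup>2"
    by (simp add: power2_eq_square mult_ac)
  have "(norm ?\<zeta>)\<^sup>2 \<le> (K * norm (h *\<^sub>R f y))\<^sup>2" using 1 2 3 unfolding 4 by linarith
  then have "norm ?\<zeta> \<le> K * norm (h *\<^sub>R f y)"
    by (rule power2_le_imp_le) (use K in simp)
  also have "\<dots> \<le> K * (h * K)" using f_bound[OF y] h K by (intro mult_left_mono) (auto simp: mult_left_mono)
  finally show *: "norm ?\<zeta> \<le> h * K\<^sup>2" by (simp add: power2_eq_square mult_ac)
  have "catching_up h y - y = h *\<^sub>R f y - ?\<zeta>" by simp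
  then have "norm (catching_up h y - y) \<le> norm (h *\<^sub>R f y) + norm ?\<zeta>" by (metis norm_triangle_ineq4)
  also have "\<dots> \<le> h * K\<^sup>2 + h * K\<^sup>2"
  proof (rule add_mono[OF _ *])
    have "norm (h *\<^sub>R f y) \<le> h * K" using f_bound[OF y] h by (simp add: mult_left_mono)
    also have "\<dots> \<le> h * K\<^sup>2" using K_powers(2)[of 1 2] h by (intro mult_left_mono) auto
    finally show "norm (h *\<^sub>R f y) \<le> h * K\<^sup>2" .
  qed
  finally show "norm (catching_up h y - y) \<le> 2 * K\<^sup>2 * h" by (simp add: mult_ac)
qed

text \<open>Comparing the nearest point with a nearby z and expanding the square bounds the pairing
  of the residual with z minus the nearest point by a quadratic term. Since the nearest point is
  inside the open ball, all points of \<open>Y\<close> near it are competitors.\<close>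

lemma catching_up_normal:
  assumes y: "y \<in> Yr" and inside: "catching_up h y \<in> ball y0 r"
    and w: "w \<in> tangent_cone Y (catching_up h y)"
  shows "B y (y + h *\<^sub>R f y - catching_up h y) w \<le> 0"
proof -
  let ?z = "catching_up h y" and ?\<zeta> = "y + h *\<^sub>R f y - catching_up h y"
  have bb: "bounded_bilinear (B y)" using B_bilinear[OF y] by (simp add: bilinear_conv_bounded_bilinear)
  obtain d where d: "d > 0" "ball ?z d \<subseteq> ball y0 r" using inside by (meson open_ball open_contains_ball)
  show ?thesis
  proof (rule tangent_cone_quadratic_bound[OF _ d(1) _ w])
    show "bounded_linear (B y ?\<zeta>)" by (rule bounded_bilinear.bounded_linear_right[OF bb])
    fix z assume z: "z \<in> Y" "dist z ?z < d"
    then have "z \<in> ball ?z d" by (simp add: dist_commute)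
    then have zr: "z \<in> Yr" using d z by auto
    have "y + h *\<^sub>R f y - z = ?\<zeta> - (z - ?z)" by simp
    then have "B y (y + h *\<^sub>R f y - z) (y + h *\<^sub>R f y - z) =
        B y ?\<zeta> ?\<zeta> - 2 * B y ?\<zeta> (z - ?z) + B y (z - ?z) (z - ?z)"
      by (simp only: B_square_expand(2)[OF y, of ?\<zeta> "z - ?z"])
    then have "2 * B y ?\<zeta> (z - ?z) \<le> B y (z - ?z) (z - ?z)"
      using catching_up_step(2)[OF y zr, of h] by simp
    also have "\<dots> \<le> K * (norm (z - ?z))\<^sup>2"
      using B_bound[OF y, of "z - ?z" "z - ?z"] by (simp add: power2_eq_square mult.assoc)
    finally show "B y ?\<zeta> (z - ?z) \<le> K / 2 * (norm (z - ?z))\<^sup>2" by simp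
  qed
qed

definition evi_const :: real where
  "evi_const = K ^ 4 * 6 * r + K ^ 3 * 2 * r + K\<^sup>2 * 2 * r + K\<^sup>2"

lemma dist_Yr: "y \<in> Yr \<Longrightarrow> z \<in> Yr \<Longrightarrow> norm (y - z) \<le> 2 * r"
  using dist_triangle2[of y z y0] by (auto simp: dist_norm[symmetric] dist_commute)

text \<open>A discrete evolution variational inequality: one step changes half the squared distance
  to any test point z by an amount in which the new velocity no longer appears. Metric and field are
  frozen at p, so that consecutive steps can be added.\<close>

lemma discrete_evi:
  assumes y: "y \<in> Yr" and p: "p \<in> Yr" and z: "z \<in> Yr" and h: "0 \<le> h"
    and inside: "catching_up h y \<in> ball y0 r"
    and \<rho>: "norm (y - p) \<le> \<rho>" "norm (catching_up h y - p) \<le> \<rho>"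
  shows "B p (z - catching_up h y) (z - catching_up h y) / 2 - B p (z - y) (z - y) / 2 \<le>
    h * (- B p (f p) (z - p) + K ^ 4 * (norm (z - p))\<^sup>2 + evi_const * \<rho>)"
proof -
  let ?y' = "catching_up h y" 
  let ?a = "z - ?y'" and ?d = "?y' - y" and ?\<zeta> = "y + h *\<^sub>R f y - ?y'"
  have y': "?y' \<in> Yr" by (rule catching_up_step(1)[OF y])
  have a: "norm ?a \<le> 2 * r" by (rule dist_Yr[OF z y'])
  have "\<rho> \<ge> 0" using \<rho>(1) norm_ge_zero order_trans by blast
  have dd: "0 \<le> B p ?d ?d"
  proof -
    have "0 \<le> K * B p ?d ?d" using B_pos[OF p, of ?d] by (meson order_trans zero_le_power2)
    then show ?thesis using K by (simp add: zero_le_mult_iff)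
  qed
  have "z - y = ?a + ?d" by simp
  then have "B p (z - y) (z - y) = B p ?a ?a + 2 * B p ?d ?a + B p ?d ?d"
    by (simp only: B_square_expand(1)[OF p, of ?a ?d] B_sym[OF p, of ?a ?d])
  \<comment> \<open>The square of the displacement has the favourable sign and is dropped.\<close>
  then have "B p ?a ?a / 2 - B p (z - y) (z - y) / 2 \<le> - B p ?d ?a" using dd by linarith
  also have "- B p ?d ?a = - h * B p (f y) ?a + B p ?\<zeta> ?a"
  proof -
    have "?d = h *\<^sub>R f y - ?\<zeta>" by simp
    then have "B p ?d ?a = B p (h *\<^sub>R f y) ?a - B p ?\<zeta> ?a" by (simp only: B_simps(3)[OF p, of "h *\<^sub>R f y" ?\<zeta>])
    then show ?thesis by (simp add: B_simps(5)[OF p])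
  qed
  \<comment> \<open>Normality holds in the metric at y, so prox-regularity is applied there before
    the metric is moved to p.\<close>
  also have "B p ?\<zeta> ?a \<le> h * (K ^ 4 * (norm ?a)\<^sup>2 + K ^ 3 * 2 * r * \<rho>)"
  proof -
    have "B y ?\<zeta> ?a \<le> K\<^sup>2 * norm ?\<zeta> * (norm ?a)\<^sup>2"
      by (intro prox_metric y y' z catching_up_normal inside)
    also have "\<dots> \<le> K\<^sup>2 * (h * K\<^sup>2) * (norm ?a)\<^sup>2"
      by (intro mult_right_mono mult_left_mono catching_up_bounds y h) auto
    finally have 1: "B y ?\<zeta> ?a \<le> h * (K ^ 4 * (norm ?a)\<^sup>2)" by (simp add: power_numeral_reduce mult_ac)
    have "B p ?\<zeta> ?a - B y ?\<zeta> ?a \<le> K * norm (p - y) * norm ?\<zeta> * norm ?a"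
      using B_lip[OF p y, of ?\<zeta> ?a] by simp
    also have "\<dots> \<le> K * \<rho> * (h * K\<^sup>2) * (2 * r)"
      using \<rho> K r h \<open>\<rho> \<ge> 0\<close> by (intro mult_mono a catching_up_bounds y) (auto simp: norm_minus_commute)
    also have "\<dots> = h * (K ^ 3 * 2 * r * \<rho>)" by (simp add: power_numeral_reduce mult_ac)
    finally show ?thesis using 1 by (simp add: distrib_left)
  qed
  also have "- h * B p (f y) ?a \<le> h * (- B p (f p) (z - p) + K\<^sup>2 * 2 * r * \<rho> + K\<^sup>2 * \<rho>)"
  proof -
    have "z - p = ?a + (?y' - p)" by simp
    then have "B p (f p) (z - p) = B p (f p) ?a + B p (f p) (?y' - p)" by (simp only: B_simps(2)[OF p, of _ ?a])
    then have "- B p (f y) ?a = - B p (f p) (z - p) - B p (f y - f p) ?a + B p (f p) (?y' - p)"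
      by (simp add: B_simps(3)[OF p, of "f y"])
    moreover have "- B p (f y - f p) ?a \<le> K\<^sup>2 * 2 * r * \<rho>"
    proof -
      have "- B p (f y - f p) ?a \<le> K * norm (f y - f p) * norm ?a" using B_bound[OF p, of "f y - f p" ?a] by simp
      also have "\<dots> \<le> K * (K * norm (y - p)) * norm ?a"
        using f_lip[OF y p] K by (intro mult_right_mono mult_left_mono) auto
      also have "\<dots> \<le> K * (K * \<rho>) * (2 * r)"
        using \<rho> K a \<open>\<rho> \<ge> 0\<close> by (intro mult_mono) auto
      finally show ?thesis by (simp add: power2_eq_square mult_ac)
    qed
    moreover have "B p (f p) (?y' - p) \<le> K\<^sup>2 * \<rho>"
    proof -
      have "B p (f p) (?y' - p) \<le> K * norm (f p) * norm (?y' - p)" using B_bound[OF p, of "f p" "?y' - p"] by simp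
      also have "\<dots> \<le> K * K * \<rho>" using \<rho> K f_bound[OF p] by (intro mult_mono) auto
      finally show ?thesis by (simp add: power2_eq_square)
    qed
    ultimately have "- B p (f y) ?a \<le> - B p (f p) (z - p) + K\<^sup>2 * 2 * r * \<rho> + K\<^sup>2 * \<rho>" by linarith
    then have "h * - B p (f y) ?a \<le> h * (- B p (f p) (z - p) + K\<^sup>2 * 2 * r * \<rho> + K\<^sup>2 * \<rho>)"
      using h by (rule mult_left_mono)
    then show ?thesis by simp
  qed
  finally have "B p ?a ?a / 2 - B p (z - y) (z - y) / 2 \<le>
      h * (- B p (f p) (z - p) + K\<^sup>2 * 2 * r * \<rho> + K\<^sup>2 * \<rho>) + h * (K ^ 4 * (norm ?a)\<^sup>2 + K ^ 3 * 2 * r * \<rho>)" by simp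
  also have "\<dots> = h * (- B p (f p) (z - p) + K ^ 4 * (norm ?a)\<^sup>2 + (K ^ 3 * 2 * r + K\<^sup>2 * 2 * r + K\<^sup>2) * \<rho>)"
    by (simp add: algebra_simps)
  also have "\<dots> \<le> h * (- B p (f p) (z - p) + K ^ 4 * (norm (z - p))\<^sup>2 + evi_const * \<rho>)"
  proof (rule mult_left_mono[OF _ h])
    have "(norm ?a)\<^sup>2 \<le> (norm (z - p))\<^sup>2 + 6 * r * \<rho>"
    proof -
      have na: "norm ?a \<le> norm (z - p) + \<rho>"
        using norm_triangle_ineq4[of "z - p" "?y' - p"] \<rho>(2) by simp
      have "(norm ?a)\<^sup>2 - (norm (z - p))\<^sup>2 = (norm ?a - norm (z - p)) * (norm ?a + norm (z - p))"
        by (simp add: power2_eq_square algebra_simps)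
      also have "\<dots> \<le> \<rho> * (norm ?a + norm (z - p))" using na by (intro mult_right_mono) auto
      also have "\<dots> \<le> \<rho> * (2 * r + 2 * r)" using a dist_Yr[OF z p] \<open>\<rho> \<ge> 0\<close> by (intro mult_left_mono) auto
      also have "\<dots> \<le> 6 * r * \<rho>" using r \<open>\<rho> \<ge> 0\<close> by (simp add: mult_ac)
      finally show ?thesis by simp
    qed
    then have "K ^ 4 * (norm ?a)\<^sup>2 \<le> K ^ 4 * ((norm (z - p))\<^sup>2 + 6 * r * \<rho>)"
      using K by (intro mult_left_mono) auto
    then show "- B p (f p) (z - p) + K ^ 4 * (norm ?a)\<^sup>2 + (K ^ 3 * 2 * r + K\<^sup>2 * 2 * r + K\<^sup>2) * \<rho>
       \<le> - B p (f p) (z - p) + K ^ 4 * (norm (z - p))\<^sup>2 + evi_const * \<rho>"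
      by (simp add: evi_const_def algebra_simps)
  qed
  finally show ?thesis .
qed

definition catching_up_seq :: "real \<Rightarrow> nat \<Rightarrow> 'e" where
  "catching_up_seq h n = ((catching_up h) ^^ n) y0"

lemma catching_up_seq_simps:
  "catching_up_seq h 0 = y0" "catching_up_seq h (Suc n) = catching_up h (catching_up_seq h n)"
  by (simp_all add: catching_up_seq_def)

lemma catching_up_seq_Yr: "catching_up_seq h n \<in> Yr"
proof (induction n)
  case (Suc n)
  then show ?case unfolding catching_up_seq_simps by (rule catching_up_step(1))
qed (use y0 r in \<open>simp add: catching_up_seq_simps\<close>)

lemma catching_up_seq_step: "0 \<le> h \<Longrightarrow> norm (catching_up_seq h (Suc n) - catching_up_seq h n) \<le> 2 * K\<^sup>2 * h"
  unfolding catching_up_seq_simps by (intro catching_up_bounds(2) catching_up_seq_Yr)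

lemma catching_up_seq_drift:
  assumes "0 \<le> h" shows "norm (catching_up_seq h n - y0) \<le> 2 * K\<^sup>2 * (real n * h)"
proof (induction n)
  case (Suc n)
  have "catching_up_seq h (Suc n) - y0 = (catching_up_seq h (Suc n) - catching_up_seq h n) + (catching_up_seq h n - y0)" by simp
  then have "norm (catching_up_seq h (Suc n) - y0) \<le> 2 * K\<^sup>2 * h + 2 * K\<^sup>2 * (real n * h)"
    by (metis norm_triangle_mono catching_up_seq_step[OF assms] Suc)
  also have "\<dots> = 2 * K\<^sup>2 * (real (Suc n) * h)" by (simp add: algebra_simps)
  finally show ?case .
qed (simp add: catching_up_seq_simps)

lemma discrete_evi_sum:
  assumes p: "p \<in> Yr" and z: "z \<in> Yr" and h: "0 \<le> h" and ij: "i \<le> j" "2 * K\<^sup>2 * (real j * h) < r"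
    and \<rho>: "\<And>k. i \<le> k \<Longrightarrow> k \<le> j \<Longrightarrow> norm (catching_up_seq h k - p) \<le> \<rho>"
  shows "B p (z - catching_up_seq h j) (z - catching_up_seq h j) / 2 -
      B p (z - catching_up_seq h i) (z - catching_up_seq h i) / 2 \<le>
    (real j * h - real i * h) * (- B p (f p) (z - p) + K ^ 4 * (norm (z - p))\<^sup>2 + evi_const * \<rho>)"
proof -
  let ?C = "- B p (f p) (z - p) + K ^ 4 * (norm (z - p))\<^sup>2 + evi_const * \<rho>"
  let ?E = "\<lambda>k. B p (z - catching_up_seq h k) (z - catching_up_seq h k) / 2"
  have step: "?E (Suc m) - ?E m \<le> h * ?C" if m: "i \<le> m" "m < j" for m
    unfolding catching_up_seq_simps
  proof (intro discrete_evi catching_up_seq_Yr p z h)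
    have "2 * K\<^sup>2 * (real (Suc m) * h) \<le> 2 * K\<^sup>2 * (real j * h)"
      using h m by (intro mult_left_mono mult_right_mono) auto
    then show "catching_up h (catching_up_seq h m) \<in> ball y0 r"
      using catching_up_seq_drift[OF h, of "Suc m"] ij(2)
      by (simp add: catching_up_seq_simps dist_norm norm_minus_commute)
    show "norm (catching_up_seq h m - p) \<le> \<rho>" using m by (intro \<rho>) auto
    show "norm (catching_up h (catching_up_seq h m) - p) \<le> \<rho>"
      using \<rho>[of "Suc m"] m by (simp add: catching_up_seq_simps)
  qed
  have "?E j - ?E i = (\<Sum>m=i..<j. ?E (Suc m) - ?E m)" using sum_Suc_diff'[OF ij(1), of ?E] by simp
  also have "\<dots> \<le> (\<Sum>m=i..<j. h * ?C)" by (rule sum_mono) (use step in auto)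
  also have "\<dots> = (real j * h - real i * h) * ?C" using ij(1) by (simp add: of_nat_diff algebra_simps)
  finally show ?thesis .
qed

text \<open>The polygons share the Lipschitz constant 2 * K^2, so a subsequence converges uniformly,
  and the summed inequality passes to the limit. The curve moves at most 2 * K^2 * (t - s) away from
  its frozen point, so the freezing error is of second order in t - s.\<close>

lemma limit_curve_exists:
  obtains T x where "T > 0" "(2 * K\<^sup>2)-lipschitz_on UNIV x" "x 0 = y0" "\<And>t. x t \<in> Y \<inter> ball y0 r"
    "\<And>s t z. 0 \<le> s \<Longrightarrow> s \<le> t \<Longrightarrow> t \<le> T \<Longrightarrow> z \<in> Yr \<Longrightarrow>
      B (x s) (z - x t) (z - x t) / 2 - B (x s) (z - x s) (z - x s) / 2 \<le>
      (t - s) * (- B (x s) (f (x s)) (z - x s) + K ^ 4 * (norm (z - x s))\<^sup>2 + evi_const * (2 * K\<^sup>2 * (t - s)))"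
proof -
  define c where "c = 2 * K\<^sup>2"
  have c: "c > 0" using K by (simp add: c_def)
  \<comment> \<open>At speed c this confines the scheme to the ball of radius r / 2.\<close>
  define T where "T = r / (2 * c)"
  have T: "T > 0" "c * T = r / 2" using c r by (auto simp: T_def)
  define h where "h n = T / real (Suc n)" for n
  have h: "h n > 0" "real (Suc n) * h n = T" for n using T by (auto simp: h_def)
  have "\<exists>X. c-lipschitz_on UNIV X \<and> (\<forall>i\<le>Suc n. X (real i * h n) = catching_up_seq (h n) i)" for n
  proof -
    have "norm (catching_up_seq (h n) (Suc i) - catching_up_seq (h n) i) \<le> c * h n" for i
      unfolding c_def using h(1)[of n] by (intro catching_up_seq_step) simp
    then show ?thesis
      using lipschitz_interpolation[of "h n" c "Suc n" "catching_up_seq (h n)"] h(1)[of n] c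
      by (metis less_imp_le)
  qed
  then obtain X where X: "\<And>n. c-lipschitz_on UNIV (X n)"
    "\<And>n i. i \<le> Suc n \<Longrightarrow> X n (real i * h n) = catching_up_seq (h n) i" by metis
  have X_lip: "norm (X n s - X n t) \<le> c * \<bar>s - t\<bar>" for n s t
    using lipschitz_onD[OF X(1)[of n], of s t] by (simp add: dist_norm)
  have X0: "X n 0 = y0" for n using X(2)[of 0 n] by (simp add: catching_up_seq_simps)
    have bd: "norm (X n t) \<le> norm y0 + c * T" if "t \<in> {0..T}" for n t
    proof -
      have "norm (X n t) \<le> norm y0 + norm (X n t - X n 0)" 
        unfolding X0 by (metis add.commute diff_add_cancel norm_triangle_ineq)
      also have "\<dots> \<le> norm y0 + c * T"
      proof (rule add_left_mono)
        have "c * \<bar>t - 0\<bar> \<le> c * T" using that c by (intro mult_left_mono) auto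
        then show "norm (X n t - X n 0) \<le> c * T" using X_lip[of n t 0] by linarith
      qed
      finally show ?thesis .
    qed
    have eqc: "\<exists>d>0. \<forall>n y. y \<in> {0..T} \<and> norm (s - y) < d \<longrightarrow> norm (X n s - X n y) < e"
      if "s \<in> {0..T}" "0 < e" for s e
    proof (intro exI[of _ "e / c"] conjI allI impI)
      show "e / c > 0" using c that by simp
      fix n y assume "y \<in> {0..T} \<and> norm (s - y) < e / c"
      then have "c * \<bar>s - y\<bar> < e" using c by (simp add: pos_less_divide_eq mult.commute)
      then show "norm (X n s - X n y) < e" using X_lip[of n s y] by linarith
    qed
  obtain x0 k where x0: "continuous_on {0..T} x0" and k: "strict_mono (k :: nat \<Rightarrow> nat)"
    and conv: "\<And>e. 0 < e \<Longrightarrow> \<exists>N. \<forall>n x. n \<ge> N \<and> x \<in> {0..T} \<longrightarrow> norm (X (k n) x - x0 x) < e"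
    by (rule Arzela_Ascoli[of "{0..T}" X "norm y0 + c * T", OF compact_Icc bd eqc]) (assumption | rule that)+
  have lim: "(\<lambda>n. X (k n) t) \<longlonglongrightarrow> x0 t" if "t \<in> {0..T}" for t
    unfolding LIMSEQ_iff using conv that by blast
  define hk where "hk n = h (k n)" for n
  have hk: "hk n > 0" "hk \<longlonglongrightarrow> 0" for n
  proof -
    have "(\<lambda>n. T / real (Suc n)) \<longlonglongrightarrow> 0"
      using LIMSEQ_Suc[OF tendsto_mult_right_zero[OF lim_inverse_n', of T]] by simp
    from LIMSEQ_subseq_LIMSEQ[OF this k] show "hk \<longlonglongrightarrow> 0" by (simp add: hk_def[abs_def] h_def o_def)
  qed (simp add: hk_def h)
  \<comment> \<open>The index of the last node not after t. Nodes are needed because the discrete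
    inequality says nothing between them.\<close>
  define node where "node n t = nat \<lfloor>t / hk n\<rfloor>" for n t
  have node: "real (node n t) * hk n \<le> t" "t < real (node n t) * hk n + hk n" "node n t \<le> Suc (k n)"
    if "t \<in> {0..T}" for n t
  proof -
    have "t / hk n \<ge> 0" using that hk(1)[of n] by simp
    then have rn: "real (node n t) = of_int \<lfloor>t / hk n\<rfloor>" by (simp add: node_def)
    then have "real (node n t) \<le> t / hk n" "t / hk n < real (node n t) + 1" by linarith+
    then show 1: "real (node n t) * hk n \<le> t" and "t < real (node n t) * hk n + hk n"
      using hk(1)[of n] by (simp_all add: pos_le_divide_eq pos_divide_less_eq distrib_right)
    have "real (node n t) * hk n \<le> real (Suc (k n)) * hk n"
      using 1 that h(2)[of "k n"] by (simp add: hk_def)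
    then have "real (node n t) \<le> real (Suc (k n))" using hk(1)[of n] by (simp only: mult_le_cancel_right_pos)
    then show "node n t \<le> Suc (k n)" by linarith
  qed
  have node_lim: "(\<lambda>n. real (node n t) * hk n) \<longlonglongrightarrow> t" if "t \<in> {0..T}" for t
  proof (rule tendsto_sandwich[of "\<lambda>n. t - hk n" _ _ "\<lambda>_. t"])
    show "(\<lambda>n. t - hk n) \<longlonglongrightarrow> t" using tendsto_diff[OF tendsto_const[of t] hk(2)] by simp
    show "\<forall>\<^sub>F n in sequentially. t - hk n \<le> real (node n t) * hk n"
      using node(2)[OF that] by (intro always_eventually) (simp add: less_imp_le diff_le_eq)
    show "\<forall>\<^sub>F n in sequentially. real (node n t) * hk n \<le> t" using node(1)[OF that] by simp
  qed simp
  have seq_lim: "(\<lambda>n. catching_up_seq (hk n) (node n t)) \<longlonglongrightarrow> x0 t" if "t \<in> {0..T}" for t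
  proof -
    have eq: "catching_up_seq (hk n) (node n t) = X (k n) (real (node n t) * hk n)" for n
      using X(2)[OF node(3)[OF that]] by (simp add: hk_def)
    have "(\<lambda>n. X (k n) (real (node n t) * hk n) - X (k n) t) \<longlonglongrightarrow> 0"
    proof (rule Lim_null_comparison)
      show "\<forall>\<^sub>F n in sequentially. norm (X (k n) (real (node n t) * hk n) - X (k n) t) \<le> c * \<bar>real (node n t) * hk n - t\<bar>"
        using X_lip by simp
      have "(\<lambda>n. c * \<bar>real (node n t) * hk n - t\<bar>) \<longlonglongrightarrow> c * \<bar>t - t\<bar>"
        by (intro tendsto_intros node_lim that)
      then show "(\<lambda>n. c * \<bar>real (node n t) * hk n - t\<bar>) \<longlonglongrightarrow> 0" by simp
    qed
    from tendsto_add[OF this lim[OF that]] show ?thesis by (simp add: eq)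
  qed
  have x0_Yr: "x0 t \<in> Yr" if "t \<in> {0..T}" for t
    using closed_sequentially[OF compact_imp_closed[OF compact] _ seq_lim[OF that]] catching_up_seq_Yr by blast
  have x0_lip: "norm (x0 s - x0 t) \<le> c * \<bar>s - t\<bar>" if "s \<in> {0..T}" "t \<in> {0..T}" for s t
  proof (rule LIMSEQ_le_const2)
    show "(\<lambda>n. norm (X (k n) s - X (k n) t)) \<longlonglongrightarrow> norm (x0 s - x0 t)" by (intro tendsto_intros lim that)
  qed (use X_lip in \<open>intro exI[of _ 0] allI impI\<close>)
  have x0_0: "x0 0 = y0"
    using LIMSEQ_unique[OF lim[of 0]] T X0 by simp
  \<comment> \<open>Constant continuation outside {0..T}: almost everywhere differentiability is
    available for functions that are Lipschitz on the whole line.\<close>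
  define x where "x t = x0 (max 0 (min T t))" for t
  have cl: "max 0 (min T t) \<in> {0..T}" for t using T by auto
  have x_eq: "x t = x0 t" if "t \<in> {0..T}" for t using that by (simp add: x_def)
  show thesis
  proof (rule that[OF T(1)])
    show "(2 * K\<^sup>2)-lipschitz_on UNIV x"
    proof (rule lipschitz_onI)
      fix s t
      have "dist (x s) (x t) \<le> c * \<bar>max 0 (min T s) - max 0 (min T t)\<bar>"
        unfolding x_def dist_norm by (rule x0_lip[OF cl cl])
      also have "\<dots> \<le> c * dist s t" using c by (intro mult_left_mono) (auto simp: dist_real_def)
      finally show "dist (x s) (x t) \<le> 2 * K\<^sup>2 * dist s t" by (simp add: c_def)
    qed simp
    show "x 0 = y0" using T x_eq[of 0] x0_0 by simp
    show "x t \<in> Y \<inter> ball y0 r" for t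
    proof -
      have "norm (x t - y0) \<le> c * \<bar>max 0 (min T t) - 0\<bar>"
        unfolding x_def x0_0[symmetric] by (rule x0_lip[OF cl]) (use T in simp)
      also have "\<dots> \<le> c * T" using cl[of t] c by (intro mult_left_mono) auto
      finally have "norm (x t - y0) < r" using T r by simp
      moreover have "x t \<in> Y" using x0_Yr[OF cl] by (simp add: x_def)
      ultimately show ?thesis by (simp add: dist_norm norm_minus_commute)
    qed
    fix s t z assume st: "0 \<le> s" "s \<le> t" "t \<le> T" and z: "z \<in> Yr"
    then have s: "s \<in> {0..T}" and t: "t \<in> {0..T}" by auto
    let ?p = "x0 s"
    have p: "?p \<in> Yr" by (rule x0_Yr[OF s])
    have bb: "bounded_bilinear (B ?p)" using B_bilinear[OF p] by (simp add: bilinear_conv_bounded_bilinear)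
    let ?C = "- B ?p (f ?p) (z - ?p) + K ^ 4 * (norm (z - ?p))\<^sup>2"
    let ?Y = "\<lambda>n u. catching_up_seq (hk n) (node n u)"
    \<comment> \<open>The node belonging to s may precede s by up to one step, hence t - s + hk n;
      the last term is the distance of polygon and limit at s.\<close>
    define \<rho> where "\<rho> n = c * (t - s + hk n) + norm (X (k n) s - x0 s)" for n
    have "B ?p (z - x0 t) (z - x0 t) / 2 - B ?p (z - x0 s) (z - x0 s) / 2 \<le>
        (t - s) * (?C + evi_const * (c * (t - s + 0) + 0))"
    proof (rule LIMSEQ_le)
      show "(\<lambda>n. B ?p (z - ?Y n t) (z - ?Y n t) / 2 - B ?p (z - ?Y n s) (z - ?Y n s) / 2) \<longlonglongrightarrow>
        B ?p (z - x0 t) (z - x0 t) / 2 - B ?p (z - x0 s) (z - x0 s) / 2"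
        by (intro tendsto_intros bounded_bilinear.tendsto[OF bb] seq_lim s t; simp)
      have "(\<lambda>n. norm (X (k n) s - x0 s)) \<longlonglongrightarrow> 0"
        using tendsto_norm[OF tendsto_diff[OF lim[OF s] tendsto_const[of "x0 s"]]] by simp
      then show "(\<lambda>n. (real (node n t) * hk n - real (node n s) * hk n) * (?C + evi_const * \<rho> n)) \<longlonglongrightarrow>
        (t - s) * (?C + evi_const * (c * (t - s + 0) + 0))"
        unfolding \<rho>_def by (intro tendsto_intros node_lim s t hk)
      have "B ?p (z - ?Y n t) (z - ?Y n t) / 2 - B ?p (z - ?Y n s) (z - ?Y n s) / 2 \<le>
        (real (node n t) * hk n - real (node n s) * hk n) * (?C + evi_const * \<rho> n)" for n
      proof (rule discrete_evi_sum[OF p z])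
        show "0 \<le> hk n" using hk(1)[of n] by simp
        show "node n s \<le> node n t"
          unfolding node_def using st hk(1)[of n] by (intro nat_mono floor_mono divide_right_mono) auto
        have "c * (real (node n t) * hk n) \<le> c * T"
          using node(1)[OF t, of n] st c by (intro mult_left_mono) auto
        then show "2 * K\<^sup>2 * (real (node n t) * hk n) < r" using T r by (simp add: c_def)
        fix m assume m: "node n s \<le> m" "m \<le> node n t"
        then have "m \<le> Suc (k n)" using node(3)[OF t, of n] by simp
        then have eq: "catching_up_seq (hk n) m = X (k n) (real m * hk n)" using X(2) by (simp add: hk_def)
        have "real (node n s) * hk n \<le> real m * hk n" "real m * hk n \<le> real (node n t) * hk n"
          using m hk(1)[of n] by (auto intro!: mult_right_mono)
        then have "\<bar>real m * hk n - s\<bar> \<le> t - s + hk n"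
          using node(1,2)[OF s, of n] node(1)[OF t, of n] st hk(1)[of n] by linarith
        then have "c * \<bar>real m * hk n - s\<bar> \<le> c * (t - s + hk n)" using c by (intro mult_left_mono) auto
        then have 1: "norm (X (k n) (real m * hk n) - X (k n) s) \<le> c * (t - s + hk n)"
          using X_lip[of "k n" "real m * hk n" s] by linarith
        have eq2: "X (k n) (real m * hk n) - x0 s = (X (k n) (real m * hk n) - X (k n) s) + (X (k n) s - x0 s)" by simp
        show "norm (catching_up_seq (hk n) m - x0 s) \<le> \<rho> n"
          unfolding eq eq2 \<rho>_def by (intro norm_triangle_mono 1 order_refl)
      qed
      then show "\<exists>N. \<forall>n\<ge>N. B ?p (z - ?Y n t) (z - ?Y n t) / 2 - B ?p (z - ?Y n s) (z - ?Y n s) / 2 \<le>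
        (real (node n t) * hk n - real (node n s) * hk n) * (?C + evi_const * \<rho> n)" by blast
    qed
    then show "B (x s) (z - x t) (z - x t) / 2 - B (x s) (z - x s) (z - x s) / 2 \<le>
      (t - s) * (- B (x s) (f (x s)) (z - x s) + K ^ 4 * (norm (z - x s))\<^sup>2 + evi_const * (2 * K\<^sup>2 * (t - s)))"
      by (simp add: x_eq[OF s] x_eq[OF t] c_def)
  qed
qed

text \<open>Freezing at a time t of differentiability and differentiating the inequality there from
  the right gives a quadratic bound on the pairing of f - v with z - x t, for all nearby test points
  z. So f - v is normal, and since both v and -v are tangent, it is orthogonal to v.\<close>

theorem local_existence:
  obtains T L x where "T > 0" "L-lipschitz_on UNIV x" "x 0 = y0" "\<And>t. x t \<in> Yr"
    "\<And>t v. 0 < t \<Longrightarrow> t < T \<Longrightarrow> (x has_vector_derivative v) (at t) \<Longrightarrow> projected_velocity (x t) v"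
proof -
  obtain T x where T: "T > 0" and lip: "(2 * K\<^sup>2)-lipschitz_on UNIV x" and x0: "x 0 = y0"
    and xY: "\<And>t. x t \<in> Y \<inter> ball y0 r"
    and evi: "\<And>s t z. 0 \<le> s \<Longrightarrow> s \<le> t \<Longrightarrow> t \<le> T \<Longrightarrow> z \<in> Yr \<Longrightarrow>
      B (x s) (z - x t) (z - x t) / 2 - B (x s) (z - x s) (z - x s) / 2 \<le>
      (t - s) * (- B (x s) (f (x s)) (z - x s) + K ^ 4 * (norm (z - x s))\<^sup>2 + evi_const * (2 * K\<^sup>2 * (t - s)))"
    by (rule limit_curve_exists) (rule that)
  have xYr: "x t \<in> Yr" for t using xY[of t] by auto
  show thesis
  proof (rule that[OF T lip x0 xYr])
    fix t v assume t: "0 < t" "t < T" and v: "(x has_vector_derivative v) (at t)"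
    let ?p = "x t"
    note p = xYr[of t]
    have bb: "bounded_bilinear (B ?p)" using B_bilinear[OF p] by (simp add: bilinear_conv_bounded_bilinear)
    have tan: "v \<in> tangent_cone Y ?p" "- v \<in> tangent_cone Y ?p"
      using velocity_in_tangent_cone[OF v zero_less_one] xY by auto
    have ineq: "B ?p (f ?p - v) (z - ?p) \<le> K ^ 4 * (norm (z - ?p))\<^sup>2" if z: "z \<in> Yr" for z
    proof -
      define A where "A = - B ?p (f ?p) (z - ?p) + K ^ 4 * (norm (z - ?p))\<^sup>2"
      \<comment> \<open>The variational inequality says that G is minimal over {t..T} at its left
        end. The freezing error is quadratic in s - t and contributes nothing to the derivative at
        t.\<close>
      define G where "G s = (s - t) * (A + evi_const * (2 * K\<^sup>2 * (s - t))) - B ?p (z - x s) (z - x s) / 2" for s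
      have dz: "((\<lambda>s. z - x s) has_vector_derivative (- v)) (at t)"
        using has_vector_derivative_diff[OF has_vector_derivative_const v, of z] by simp
      have "((\<lambda>s. B ?p (z - x s) (z - x s)) has_vector_derivative (B ?p (z - x t) (- v) + B ?p (- v) (z - x t))) (at t)"
        by (rule bounded_bilinear.has_vector_derivative[OF bb dz dz])
      then have "((\<lambda>s. B ?p (z - x s) (z - x s)) has_real_derivative (- 2 * B ?p v (z - x t))) (at t)"
        unfolding has_real_derivative_iff_has_vector_derivative
        using B_sym[OF p, of "z - x t" v] by (simp add: B_simps(7,8)[OF p])
      then have "(G has_real_derivative (A + B ?p v (z - x t))) (at t)"
        unfolding G_def by (auto intro!: derivative_eq_intros)
      moreover have "G t \<le> G s" if "t \<le> s" "s \<le> T" for s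
        using evi[of t s z] that t z by (simp add: G_def A_def)
      ultimately have "A + B ?p v (z - x t) \<ge> 0"
      proof -
        assume G: "(G has_real_derivative (A + B ?p v (z - x t))) (at t)"
          and mono: "\<And>s. t \<le> s \<Longrightarrow> s \<le> T \<Longrightarrow> G t \<le> G s"
        show ?thesis
        proof (rule ccontr)
          assume "\<not> ?thesis"
          then obtain d where d: "d > 0" "\<And>h. 0 < h \<Longrightarrow> h < d \<Longrightarrow> G (t + h) < G t"
            using DERIV_neg_dec_right[OF G] by auto
          define h where "h = min (d/2) (T - t)"
          have "0 < h" "h < d" "t + h \<le> T" using d t by (auto simp: h_def)
          then show False using d(2)[of h] mono[of "t + h"] by simp
        qed
      qed
      then show ?thesis by (simp add: A_def B_simps(3)[OF p])
    qed
    obtain d where d: "d > 0" "ball ?p d \<subseteq> ball y0 r" using xY[of t] by (meson IntD2 open_ball open_contains_ball)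
    have normal: "B ?p (f ?p - v) w \<le> 0" if w: "w \<in> tangent_cone Y ?p" for w
    proof (rule tangent_cone_quadratic_bound[OF _ d(1) _ w])
      show "bounded_linear (B ?p (f ?p - v))" by (rule bounded_bilinear.bounded_linear_right[OF bb])
      fix z assume "z \<in> Y" "dist z ?p < d"
      then have "z \<in> ball ?p d" "z \<in> Y" by (auto simp: dist_commute)
      then have "z \<in> Yr" using d by auto
      then show "B ?p (f ?p - v) (z - ?p) \<le> K ^ 4 * (norm (z - ?p))\<^sup>2" by (rule ineq)
    qed
    have "B ?p (f ?p - v) v = 0"
      using normal[OF tan(1)] normal[OF tan(2)] by (simp add: B_simps(8)[OF p])
    then show "projected_velocity ?p v"
      unfolding projected_velocity_def using tan(1) normal by blast
  qed
qed

end

section \<open>From the metric on the coordinate space to a local system\<close>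

lemma orthonormal_projection:
  fixes E :: "'e::euclidean_space set"
  assumes "subspace E"
  obtains I where "finite I" "I \<subseteq> E" "\<And>i. i \<in> I \<Longrightarrow> norm i = 1"
    "\<And>u. u \<in> E \<Longrightarrow> (\<Sum>i\<in>I. (u \<bullet> i) *\<^sub>R i) = u"
proof -
  obtain I where I: "I \<subseteq> E" "pairwise orthogonal I" "\<And>i. i \<in> I \<Longrightarrow> norm i = 1" "independent I" "span I = E"
    using orthonormal_basis_subspace[OF assms] by metis
  have fin: "finite I" using I(4) by (rule independent_imp_finite)
  have "(\<Sum>i\<in>I. (u \<bullet> i) *\<^sub>R i) = u" if u: "u \<in> E" for u
  proof -
    let ?d = "u - (\<Sum>i\<in>I. (u \<bullet> i) *\<^sub>R i)"
    have "orthogonal ?d j" if "j \<in> I" for j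
    proof -
      have "(\<Sum>i\<in>I. (u \<bullet> i) * (i \<bullet> j)) = (\<Sum>i\<in>I. if i = j then u \<bullet> i else 0)"
        using I(2,3) that by (intro sum.cong) (auto simp: pairwise_def orthogonal_def norm_eq_1)
      then show ?thesis using that fin by (simp add: orthogonal_def inner_diff_left inner_sum_left)
    qed
    moreover have "?d \<in> span I"
      unfolding I(5) using u I(1) by (intro subspace_diff subspace_sum subspace_scale assms) auto
    ultimately have "orthogonal ?d ?d" by (blast intro: orthogonal_to_span)
    then show ?thesis by (simp add: orthogonal_def)
  qed
  with fin I show thesis by (intro that) auto
qed

text \<open>Adding the squared distance to \<open>E\<close> turns a metric on the coordinate space \<open>E\<close> into one on the
  whole Euclidean type.\<close>

lemma projected_system_exists:
  fixes E :: "'e::euclidean_space set" and b :: "'e \<Rightarrow> 'e \<Rightarrow> 'e \<Rightarrow> real"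
  assumes E: "subspace E" and S: "Y \<subseteq> S" and y0: "y0 \<in> Y" and prox: "prox_regular Y"
    and b_sym: "\<And>y u w. y \<in> S \<Longrightarrow> u \<in> E \<Longrightarrow> w \<in> E \<Longrightarrow> b y u w = b y w u"
    and b_add: "\<And>y u v w. y \<in> S \<Longrightarrow> u \<in> E \<Longrightarrow> v \<in> E \<Longrightarrow> w \<in> E \<Longrightarrow> b y (u + v) w = b y u w + b y v w"
    and b_scale: "\<And>y u w c. y \<in> S \<Longrightarrow> u \<in> E \<Longrightarrow> w \<in> E \<Longrightarrow> b y (c *\<^sub>R u) w = c * b y u w"
    and b_pos: "\<And>y u. y \<in> S \<Longrightarrow> u \<in> E \<Longrightarrow> u \<noteq> 0 \<Longrightarrow> b y u u > 0"
    and b_lip: "\<And>u w. u \<in> E \<Longrightarrow> w \<in> E \<Longrightarrow> locally_lipschitz_on S (\<lambda>y. b y u w)"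
    and f_lip: "locally_lipschitz_on Y f"
  obtains r B K where "projected_system Y y0 r B f K"
    "\<And>y u w. y \<in> Y \<Longrightarrow> u \<in> E \<Longrightarrow> w \<in> E \<Longrightarrow> B y u w = b y u w"
proof -
  obtain I where I: "finite I" "I \<subseteq> E" "\<And>i. i \<in> I \<Longrightarrow> norm i = 1"
    "\<And>u. u \<in> E \<Longrightarrow> (\<Sum>i\<in>I. (u \<bullet> i) *\<^sub>R i) = u"
    using orthonormal_projection[OF E] by metis
  define P where "P u = (\<Sum>i\<in>I. (u \<bullet> i) *\<^sub>R i)" for u
  have PE: "P u \<in> E" for u unfolding P_def using I(2) by (intro subspace_sum subspace_scale E) auto
  have P_id: "P u = u" if "u \<in> E" for u using I(4)[OF that] by (simp add: P_def)
  have P_add: "P (u + w) = P u + P w" for u w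
    by (simp add: P_def inner_add_left scaleR_left_distrib sum.distrib)
  have P_scale: "P (c *\<^sub>R u) = c *\<^sub>R P u" for c u by (simp add: P_def scaleR_sum_right)
  define q where "q y u w = b y (P u) (P w)" for y u w
  define B where "B y u w = q y u w + (u - P u) \<bullet> (w - P w)" for y u w
  have y0S: "y0 \<in> S" using S y0 by auto
  have q_bil: "bilinear (q y)" if y: "y \<in> S" for y
  proof -
    have "linear (\<lambda>u. q y u w)" for w
      by (rule linearI) (simp_all add: q_def P_add P_scale b_add b_scale y PE)
    moreover have "q y u w = q y w u" for u w by (simp add: q_def b_sym[OF y PE PE])
    ultimately show ?thesis unfolding bilinear_def by (metis (no_types, lifting) ext)
  qed
  have B_bil: "bilinear (B y)" if y: "y \<in> S" for y
    unfolding bilinear_def B_def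
    by (intro conjI allI linearI)
       (simp_all add: bilinear_ladd[OF q_bil[OF y]] bilinear_radd[OF q_bil[OF y]]
         bilinear_lmul[OF q_bil[OF y]] bilinear_rmul[OF q_bil[OF y]] P_add P_scale
         inner_add_left inner_add_right inner_diff_left inner_diff_right algebra_simps)
  have B_sym: "B y u w = B y w u" if y: "y \<in> S" for y u w
    by (simp add: B_def q_def b_sym[OF y PE PE, of u w] inner_commute)
  have B_eq: "B y u w = b y u w" if "u \<in> E" "w \<in> E" for y u w
    using that by (simp add: B_def q_def P_id)
  have B_posdef: "B y u u > 0" if y: "y \<in> S" and "u \<noteq> 0" for y u
  proof (cases "P u = 0")
    case True
    have "q y u u = 0" using b_scale[OF y PE PE, of 0 u u] True by (simp add: q_def)
    then show ?thesis using True \<open>u \<noteq> 0\<close> by (simp add: B_def)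
  next
    case False
    then have "q y u u > 0" using b_pos[OF y PE] by (simp add: q_def)
    then show ?thesis by (simp add: B_def add_pos_nonneg)
  qed
  obtain C U where CU: "closed C" "open U" "Y = C \<inter> U"
    using prox by (auto simp: prox_regular_def clarke_regular_def)
  obtain r1 where r1: "r1 > 0" "cball y0 r1 \<subseteq> U"
    using CU y0 by (metis IntD2 open_contains_cball)
  obtain L0 W where L0: "L0 > 0" "open W" "y0 \<in> W"
    "\<And>z y \<eta>. z \<in> Y \<inter> W \<Longrightarrow> y \<in> Y \<inter> W \<Longrightarrow> \<eta> \<in> normal_cone Y y \<Longrightarrow> inner \<eta> (z - y) \<le> L0 * norm \<eta> * (norm (z - y))\<^sup>2"
    using prox y0 unfolding prox_regular_def by metis
  obtain r2 where r2: "r2 > 0" "cball y0 r2 \<subseteq> W" using L0 by (metis open_contains_cball)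
  obtain r3 Lf where r3: "r3 > 0" "Lf-lipschitz_on (Y \<inter> ball y0 r3) f"
    using f_lip y0 unfolding locally_lipschitz_on_def by blast
  have "\<exists>\<rho> L. \<rho> > 0 \<and> L-lipschitz_on (S \<inter> ball y0 \<rho>) (\<lambda>y. b y (fst p) (snd p))" if "p \<in> I \<times> I" for p
  proof -
    have "fst p \<in> E" "snd p \<in> E" using that I(2) by auto
    from b_lip[OF this] show ?thesis using y0S unfolding locally_lipschitz_on_def by blast
  qed
  then obtain \<rho> L where \<rho>L: "\<And>p. p \<in> I \<times> I \<Longrightarrow> \<rho> p > 0"
    "\<And>p. p \<in> I \<times> I \<Longrightarrow> (L p)-lipschitz_on (S \<inter> ball y0 (\<rho> p)) (\<lambda>y. b y (fst p) (snd p))" by metis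
  have finI: "finite (I \<times> I)" using I(1) by simp
  \<comment> \<open>Finitely many metric coefficients, one for each pair of basis vectors, control
    the metric uniformly in u and w. The inserted 1 covers an empty basis, that is, a manifold of
    dimension 0.\<close>
  define r4 where "r4 = Min (insert 1 (\<rho> ` (I \<times> I)))"
  have r4: "r4 > 0" "\<And>p. p \<in> I \<times> I \<Longrightarrow> r4 \<le> \<rho> p"
  proof -
    have "finite (insert 1 (\<rho> ` (I \<times> I)))" using finI by blast
    moreover have "0 < x" if "x \<in> insert 1 (\<rho> ` (I \<times> I))" for x
      using that \<rho>L(1) by (elim insertE imageE) simp_all
    ultimately show "r4 > 0" unfolding r4_def by (subst Min_gr_iff) blast+
    show "r4 \<le> \<rho> p" if "p \<in> I \<times> I" for p
      unfolding r4_def using that finI by (intro Min_le finite.insertI finite_imageI insertI2 imageI)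
  qed
  define Lb where "Lb = (\<Sum>p\<in>I \<times> I. L p)"
  have L_nonneg: "L p \<ge> 0" if "p \<in> I \<times> I" for p using \<rho>L(2)[OF that] by (rule lipschitz_on_nonneg)
  have Lb: "Lb \<ge> 0" unfolding Lb_def using L_nonneg by (intro sum_nonneg) auto
  have q_lip: "\<bar>q y u w - q z u w\<bar> \<le> Lb * norm (y - z) * norm u * norm w"
    if y: "y \<in> S" "dist y0 y < r4" and z: "z \<in> S" "dist y0 z < r4" for y z u w
  proof -
    have expand: "q y u w = (\<Sum>p\<in>I \<times> I. (u \<bullet> fst p) * (w \<bullet> snd p) * b y (fst p) (snd p))" if y: "y \<in> S" for y
    proof -
      have "q y u w = q y (P u) (P w)" by (simp add: q_def P_id[OF PE])
      also have "\<dots> = (\<Sum>p\<in>I \<times> I. q y ((u \<bullet> fst p) *\<^sub>R fst p) ((w \<bullet> snd p) *\<^sub>R snd p))"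
        unfolding P_def bilinear_sum[OF q_bil[OF y]] by (simp add: case_prod_unfold)
      also have "\<dots> = (\<Sum>p\<in>I \<times> I. (u \<bullet> fst p) * (w \<bullet> snd p) * b y (fst p) (snd p))"
      proof (rule sum.cong)
        fix p assume "p \<in> I \<times> I"
        then have "q y (fst p) (snd p) = b y (fst p) (snd p)" using I(2) by (auto simp: q_def P_id subset_iff)
        then show "q y ((u \<bullet> fst p) *\<^sub>R fst p) ((w \<bullet> snd p) *\<^sub>R snd p) = (u \<bullet> fst p) * (w \<bullet> snd p) * b y (fst p) (snd p)"
          by (simp add: bilinear_lmul[OF q_bil[OF y]] bilinear_rmul[OF q_bil[OF y]])
      qed simp
      finally show ?thesis .
    qed
    have "\<bar>q y u w - q z u w\<bar> \<le> (\<Sum>p\<in>I \<times> I. \<bar>(u \<bullet> fst p) * (w \<bullet> snd p) * (b y (fst p) (snd p) - b z (fst p) (snd p))\<bar>)"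
      unfolding expand[OF y(1)] expand[OF z(1)] sum_subtractf[symmetric] right_diff_distrib[symmetric]
      by (rule sum_abs)
    also have "\<dots> \<le> (\<Sum>p\<in>I \<times> I. L p * (norm (y - z) * norm u * norm w))"
    proof (rule sum_mono)
      fix p assume p: "p \<in> I \<times> I"
      have "\<bar>u \<bullet> fst p\<bar> \<le> norm u" "\<bar>w \<bullet> snd p\<bar> \<le> norm w"
        using Cauchy_Schwarz_ineq2[of u "fst p"] Cauchy_Schwarz_ineq2[of w "snd p"] p I(3) by auto
      moreover have "\<bar>b y (fst p) (snd p) - b z (fst p) (snd p)\<bar> \<le> L p * norm (y - z)"
        using lipschitz_onD[OF \<rho>L(2)[OF p], of y z] y z r4(2)[OF p] by (simp add: dist_norm)
      ultimately have "\<bar>(u \<bullet> fst p) * (w \<bullet> snd p) * (b y (fst p) (snd p) - b z (fst p) (snd p))\<bar> \<le>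
          norm u * norm w * (L p * norm (y - z))"
        unfolding abs_mult by (intro mult_mono) auto
      then show "\<bar>(u \<bullet> fst p) * (w \<bullet> snd p) * (b y (fst p) (snd p) - b z (fst p) (snd p))\<bar> \<le>
          L p * (norm (y - z) * norm u * norm w)" by (simp add: mult_ac)
    qed
    also have "\<dots> = Lb * norm (y - z) * norm u * norm w"
      unfolding Lb_def by (simp only: sum_distrib_right[symmetric] mult.assoc)
    finally show ?thesis .
  qed
  have B_lip: "\<bar>B y u w - B z u w\<bar> \<le> Lb * norm (y - z) * norm u * norm w"
    if "y \<in> S" "dist y0 y < r4" "z \<in> S" "dist y0 z < r4" for y z u w
    using q_lip[OF that] by (simp add: B_def)
  \<comment> \<open>Coercivity at the centre, from compactness of the unit sphere.\<close>
  obtain m0 where m0: "m0 > 0" "\<And>u. m0 * (norm u)\<^sup>2 \<le> B y0 u u"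
  proof -
    have bb: "bounded_bilinear (B y0)" using B_bil[OF y0S] by (simp add: bilinear_conv_bounded_bilinear)
    have "continuous_on (sphere 0 1) (\<lambda>u. B y0 u u)"
      by (intro bounded_bilinear.continuous_on[OF bb] continuous_intros)
    then obtain s where s: "s \<in> sphere (0::'e) 1" "\<And>u. u \<in> sphere 0 1 \<Longrightarrow> B y0 s s \<le> B y0 u u"
      using continuous_attains_inf[of "sphere (0::'e) 1" "\<lambda>u. B y0 u u"] by fastforce
    show thesis
    proof (rule that)
      show "B y0 s s > 0" by (rule B_posdef[OF y0S]) (use s(1) in force)
      fix u
      show "B y0 s s * (norm u)\<^sup>2 \<le> B y0 u u"
      proof (cases "u = 0")
        case True
        then show ?thesis using bilinear_lzero[OF B_bil[OF y0S]] by simp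
      next
        case False
        define n where "n = u /\<^sub>R norm u"
        have n: "norm n = 1" "u = norm u *\<^sub>R n" using False by (simp_all add: n_def)
        have "B y0 s s \<le> B y0 n n" using n(1) by (intro s(2)) simp
        then have "B y0 s s * (norm u)\<^sup>2 \<le> B y0 n n * (norm u)\<^sup>2" by (rule mult_right_mono) simp
        also have "\<dots> = B y0 (norm u *\<^sub>R n) (norm u *\<^sub>R n)"
          by (simp add: bilinear_lmul[OF B_bil[OF y0S]] bilinear_rmul[OF B_bil[OF y0S]] power2_eq_square)
        finally show ?thesis using n(2) by metis
      qed
    qed
  qed
  obtain C0 where C0: "C0 > 0" "\<And>u w. \<bar>B y0 u w\<bar> \<le> C0 * norm u * norm w"
    using bilinear_bounded_pos[OF B_bil[OF y0S]] by auto
  \<comment> \<open>The last entry limits the variation of the metric to m0 / 2, so half of the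
    coercivity at y0 survives in the ball; this explains 2 / m0 in K. The halved radii put the
    closed ball inside open balls, and the entry 1 simplifies the bounds on metric and
    field.\<close>
  define r where "r = Min {r1, r2, r3/2, r4/2, 1, m0 / (2 * (Lb + 1))}"
  have r: "r > 0" "r \<le> r1" "r \<le> r2" "r \<le> r3/2" "r \<le> r4/2" "r \<le> 1" "r \<le> m0 / (2 * (Lb + 1))"
  proof -
    have le: "r \<le> x" if "x \<in> {r1, r2, r3/2, r4/2, 1, m0 / (2 * (Lb + 1))}" for x
      unfolding r_def by (rule Min_le) (use that in simp_all)
    show "r \<le> r1" "r \<le> r2" "r \<le> r3/2" "r \<le> r4/2" "r \<le> 1" "r \<le> m0 / (2 * (Lb + 1))"
      by (rule le; simp)+
    have "m0 / (2 * (Lb + 1)) > 0" using m0(1) Lb by (intro divide_pos_pos) auto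
    then show "r > 0" unfolding r_def using r1(1) r2(1) r3(1) r4(1) by (subst Min_gr_iff) simp_all
  qed
  have Lf: "Lf \<ge> 0" using r3(2) by (rule lipschitz_on_nonneg)
  define K where "K = 1 + 2 / m0 + C0 + Lb + norm (f y0) + Lf + L0"
  have "2 / m0 > 0" using m0(1) by simp
  have K: "1 \<le> K" "2 / m0 \<le> K" "C0 + Lb \<le> K" "Lb \<le> K" "norm (f y0) + Lf \<le> K" "Lf \<le> K" "L0 \<le> K"
    unfolding K_def using \<open>2 / m0 > 0\<close> C0(1) Lb Lf L0(1) norm_ge_zero[of "f y0"] by linarith+
  let ?Yr = "Y \<inter> cball y0 r"
  have YrS: "y \<in> S" "dist y0 y < r4" "dist y0 y \<le> 1" "dist y0 y \<le> r" if "y \<in> ?Yr" for y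
    using that S r r4 by auto
  have comp: "compact (Y \<inter> cball y0 s)" if "s \<le> r1" for s
  proof -
    have "Y \<inter> cball y0 s = C \<inter> cball y0 s" using CU(3) r1 that by auto
    then show ?thesis using CU(1) by (simp add: closed_Int_compact)
  qed
  have regular: "tangent_cone Y y = clarke_tangent_cone Y y" if "y \<in> Y" for y
    using prox that by (auto simp: prox_regular_def clarke_regular_def)
  show thesis
  proof (rule that)
    show "projected_system Y y0 r B f K"
    proof
      show "r > 0" "y0 \<in> Y" "1 \<le> K" "compact ?Yr" using r K y0 comp by auto
    next
      fix y assume "y \<in> ?Yr"
      then show "bilinear (B y)" using B_bil YrS by blast
    next
      fix y u w assume "y \<in> ?Yr"
      then show "B y u w = B y w u" using B_sym YrS by blast
    next
      fix y u assume y: "y \<in> ?Yr"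
      have "\<bar>B y u u - B y0 u u\<bar> \<le> Lb * norm (y - y0) * norm u * norm u"
        using YrS[OF y] y0S r4 by (intro B_lip) auto
      also have "\<dots> \<le> (Lb + 1) * (m0 / (2 * (Lb + 1))) * norm u * norm u"
        using YrS(4)[OF y] r(7) Lb by (intro mult_right_mono mult_mono) (auto simp: dist_norm norm_minus_commute)
      also have "(Lb + 1) * (m0 / (2 * (Lb + 1))) = m0 / 2" using Lb by (simp add: field_simps)
      finally have "\<bar>B y u u - B y0 u u\<bar> \<le> m0 / 2 * (norm u)\<^sup>2" by (simp add: power2_eq_square mult.assoc)
      then have "m0 / 2 * (norm u)\<^sup>2 \<le> B y u u" using m0(2)[of u] by linarith
      then have "(2 / m0) * (m0 / 2 * (norm u)\<^sup>2) \<le> (2 / m0) * B y u u" using m0 by (intro mult_left_mono) auto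
      moreover have "(2 / m0) * (m0 / 2 * (norm u)\<^sup>2) = (norm u)\<^sup>2" using m0 by simp
      moreover have "0 \<le> m0 / 2 * (norm u)\<^sup>2" using m0 by simp
      then have "(2 / m0) * B y u u \<le> K * B y u u"
        using \<open>m0 / 2 * (norm u)\<^sup>2 \<le> B y u u\<close> K by (intro mult_right_mono) linarith+
      ultimately show "(norm u)\<^sup>2 \<le> K * B y u u" by linarith
    next
      fix y u w assume y: "y \<in> ?Yr"
      have "\<bar>B y u w - B y0 u w\<bar> \<le> Lb * norm (y - y0) * norm u * norm w"
        using YrS[OF y] y0S r4 by (intro B_lip) auto
      also have "\<dots> \<le> Lb * 1 * norm u * norm w"
        using YrS(3)[OF y] Lb by (intro mult_right_mono mult_left_mono) (auto simp: dist_norm norm_minus_commute)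
      finally have "\<bar>B y u w\<bar> \<le> (C0 + Lb) * (norm u * norm w)" using C0(2)[of u w] by (simp add: algebra_simps)
      also have "\<dots> \<le> K * (norm u * norm w)" using K by (intro mult_right_mono) auto
      finally show "\<bar>B y u w\<bar> \<le> K * norm u * norm w" by (simp add: mult_ac)
    next
      fix y z u w assume y: "y \<in> ?Yr" and z: "z \<in> ?Yr"
      have "\<bar>B y u w - B z u w\<bar> \<le> Lb * norm (y - z) * norm u * norm w"
        using YrS[OF y] YrS[OF z] by (intro B_lip) auto
      also have "\<dots> \<le> K * norm (y - z) * norm u * norm w" using K by (intro mult_right_mono) auto
      finally show "\<bar>B y u w - B z u w\<bar> \<le> K * norm (y - z) * norm u * norm w" .
    next
      fix y assume y: "y \<in> ?Yr"
      have "norm (f y - f y0) \<le> Lf * dist y y0"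
        using lipschitz_onD[OF r3(2), of y y0] y y0 r r3(1) by (auto simp: dist_norm)
      also have "\<dots> \<le> Lf * 1" using YrS(3)[OF y] Lf by (intro mult_left_mono) (auto simp: dist_commute)
      finally have "norm (f y) \<le> norm (f y0) + Lf" using norm_triangle_sub[of "f y" "f y0"] by simp
      then show "norm (f y) \<le> K" using K by simp
    next
      fix y z assume yz: "y \<in> ?Yr" "z \<in> ?Yr"
      have "norm (f y - f z) \<le> Lf * norm (y - z)"
        using lipschitz_onD[OF r3(2), of y z] yz r r3(1) by (auto simp: dist_norm)
      also have "\<dots> \<le> K * norm (y - z)" using K by (intro mult_right_mono) auto
      finally show "norm (f y - f z) \<le> K * norm (y - z)" .
    next
      fix y z \<eta> assume yz: "y \<in> ?Yr" "z \<in> ?Yr" and "\<And>w. w \<in> tangent_cone Y y \<Longrightarrow> inner \<eta> w \<le> 0"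
      \<comment> \<open>The polar of the tangent cone is the normal cone because the set is Clarke
        regular.\<close>
      then have "\<eta> \<in> normal_cone Y y" using regular[of y] by (auto simp: normal_cone_def inner_commute)
      moreover have "y \<in> Y \<inter> W" "z \<in> Y \<inter> W" using yz r r2 by auto
      ultimately have "inner \<eta> (z - y) \<le> L0 * norm \<eta> * (norm (z - y))\<^sup>2" using L0(4) by blast
      also have "\<dots> \<le> K * norm \<eta> * (norm (z - y))\<^sup>2" using K by (intro mult_right_mono) auto
      finally show "inner \<eta> (z - y) \<le> K * norm \<eta> * (norm (z - y))\<^sup>2" .
    next
      fix y v w assume y: "y \<in> ?Yr" and vw: "v \<in> tangent_cone Y y" "w \<in> tangent_cone Y y"
      \<comment> \<open>Adding tangent vectors requires a compact piece of Y centred at y rather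
        than at y0.\<close>
      obtain s where s: "s > 0" "cball y s \<subseteq> U" using y CU by (metis IntD1 IntD2 open_contains_cball)
      have "Y \<inter> cball y s = C \<inter> cball y s" using CU(3) s by auto
      then have "compact (Y \<inter> cball y s)" using CU(1) by (simp add: closed_Int_compact)
      then show "v + w \<in> tangent_cone Y y"
        using tangent_cone_add_clarke[OF _ s(1) vw(1)] vw(2) regular[of y] y by auto
    qed
  qed (use B_eq in blast)
qed

section \<open>Differentiation relative to the coordinate space\<close>

text \<open>Restriction to the line through y in direction u reduces this to uniqueness in one
  variable. A derivative within E is determined on E only, which is why the chain rules below are
  stated for vectors of E.\<close>

lemma has_derivative_unique_on_subspace:
  assumes E: "subspace E" "y \<in> E" and u: "u \<in> E"
    and D: "(h has_derivative D1) (at y within E)" "(h has_derivative D2) (at y within E)"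
  shows "D1 u = D2 u"
proof -
  have line: "((\<lambda>t::real. y + t *\<^sub>R u) has_derivative (\<lambda>t. t *\<^sub>R u)) (at 0)"
    by (auto intro!: derivative_eq_intros)
  have sub: "range (\<lambda>t::real. y + t *\<^sub>R u) \<subseteq> E" using E u by (auto intro!: subspace_add subspace_scale)
  have "((\<lambda>t. h (y + t *\<^sub>R u)) has_derivative (\<lambda>t. D (t *\<^sub>R u))) (at (0::real))"
    if "(h has_derivative D) (at y within E)" for D
    using has_derivative_in_compose[OF line, of h D] has_derivative_subset[OF that sub] by simp
  from has_derivative_unique[OF this[OF D(1)] this[OF D(2)]] show ?thesis
    by (metis scaleR_one)
qed

lemma at_within_openin:
  assumes "openin (top_of_set E) S" "y \<in> S"
  shows "at y within S = at y within E"
proof -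
  obtain U where "open U" "S = E \<inter> U" using assms(1) by (auto simp: openin_open)
  then show ?thesis using assms(2) by (intro at_within_nhd[of y U]) auto
qed

lemma openin_ballE:
  assumes "openin (top_of_set E) S" "y \<in> S"
  obtains r where "r > 0" "E \<inter> ball y r \<subseteq> S"
  using assms unfolding openin_contains_ball by (metis inf_commute)

lemma tangent_cone_subset_subspace:
  assumes E: "subspace E" and "Y \<subseteq> E" "x \<in> E"
  shows "tangent_cone Y x \<subseteq> E"
proof
  fix v assume "v \<in> tangent_cone Y x"
  then obtain y \<delta> where y: "\<And>k. y k \<in> Y" "(\<lambda>k. (y k - x) /\<^sub>R \<delta> k) \<longlonglongrightarrow> v" by (auto simp: tangent_cone_def)
  have "(y k - x) /\<^sub>R \<delta> k \<in> E" for k using assms y(1)[of k] by (intro subspace_scale subspace_diff) auto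
  then show "v \<in> E" using closed_sequentially[OF closed_subspace[OF E] _ y(2)] by blast
qed

text \<open>With the previous lemma, E is its own tangent cone at each of its points, so invariance
  of E under derivatives becomes an instance of invariance of tangent cones.\<close>

lemma subspace_subset_tangent_cone:
  assumes E: "subspace E" and "x \<in> E" "u \<in> E"
  shows "u \<in> tangent_cone E x"
  unfolding tangent_cone_iff
proof (intro allI impI)
  fix e :: real assume "e > 0"
  define \<delta> where "\<delta> = e / (2 * (norm u + 1))"
  have n: "norm u + 1 > 0" by (simp add: add_nonneg_pos)
  have \<delta>: "\<delta> > 0" using \<open>e > 0\<close> n by (simp add: \<delta>_def)
  have "\<delta> * (norm u + 1) = e / 2" unfolding \<delta>_def using n by (simp add: field_simps)
  then have "\<delta> * norm u + \<delta> = e / 2" by (simp add: distrib_left)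
  moreover have "\<delta> * norm u \<ge> 0" using \<delta> by simp
  ultimately have "\<delta> < e" "\<delta> * norm u < e" using \<delta> \<open>e > 0\<close> by linarith+
  moreover have "x + \<delta> *\<^sub>R u \<in> E" using assms by (intro subspace_add subspace_scale)
  ultimately show "\<exists>y\<in>E. \<exists>\<delta>. 0 < \<delta> \<and> \<delta> < e \<and> dist y x < e \<and> norm (y - x - \<delta> *\<^sub>R u) \<le> e * \<delta>"
    using \<delta> \<open>e > 0\<close> by (intro bexI[of _ "x + \<delta> *\<^sub>R u"] exI[of _ \<delta>]) (auto simp: dist_norm)
qed

text \<open>A locally Lipschitz derivative is bounded near y, and E intersected with a ball is
  convex, so the mean value inequality gives a Lipschitz bound.\<close>

lemma C11_on_local:
  assumes E: "subspace E" and S: "openin (top_of_set E) S" and y: "y \<in> S" and C: "C11_on S h"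
  shows "\<exists>D. (h has_derivative D) (at y within E)"
    and "\<exists>r>0. \<exists>L. E \<inter> ball y r \<subseteq> S \<and> L-lipschitz_on (E \<inter> ball y r) h"
proof -
  obtain D :: "'a \<Rightarrow> 'a \<Rightarrow>\<^sub>L 'a" where D: "\<And>x. x \<in> S \<Longrightarrow> (h has_derivative blinfun_apply (D x)) (at x within S)"
    "locally_lipschitz_on S D" using C unfolding C11_on_def by blast
  show "\<exists>D. (h has_derivative D) (at y within E)" using D(1)[OF y] at_within_openin[OF S y] by auto
  obtain r1 L where r1: "r1 > 0" "L-lipschitz_on (S \<inter> ball y r1) D"
    using D(2) y unfolding locally_lipschitz_on_def by blast
  obtain r2 where r2: "r2 > 0" "E \<inter> ball y r2 \<subseteq> S" using openin_ballE[OF S y] .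
  define r where "r = min r1 r2"
  have r: "r > 0" "r \<le> r1" "r \<le> r2" using r1 r2 by (auto simp: r_def)
  have L: "L \<ge> 0" using r1(2) by (rule lipschitz_on_nonneg)
  let ?X = "E \<inter> ball y r"
  have sub: "?X \<subseteq> S" using r2 r by auto
  have "(norm (D y) + L * r)-lipschitz_on ?X h"
  proof (rule bounded_derivative_imp_lipschitz)
    show "convex ?X" using E by (intro convex_Int subspace_imp_convex convex_ball)
    show "0 \<le> norm (D y) + L * r" using L r by simp
    fix x assume x: "x \<in> ?X"
    then have "x \<in> S" using sub by blast
    show "(h has_derivative blinfun_apply (D x)) (at x within ?X)"
      by (rule has_derivative_subset[OF D(1)[OF \<open>x \<in> S\<close>] sub])
    have "dist (D x) (D y) \<le> L * dist x y"
      using x y r r1(1) \<open>x \<in> S\<close> by (intro lipschitz_onD[OF r1(2)]) auto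
    also have "\<dots> \<le> L * r" using x L by (intro mult_left_mono) (auto simp: dist_commute)
    finally have "norm (D x) \<le> norm (D y) + L * r"
      using norm_triangle_sub[of "D x" "D y"] by (simp add: dist_norm)
    then show "onorm (blinfun_apply (D x)) \<le> norm (D y) + L * r" by (simp add: norm_blinfun.rep_eq)
  qed
  then show "\<exists>r>0. \<exists>L. E \<inter> ball y r \<subseteq> S \<and> L-lipschitz_on (E \<inter> ball y r) h" using r sub by blast
qed

section \<open>Charts and tangent vectors\<close>

lemma is_chartD:
  assumes "is_chart E c"
  shows "open (chart_dom c)" "openin (top_of_set E) (chart_map c ` chart_dom c)"
    "homeomorphism (chart_dom c) (chart_map c ` chart_dom c) (chart_map c) (chart_inv c)"
    "continuous_on (chart_dom c) (chart_map c)"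
    "continuous_on (chart_map c ` chart_dom c) (chart_inv c)"
    "\<And>x. x \<in> chart_dom c \<Longrightarrow> chart_inv c (chart_map c x) = x"
    "\<And>x. x \<in> chart_dom c \<Longrightarrow> chart_map c x \<in> E"
  using assms by (auto simp: is_chart_def homeomorphism_def openin_contains_ball)

lemma openin_chart_image:
  assumes c: "is_chart E c" and "open V"
  shows "openin (top_of_set E) (chart_map c ` (chart_dom c \<inter> V))"
proof -
  have "openin (top_of_set (chart_dom c)) (chart_dom c \<inter> V)" using \<open>open V\<close> by blast
  then have "openin (top_of_set (chart_map c ` chart_dom c)) (chart_map c ` (chart_dom c \<inter> V))"
    by (rule homeomorphism_imp_open_map[OF is_chartD(3)[OF c]])
  then show ?thesis using is_chartD(2)[OF c] by (rule openin_trans)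
qed

lemma transition_apply:
  assumes "is_chart E c" "x \<in> chart_dom c"
  shows "transition c d (chart_map c x) = chart_map d x"
  using is_chartD(6)[OF assms] by (simp add: transition_def)

locale c11_manifold =
  fixes E :: "'e::euclidean_space set"
    and A :: "('m::{t2_space,second_countable_topology}, 'e) chart set"
  assumes manifold: "C11_manifold E A"
begin

lemma E: "subspace E" using manifold by (simp add: C11_manifold_def)

lemma charts_is_chart: "c \<in> charts E A \<Longrightarrow> is_chart E c" by (simp add: charts_def)

lemma charts_atD:
  "c \<in> charts_at E A x \<Longrightarrow> c \<in> charts E A" "c \<in> charts_at E A x \<Longrightarrow> is_chart E c"
  "c \<in> charts_at E A x \<Longrightarrow> x \<in> chart_dom c"
  by (auto simp: charts_at_def charts_def)

lemma overlap_openin: "is_chart E c \<Longrightarrow> is_chart E d \<Longrightarrow> openin (top_of_set E) (overlap c d)"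
  unfolding overlap_def by (intro openin_chart_image is_chartD)

text \<open>Two charts of the maximal atlas need not be compatible by definition; the transition map is
  factored through a chart of \<open>A\<close>.\<close>

lemma transition_local:
  assumes c: "c \<in> charts E A" and d: "d \<in> charts E A" and x: "x \<in> chart_dom c" "x \<in> chart_dom d"
  shows "\<exists>D. (transition c d has_derivative D) (at (chart_map c x) within E)"
    and "\<exists>r>0. \<exists>L. E \<inter> ball (chart_map c x) r \<subseteq> overlap c d \<and>
      L-lipschitz_on (E \<inter> ball (chart_map c x) r) (transition c d)"
proof -
  obtain a where a: "a \<in> A" "x \<in> chart_dom a" using manifold unfolding C11_manifold_def by blast
  have ca: "is_chart E a" using manifold a(1) by (simp add: C11_manifold_def)
  note cc = charts_is_chart[OF c] and cd = charts_is_chart[OF d]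
  let ?y = "chart_map c x" and ?z = "chart_map a x"
  have C1: "C11_on (overlap c a) (transition c a)" and C2: "C11_on (overlap a d) (transition a d)"
    using c d a(1) by (auto simp: charts_def C11_compatible_def)
  have y: "?y \<in> overlap c a" and z: "?z \<in> overlap a d" using x a(2) by (auto simp: overlap_def)
  note l1 = C11_on_local[OF E overlap_openin[OF cc ca] y C1]
    and l2 = C11_on_local[OF E overlap_openin[OF ca cd] z C2]
  have yz: "transition c a ?y = ?z" by (rule transition_apply[OF cc x(1)])
  \<comment> \<open>The overlap of all three charts, on which the factorisation through a is an
    identity; it is relatively open in E, so derivatives within it are derivatives within E.\<close>
  define S where "S = chart_map c ` (chart_dom c \<inter> (chart_dom d \<inter> chart_dom a))"
  have S: "openin (top_of_set E) S"
    unfolding S_def by (intro openin_chart_image cc open_Int is_chartD(1)[OF cd] is_chartD(1)[OF ca])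
  have yS: "?y \<in> S" using x a(2) by (auto simp: S_def)
  have SE: "S \<subseteq> E" using S by (auto simp: openin_contains_ball)
  have Sov: "S \<subseteq> overlap c d" by (auto simp: S_def overlap_def)
  have eq: "transition c d u = transition a d (transition c a u)" "transition c a u \<in> E" if "u \<in> S" for u
  proof -
    obtain p where p: "p \<in> chart_dom c" "p \<in> chart_dom d" "p \<in> chart_dom a" "u = chart_map c p"
      using \<open>u \<in> S\<close> by (auto simp: S_def)
    show "transition c d u = transition a d (transition c a u)" "transition c a u \<in> E"
      using p by (simp_all add: transition_apply[OF cc] transition_apply[OF ca] is_chartD(7)[OF ca])
  qed
  obtain D1 D2 where D: "(transition c a has_derivative D1) (at ?y within E)"
    "(transition a d has_derivative D2) (at ?z within E)" using l1(1) l2(1) by blast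
  have D1: "(transition c a has_derivative D1) (at ?y within S)" by (rule has_derivative_subset[OF D(1) SE])
  have D2: "(transition a d has_derivative D2) (at (transition c a ?y) within transition c a ` S)"
    unfolding yz by (rule has_derivative_subset[OF D(2)]) (use eq(2) in blast)
  from has_derivative_in_compose[OF D1 D2] have "(transition c d has_derivative (\<lambda>u. D2 (D1 u))) (at ?y within S)"
    by (rule has_derivative_transform[where f = "\<lambda>u. transition a d (transition c a u)", OF yS eq(1), rotated])
  then show "\<exists>D. (transition c d has_derivative D) (at ?y within E)"
    unfolding at_within_openin[OF S yS] by blast
  obtain r1 L1 where 1: "r1 > 0" "L1-lipschitz_on (E \<inter> ball ?y r1) (transition c a)" using l1(2) by blast
  obtain r2 L2 where 2: "r2 > 0" "L2-lipschitz_on (E \<inter> ball ?z r2) (transition a d)" using l2(2) by blast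
  obtain r3 where 3: "r3 > 0" "E \<inter> ball ?y r3 \<subseteq> S" using openin_ballE[OF S yS] .
  have L1: "L1 \<ge> 0" using 1(2) by (rule lipschitz_on_nonneg)
  \<comment> \<open>Since L1 * r < r2, the first factor maps the small ball into the ball where the
    second factor is Lipschitz.\<close>
  define r where "r = min (min r1 r3) (r2 / (L1 + 1))"
  have "r2 / (L1 + 1) > 0" using 2 L1 by (intro divide_pos_pos) auto
  then have r: "r > 0" "r \<le> r1" "r \<le> r3" "r \<le> r2 / (L1 + 1)" using 1 3 by (auto simp: r_def)
  then have rL: "r * (L1 + 1) \<le> r2" using L1 by (simp add: pos_le_divide_eq)
  let ?X = "E \<inter> ball ?y r"
  have XS: "?X \<subseteq> S" using 3 r by auto
  have lip1: "L1-lipschitz_on ?X (transition c a)" by (rule lipschitz_on_subset[OF 1(2)]) (use r in auto)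
  have lip2: "L2-lipschitz_on (transition c a ` ?X) (transition a d)"
  proof (rule lipschitz_on_subset[OF 2(2)], clarify)
      fix u assume u: "u \<in> E" "u \<in> ball ?y r"
      have "dist ?z (transition c a u) \<le> L1 * dist ?y u"
        unfolding yz[symmetric] using u r 1(1) is_chartD(7)[OF cc x(1)] by (intro lipschitz_onD[OF 1(2)]) auto
      also have "\<dots> \<le> L1 * r" using u L1 by (intro mult_left_mono) auto
      also have "\<dots> < r2" using rL r by (simp add: algebra_simps)
      finally show "transition c a u \<in> E \<inter> ball ?z r2" using eq(2) XS u by auto
  qed
  have "(L2 * L1)-lipschitz_on ?X (transition c d)"
    using lipschitz_on_compose2[OF lip1 lip2] by (rule lipschitz_on_transform) (use eq(1) XS in auto)
  then show "\<exists>r>0. \<exists>L. E \<inter> ball ?y r \<subseteq> overlap c d \<and> L-lipschitz_on (E \<inter> ball ?y r) (transition c d)"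
    using r XS Sov by blast
qed

lemma transition_deriv:
  assumes c: "c \<in> charts_at E A x" and d: "d \<in> charts_at E A x"
  shows "(transition c d has_derivative transition_deriv c d x) (at (chart_map c x) within E)"
proof -
  have "chart_map c x \<in> overlap c d" using charts_atD[OF c] charts_atD[OF d] by (auto simp: overlap_def)
  then have "at (chart_map c x) within overlap c d = at (chart_map c x) within E"
    by (intro at_within_openin overlap_openin charts_atD(2)[OF c] charts_atD(2)[OF d])
  moreover have "transition c d differentiable (at (chart_map c x) within E)"
    using transition_local(1)[OF charts_atD(1)[OF c] charts_atD(1)[OF d] charts_atD(3)[OF c] charts_atD(3)[OF d]]
    unfolding differentiable_def .
  ultimately show ?thesis unfolding transition_deriv_def frechet_derivative_works by simp
qed

lemma transition_deriv_linear:
  assumes "c \<in> charts_at E A x" "d \<in> charts_at E A x"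
  shows "linear (transition_deriv c d x)"
  using transition_deriv[OF assms] by (meson bounded_linear.linear has_derivative_bounded_linear)

text \<open>Near the base point the transition map carries one coordinate image of X into the other.
  Thus tangency to X may be tested in any single chart, although the definition quantifies over all
  of them.\<close>

lemma tangent_cone_transition:
  assumes c: "c \<in> charts_at E A x" and d: "d \<in> charts_at E A x"
    and u: "u \<in> tangent_cone (chart_map c ` (X \<inter> chart_dom c)) (chart_map c x)"
  shows "transition_deriv c d x u \<in> tangent_cone (chart_map d ` (X \<inter> chart_dom d)) (chart_map d x)"
proof -
  note cc = charts_atD[OF c] and cd = charts_atD[OF d]
  obtain r where r: "r > 0" "E \<inter> ball (chart_map c x) r \<subseteq> overlap c d"
    using transition_local(2)[OF cc(1) cd(1) cc(3) cd(3)] by blast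
  let ?Y = "chart_map c ` (X \<inter> chart_dom c)"
  have YE: "?Y \<subseteq> E" using is_chartD(7)[OF cc(2)] by auto
  have "transition_deriv c d x u \<in> tangent_cone (chart_map d ` (X \<inter> chart_dom d)) (transition c d (chart_map c x))"
  proof (rule tangent_cone_has_derivative[OF transition_deriv[OF c d] _ r(1) _ u])
    show "?Y \<inter> ball (chart_map c x) r \<subseteq> E" using YE by auto
    show "transition c d ` (?Y \<inter> ball (chart_map c x) r) \<subseteq> chart_map d ` (X \<inter> chart_dom d)"
    proof clarify
      fix p assume p: "p \<in> X" "p \<in> chart_dom c" "chart_map c p \<in> ball (chart_map c x) r"
      then have "chart_map c p \<in> overlap c d" using r(2) is_chartD(7)[OF cc(2) p(2)] by blast
      then obtain p' where p': "p' \<in> chart_dom c" "p' \<in> chart_dom d" "chart_map c p = chart_map c p'"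
        by (auto simp: overlap_def)
      then have "p = p'" using is_chartD(6)[OF cc(2)] p(2) by metis
      then show "transition c d (chart_map c p) \<in> chart_map d ` (X \<inter> chart_dom d)"
        using p p' transition_apply[OF cc(2) p(2)] by auto
    qed
  qed
  then show ?thesis by (simp add: transition_apply[OF cc(2,3)])
qed

text \<open>The transition map sends a relative neighbourhood in E into E, and tangent vectors of E
  are exactly the vectors of E.\<close>

lemma transition_deriv_in_E:
  assumes c: "c \<in> charts_at E A x" and d: "d \<in> charts_at E A x" and u: "u \<in> E"
  shows "transition_deriv c d x u \<in> E"
proof -
  note cc = charts_atD[OF c] and cd = charts_atD[OF d]
  obtain r where r: "r > 0" "E \<inter> ball (chart_map c x) r \<subseteq> overlap c d"
    using transition_local(2)[OF cc(1) cd(1) cc(3) cd(3)] by blast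
  have "transition_deriv c d x u \<in> tangent_cone E (transition c d (chart_map c x))"
  proof (rule tangent_cone_has_derivative[OF transition_deriv[OF c d] _ r(1)])
    show "transition c d ` (E \<inter> ball (chart_map c x) r) \<subseteq> E"
    proof
      fix v assume "v \<in> transition c d ` (E \<inter> ball (chart_map c x) r)"
      then obtain p where "p \<in> chart_dom c" "p \<in> chart_dom d" "v = transition c d (chart_map c p)"
        using r(2) by (auto simp: overlap_def)
      then show "v \<in> E" using transition_apply[OF cc(2)] is_chartD(7)[OF cd(2)] by auto
    qed
    show "u \<in> tangent_cone E (chart_map c x)"
      using u is_chartD(7)[OF cc(2,3)] by (intro subspace_subset_tangent_cone E)
  qed auto
  moreover have "tangent_cone E (transition c d (chart_map c x)) \<subseteq> E"
    by (rule tangent_cone_subset_subspace[OF E])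
       (use transition_apply[OF cc(2,3)] is_chartD(7)[OF cd(2,3)] in auto)
  ultimately show ?thesis by blast
qed

text \<open>The chain rule on the triple overlap. This cocycle identity makes a vector given in one
  chart extend consistently to all charts.\<close>

lemma transition_deriv_comp:
  assumes c: "c \<in> charts_at E A x" and d: "d \<in> charts_at E A x" and e: "e \<in> charts_at E A x" and u: "u \<in> E"
  shows "transition_deriv d e x (transition_deriv c d x u) = transition_deriv c e x u"
proof -
  note cc = charts_atD[OF c] and cd = charts_atD[OF d] and ce = charts_atD[OF e]
  let ?y = "chart_map c x"
  define S where "S = chart_map c ` (chart_dom c \<inter> (chart_dom d \<inter> chart_dom e))"
  have S: "openin (top_of_set E) S"
    unfolding S_def by (intro openin_chart_image cc(2) open_Int is_chartD(1)[OF cd(2)] is_chartD(1)[OF ce(2)])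
  have yS: "?y \<in> S" using cc cd ce by (auto simp: S_def)
  have SE: "S \<subseteq> E" using S by (auto simp: openin_contains_ball)
  have eq: "transition c e u = transition d e (transition c d u)" "transition c d u \<in> E" if "u \<in> S" for u
  proof -
    obtain p where p: "p \<in> chart_dom c" "p \<in> chart_dom d" "p \<in> chart_dom e" "u = chart_map c p"
      using \<open>u \<in> S\<close> by (auto simp: S_def)
    show "transition c e u = transition d e (transition c d u)" "transition c d u \<in> E"
      using p by (simp_all add: transition_apply[OF cc(2)] transition_apply[OF cd(2)] is_chartD(7)[OF cd(2)])
  qed
  have D1: "(transition c d has_derivative transition_deriv c d x) (at ?y within S)"
    by (rule has_derivative_subset[OF transition_deriv[OF c d] SE])
  have D2: "(transition d e has_derivative transition_deriv d e x) (at (transition c d ?y) within transition c d ` S)"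
    unfolding transition_apply[OF cc(2,3)]
    by (rule has_derivative_subset[OF transition_deriv[OF d e]]) (use eq(2) in blast)
  from has_derivative_in_compose[OF D1 D2] have "(transition c e has_derivative (\<lambda>u. transition_deriv d e x (transition_deriv c d x u))) (at ?y within S)"
    by (rule has_derivative_transform[where f = "\<lambda>u. transition d e (transition c d u)", OF yS eq(1), rotated])
  then have "(transition c e has_derivative (\<lambda>u. transition_deriv d e x (transition_deriv c d x u))) (at ?y within E)"
    unfolding at_within_openin[OF S yS] .
  from has_derivative_unique_on_subspace[OF E is_chartD(7)[OF cc(2,3)] u this transition_deriv[OF c e]]
  show ?thesis .
qed

lemma transition_deriv_id:
  assumes c: "c \<in> charts_at E A x" and u: "u \<in> E"
  shows "transition_deriv c c x u = u"
proof -
  note cc = charts_atD[OF c]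
  have y: "chart_map c x \<in> chart_map c ` chart_dom c" using cc by auto
  have "(transition c c has_derivative (\<lambda>u. u)) (at (chart_map c x) within chart_map c ` chart_dom c)"
    by (rule has_derivative_transform[OF y _ has_derivative_ident]) (auto simp: transition_apply[OF cc(2)])
  then have "(transition c c has_derivative (\<lambda>u. u)) (at (chart_map c x) within E)"
    unfolding at_within_openin[OF is_chartD(2)[OF cc(2)] y] .
  from has_derivative_unique_on_subspace[OF E is_chartD(7)[OF cc(2,3)] u transition_deriv[OF c c] this]
  show ?thesis .
qed

lemma tangent_of_coords_in_tangent_space:
  assumes c: "c \<in> charts_at E A x" and u: "u \<in> E"
  shows "tangent_of_coords E A c x u \<in> tangent_space E A x"
  unfolding tangent_space_def tangent_of_coords_def
  using transition_deriv_in_E[OF c _ u] transition_deriv_comp[OF c _ _ u] by auto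

lemma tangent_of_coords_apply:
  assumes "c \<in> charts_at E A x" "u \<in> E"
  shows "tangent_of_coords E A c x u c = u"
  using assms by (simp add: tangent_of_coords_def transition_deriv_id)

lemma tangent_space_eq_tangent_of_coords:
  assumes c: "c \<in> charts_at E A x" and v: "v \<in> tangent_space E A x"
  shows "tangent_of_coords E A c x (v c) = v" "v c \<in> E"
proof -
  have v': "v c \<in> E" "\<And>d. d \<in> charts_at E A x \<Longrightarrow> v d = transition_deriv c d x (v c)"
    "\<And>d. d \<notin> charts_at E A x \<Longrightarrow> v d = 0"
    using c v unfolding tangent_space_def by blast+
  then show "v c \<in> E" by blast
  show "tangent_of_coords E A c x (v c) = v"
  proof
    fix d
    show "tangent_of_coords E A c x (v c) d = v d"
      using v'(2,3)[of d] by (cases "d \<in> charts_at E A x") (simp_all add: tangent_of_coords_def)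
  qed
qed

lemma tangent_of_coords_add:
  assumes c: "c \<in> charts_at E A x"
  shows "tangent_of_coords E A c x (u + w) = (\<lambda>d. tangent_of_coords E A c x u d + tangent_of_coords E A c x w d)"
  using transition_deriv_linear[OF c] by (auto simp: tangent_of_coords_def linear_add)

lemma tangent_of_coords_diff:
  assumes c: "c \<in> charts_at E A x"
  shows "tangent_of_coords E A c x (u - w) = (\<lambda>d. tangent_of_coords E A c x u d - tangent_of_coords E A c x w d)"
  using transition_deriv_linear[OF c] by (auto simp: tangent_of_coords_def linear_diff)

lemma tangent_of_coords_scale:
  assumes c: "c \<in> charts_at E A x"
  shows "tangent_of_coords E A c x (k *\<^sub>R u) = (\<lambda>d. k *\<^sub>R tangent_of_coords E A c x u d)"
  using transition_deriv_linear[OF c] by (auto simp: tangent_of_coords_def linear_scale)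

lemma coords_tangent_cone_subset:
  assumes c: "c \<in> charts_at E A x"
  shows "tangent_cone (chart_map c ` (X \<inter> chart_dom c)) (chart_map c x) \<subseteq> E"
  using is_chartD(7)[OF charts_atD(2)[OF c]] charts_atD(3)[OF c]
  by (intro tangent_cone_subset_subspace E) auto

lemma tangent_of_coords_in_manifold_tangent_cone:
  assumes c: "c \<in> charts_at E A x"
    and u: "u \<in> tangent_cone (chart_map c ` (X \<inter> chart_dom c)) (chart_map c x)"
  shows "tangent_of_coords E A c x u \<in> manifold_tangent_cone E A X x"
proof -
  have "u \<in> E" using u coords_tangent_cone_subset[OF c] by blast
  then show ?thesis
    unfolding manifold_tangent_cone_def
    using tangent_of_coords_in_tangent_space[OF c] tangent_cone_transition[OF c _ u]
    by (auto simp: tangent_of_coords_def)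
qed

definition coords_metric :: "('m, 'e) metric \<Rightarrow> ('m, 'e) chart \<Rightarrow> 'e \<Rightarrow> 'e \<Rightarrow> 'e \<Rightarrow> real" where
  "coords_metric g c y u w = g (chart_inv c y) (tangent_of_coords E A c (chart_inv c y) u)
     (tangent_of_coords E A c (chart_inv c y) w)"

text \<open>Evaluation at c and \<open>tangent_of_coords\<close> are mutually inverse between the
  tangent cone on the manifold and the one in the chart, and they turn the minimised functional into
  its coordinate expression.\<close>

lemma projected_vector_field_coords:
  assumes c: "c \<in> charts_at E A x" and f: "f x \<in> tangent_space E A x"
  shows "v \<in> projected_vector_field E A g X f x \<longleftrightarrow>
    (\<exists>u. v = tangent_of_coords E A c x u \<and> u \<in> tangent_cone (chart_map c ` (X \<inter> chart_dom c)) (chart_map c x) \<and>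
     (\<forall>w\<in>tangent_cone (chart_map c ` (X \<inter> chart_dom c)) (chart_map c x).
        coords_metric g c (chart_map c x) (u - f x c) (u - f x c) \<le>
        coords_metric g c (chart_map c x) (w - f x c) (w - f x c)))"
    (is "_ \<longleftrightarrow> (\<exists>u. v = ?v u \<and> u \<in> ?T \<and> (\<forall>w\<in>?T. ?G u \<le> ?G w))")
proof -
  note cc = charts_atD[OF c]
  let ?N = "\<lambda>w. g x (\<lambda>c. w c - f x c) (\<lambda>c. w c - f x c)"
  have N: "?N (?v u) = ?G u" for u
    using tangent_space_eq_tangent_of_coords(1)[OF c f]
    by (simp add: coords_metric_def is_chartD(6)[OF cc(2,3)] tangent_of_coords_diff[OF c])
  have sub: "w c \<in> ?T \<and> ?v (w c) = w" if "w \<in> manifold_tangent_cone E A X x" for w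
    using that c tangent_space_eq_tangent_of_coords(1)[OF c] by (auto simp: manifold_tangent_cone_def)
  have sup: "?v u \<in> manifold_tangent_cone E A X x" if "u \<in> ?T" for u
    using tangent_of_coords_in_manifold_tangent_cone[OF c that] .
  show ?thesis
  proof
    assume "v \<in> projected_vector_field E A g X f x"
    then have v: "v \<in> manifold_tangent_cone E A X x"
      and min: "\<And>w. w \<in> manifold_tangent_cone E A X x \<Longrightarrow> ?N v \<le> ?N w"
      by (auto simp: projected_vector_field_def is_arg_min_linorder)
    have "?G (v c) \<le> ?G w" if "w \<in> ?T" for w
      using min[OF sup[OF that]] sub[OF v] N[of w] N[of "v c"] by simp
    then show "\<exists>u. v = ?v u \<and> u \<in> ?T \<and> (\<forall>w\<in>?T. ?G u \<le> ?G w)"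
      using sub[OF v] by (intro exI[of _ "v c"]) auto
  next
    assume "\<exists>u. v = ?v u \<and> u \<in> ?T \<and> (\<forall>w\<in>?T. ?G u \<le> ?G w)"
    then obtain u where u: "v = ?v u" "u \<in> ?T" "\<And>w. w \<in> ?T \<Longrightarrow> ?G u \<le> ?G w" by blast
    have "?N v \<le> ?N w" if "w \<in> manifold_tangent_cone E A X x" for w
      using u(3)[of "w c"] sub[OF that] N[of u] N[of "w c"] u(1) by simp
    then show "v \<in> projected_vector_field E A g X f x"
      using sup[OF u(2)] u(1) by (auto simp: projected_vector_field_def is_arg_min_linorder)
  qed
qed

end

section \<open>Projected dynamics on the manifold\<close>

lemma locally_lipschitz_interval_imp_lipschitz:
  fixes h :: "real \<Rightarrow> 'b::metric_space"
  assumes "\<And>t. t \<in> {a..b} \<Longrightarrow> \<exists>\<delta>>0. \<exists>L. L-lipschitz_on ({a..b} \<inter> ball t \<delta>) h"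
  obtains L where "L-lipschitz_on {a..b} h"
proof -
  \<comment> \<open>A dummy one-point parameter set puts the problem in the form of the compactness
    theorem for parametrised Lipschitz maps.\<close>
  have "local_lipschitz {0::real} {a..b} (\<lambda>_. h)"
    unfolding local_lipschitz_def
  proof (intro ballI)
    fix t s :: real assume "t \<in> {a..b}"
    then obtain \<delta> L where "\<delta> > 0" "L-lipschitz_on ({a..b} \<inter> ball t \<delta>) h" using assms by blast
    moreover have "cball t (\<delta> / 2) \<inter> {a..b} \<subseteq> {a..b} \<inter> ball t \<delta>" using \<open>\<delta> > 0\<close> by auto
    ultimately show "\<exists>u>0. \<exists>L. \<forall>s\<in>cball s u \<inter> {0}. L-lipschitz_on (cball t u \<inter> {a..b}) h"
      by (intro exI[of _ "\<delta> / 2"] conjI exI[of _ L] ballI) (auto intro: lipschitz_on_subset)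
  qed
  then obtain L where "\<And>t::real. t \<in> {0} \<Longrightarrow> L-lipschitz_on {a..b} h"
    by (rule local_lipschitz_compact_implies_lipschitz) auto
  then show thesis by (intro that) simp
qed

locale projected_dynamics = c11_manifold E A
  for E :: "'e::euclidean_space set" and A :: "('m::{t2_space,second_countable_topology}, 'e) chart set" +
  fixes g :: "('m, 'e) metric" and X :: "'m set" and f :: "'m \<Rightarrow> ('m, 'e) tvec"
  assumes metric: "C01_riemannian_metric E A g"
    and prox_regular: "manifold_prox_regular E A X"
    and vector_field: "C01_vector_field_on E A X f"
begin

abbreviation coords :: "('m, 'e) chart \<Rightarrow> 'e set" where
  "coords c \<equiv> chart_map c ` (X \<inter> chart_dom c)"

text \<open>B is the extended metric on the whole Euclidean type, hence it is tied to the coordinate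
  metric only for vectors of E.\<close>

definition local_model :: "'m \<Rightarrow> ('m, 'e) chart \<Rightarrow> real \<Rightarrow> ('e \<Rightarrow> 'e \<Rightarrow> 'e \<Rightarrow> real) \<Rightarrow> real \<Rightarrow> bool" where
  "local_model x c r B K \<longleftrightarrow> c \<in> charts_at E A x \<and>
     projected_system (coords c) (chart_map c x) r B (\<lambda>y. f (chart_inv c y) c) K \<and>
     (\<forall>y\<in>coords c. \<forall>u\<in>E. \<forall>w\<in>E. B y u w = coords_metric g c y u w)"

lemma riemannian_metricD:
  assumes "u \<in> tangent_space E A x" "v \<in> tangent_space E A x"
  shows "g x u v = g x v u" "w \<in> tangent_space E A x \<Longrightarrow> g x (\<lambda>c. u c + v c) w = g x u w + g x v w"
    "g x (\<lambda>c. a *\<^sub>R u c) v = a * g x u v" "u \<noteq> (\<lambda>_. 0) \<Longrightarrow> g x u u > 0"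
proof -
  have "g x u v = g x v u \<and> (\<forall>w\<in>tangent_space E A x. g x (\<lambda>c. u c + v c) w = g x u w + g x v w) \<and>
        (\<forall>a::real. g x (\<lambda>c. a *\<^sub>R u c) v = a * g x u v) \<and> (u \<noteq> (\<lambda>_. 0) \<longrightarrow> g x u u > 0)"
    using metric assms unfolding C01_riemannian_metric_def riemannian_metric_def by blast
  then show "g x u v = g x v u" "w \<in> tangent_space E A x \<Longrightarrow> g x (\<lambda>c. u c + v c) w = g x u w + g x v w"
    "g x (\<lambda>c. a *\<^sub>R u c) v = a * g x u v" "u \<noteq> (\<lambda>_. 0) \<Longrightarrow> g x u u > 0" by blast+
qed

lemma local_model_exists:
  assumes x: "x \<in> X"
  obtains c r B K where "local_model x c r B K"
proof -
  obtain c where c: "c \<in> charts_at E A x" "prox_regular (coords c)"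
    using prox_regular x unfolding manifold_prox_regular_def by blast
  note cc = charts_atD[OF c(1)]
  let ?S = "chart_map c ` chart_dom c"
  have at: "c \<in> charts_at E A (chart_inv c y)" "chart_inv c y \<in> chart_dom c" if "y \<in> ?S" for y
    using that cc is_chartD(6)[OF cc(2)] by (auto simp: charts_at_def)
  note toc = tangent_of_coords_in_tangent_space[OF at(1)]
  show thesis
  proof (rule projected_system_exists[OF E, of "coords c" ?S "chart_map c x" "coords_metric g c" "\<lambda>y. f (chart_inv c y) c"])
    show "coords c \<subseteq> ?S" by auto
    show "chart_map c x \<in> coords c" using x cc by auto
    show "prox_regular (coords c)" by fact
    show "coords_metric g c y u w = coords_metric g c y w u" if "y \<in> ?S" "u \<in> E" "w \<in> E" for y u w
      unfolding coords_metric_def using riemannian_metricD(1)[OF toc toc] that by blast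
    show "coords_metric g c y (u + v) w = coords_metric g c y u w + coords_metric g c y v w"
      if "y \<in> ?S" "u \<in> E" "v \<in> E" "w \<in> E" for y u v w
      unfolding coords_metric_def tangent_of_coords_add[OF at(1)[OF that(1)]]
      using that by (intro riemannian_metricD(2) toc)
    show "coords_metric g c y (k *\<^sub>R u) w = k * coords_metric g c y u w"
      if "y \<in> ?S" "u \<in> E" "w \<in> E" for y u w k
      unfolding coords_metric_def tangent_of_coords_scale[OF at(1)[OF that(1)]]
      using that by (intro riemannian_metricD(3) toc)
    show "coords_metric g c y u u > 0" if y: "y \<in> ?S" "u \<in> E" "u \<noteq> 0" for y u
    proof -
      have "tangent_of_coords E A c (chart_inv c y) u c = u" using tangent_of_coords_apply[OF at(1)[OF y(1)] y(2)] .
      then have "tangent_of_coords E A c (chart_inv c y) u \<noteq> (\<lambda>_. 0)" using y(3) by metis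
      then show ?thesis unfolding coords_metric_def using y by (intro riemannian_metricD(4)[OF toc toc])
    qed
    show "locally_lipschitz_on ?S (\<lambda>y. coords_metric g c y u w)" if "u \<in> E" "w \<in> E" for u w
      using metric cc(1) that unfolding coords_metric_def C01_riemannian_metric_def by blast
    show "locally_lipschitz_on (coords c) (\<lambda>y. f (chart_inv c y) c)"
      using vector_field cc(1) unfolding C01_vector_field_on_def by blast
  next
    fix r B K assume "projected_system (coords c) (chart_map c x) r B (\<lambda>y. f (chart_inv c y) c) K"
      "\<And>y u w. y \<in> coords c \<Longrightarrow> u \<in> E \<Longrightarrow> w \<in> E \<Longrightarrow> B y u w = coords_metric g c y u w"
    then show thesis using c(1) by (intro that[of c r B K]) (simp add: local_model_def)
  qed
qed

text \<open>Tangent vectors and the field have coordinates in E, so their differences do not see the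
  extension of the metric off E. The statement concerns all points p near the centre, because a
  curve leaves the centre at once.\<close>

lemma projected_vector_field_local_model:
  assumes model: "local_model x c r B K" and p: "p \<in> X" "p \<in> chart_dom c" "chart_map c p \<in> cball (chart_map c x) r"
  shows "v \<in> projected_vector_field E A g X f p \<longleftrightarrow> (\<exists>u. v = tangent_of_coords E A c p u \<and>
    projected_system.projected_velocity (coords c) B (\<lambda>y. f (chart_inv c y) c) (chart_map c p) u)"
proof -
  have c: "c \<in> charts_at E A x"
    and B: "\<And>y u w. y \<in> coords c \<Longrightarrow> u \<in> E \<Longrightarrow> w \<in> E \<Longrightarrow> B y u w = coords_metric g c y u w"
    and sys: "projected_system (coords c) (chart_map c x) r B (\<lambda>y. f (chart_inv c y) c) K"
    using model by (auto simp: local_model_def)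
  interpret S: projected_system "coords c" "chart_map c x" r B "\<lambda>y. f (chart_inv c y) c" K by (rule sys)
  have cp: "c \<in> charts_at E A p" using c p by (simp add: charts_at_def)
  have inv: "chart_inv c (chart_map c p) = p" by (rule is_chartD(6)[OF charts_atD(2)[OF c] p(2)])
  have fp: "f p \<in> tangent_space E A p" using vector_field p(1) by (simp add: C01_vector_field_on_def)
  have fE: "f p c \<in> E" by (rule tangent_space_eq_tangent_of_coords(2)[OF cp fp])
  have y: "chart_map c p \<in> S.Yr" using p by auto
  then have yc: "chart_map c p \<in> coords c" by simp
  have TE: "tangent_cone (coords c) (chart_map c p) \<subseteq> E" by (rule coords_tangent_cone_subset[OF cp])
  have eq: "B (chart_map c p) (u - f p c) (u - f p c) = coords_metric g c (chart_map c p) (u - f p c) (u - f p c)"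
    if "u \<in> tangent_cone (coords c) (chart_map c p)" for u
    using that TE fE by (intro B[OF yc] subspace_diff[OF E]) auto
  show ?thesis
    unfolding projected_vector_field_coords[where f = f, OF cp fp] S.projected_velocity_iff_min[OF y] inv
    using eq by (metis (no_types, lifting))
qed

text \<open>The curve is built in a single chart, but absolute continuity and velocity are required
  in all charts. Transition maps are locally Lipschitz, which on a compact time interval gives a
  global Lipschitz bound in any other chart, and they are differentiable, which transports the
  velocity.\<close>

theorem solution_exists:
  assumes x0: "x0 \<in> X"
  shows "\<exists>T x. caratheodory_solution E A g X f x0 T x"
proof -
  obtain c r B K where model: "local_model x0 c r B K" by (rule local_model_exists[OF x0])
  then have c: "c \<in> charts_at E A x0"
    and sys: "projected_system (coords c) (chart_map c x0) r B (\<lambda>y. f (chart_inv c y) c) K"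
    by (auto simp: local_model_def)
  note cc = charts_atD[OF c]
  interpret S: projected_system "coords c" "chart_map c x0" r B "\<lambda>y. f (chart_inv c y) c" K by (rule sys)
  obtain T L y where T: "T > 0" and lip: "L-lipschitz_on UNIV y" and y0: "y 0 = chart_map c x0"
    and yYr: "\<And>t. y t \<in> S.Yr"
    and vel: "\<And>t v. 0 < t \<Longrightarrow> t < T \<Longrightarrow> (y has_vector_derivative v) (at t) \<Longrightarrow> S.projected_velocity (y t) v"
    by (rule S.local_existence) (rule that)
  define x where "x t = chart_inv c (y t)" for t
  have y: "y t \<in> coords c" "y t \<in> chart_map c ` chart_dom c" "y t \<in> E" for t
    using yYr[of t] is_chartD(7)[OF cc(2)] by auto
  have x: "x t \<in> X" "x t \<in> chart_dom c" "chart_map c (x t) = y t" "c \<in> charts_at E A (x t)" for t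
    using y(1)[of t] is_chartD(6)[OF cc(2)] cc(1) by (auto simp: x_def charts_at_def)
  have map_x: "chart_map d \<circ> x = (\<lambda>t. transition c d (y t))" for d
    by (simp add: fun_eq_iff transition_def x_def)
  have ac: "absolutely_continuous_curve E A T x"
    unfolding absolutely_continuous_curve_def
  proof (intro conjI ballI allI impI)
    show "continuous_on {0..<T} x"
      unfolding x_def using lipschitz_on_continuous_on[OF lip] y(2)
      by (intro continuous_on_compose2[OF is_chartD(5)[OF cc(2)]]) (auto intro: continuous_on_subset)
    fix d a b assume d: "d \<in> charts E A" and ab: "0 \<le> a \<and> a \<le> b \<and> b < T \<and> x ` {a..b} \<subseteq> chart_dom d"
    have "\<exists>\<delta>>0. \<exists>L. L-lipschitz_on ({a..b} \<inter> ball t \<delta>) (chart_map d \<circ> x)" if t: "t \<in> {a..b}" for t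
    proof -
      have "x t \<in> chart_dom d" using ab t by auto
      then obtain r' L' where r': "r' > 0" "L'-lipschitz_on (E \<inter> ball (y t) r') (transition c d)"
        using transition_local(2)[OF cc(1) d x(2)[of t]] by (auto simp: x(3))
      have L: "L \<ge> 0" using lip by (rule lipschitz_on_nonneg)
      \<comment> \<open>Within time \<delta> the curve stays in the ball where the transition map is
        Lipschitz.\<close>
      define \<delta> where "\<delta> = r' / (L + 1)"
      have \<delta>: "\<delta> > 0" "L * \<delta> < r'" using r' L by (auto simp: \<delta>_def field_simps)
      have "L-lipschitz_on ({a..b} \<inter> ball t \<delta>) y" by (rule lipschitz_on_subset[OF lip]) simp
      moreover have "L'-lipschitz_on (y ` ({a..b} \<inter> ball t \<delta>)) (transition c d)"
      proof (rule lipschitz_on_subset[OF r'(2)], clarify)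
        fix s assume "s \<in> ball t \<delta>"
        have "dist (y t) (y s) \<le> L * dist t s" by (rule lipschitz_onD[OF lip]) auto
        also have "\<dots> \<le> L * \<delta>" using \<open>s \<in> ball t \<delta>\<close> L by (intro mult_left_mono) auto
        finally show "y s \<in> E \<inter> ball (y t) r'" using \<delta> y(3) by simp
      qed
      ultimately have "(L' * L)-lipschitz_on ({a..b} \<inter> ball t \<delta>) (\<lambda>s. transition c d (y s))"
        by (rule lipschitz_on_compose2)
      then show ?thesis using \<delta>(1) unfolding map_x by blast
    qed
    then obtain L' where "L'-lipschitz_on {a..b} (chart_map d \<circ> x)"
      by (rule locally_lipschitz_interval_imp_lipschitz)
    then show "absolutely_continuous_on_interval a b (chart_map d \<circ> x)"
      by (rule lipschitz_on_imp_absolutely_continuous)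
  qed
  have "AE t in lborel. y differentiable (at t)" using lip by (rule lipschitz_differentiable_AE)
  \<comment> \<open>At time 0 the projection property of the velocity is unknown; it is discarded as
    a null set.\<close>
  moreover have "AE t in lborel. t \<noteq> (0::real)" by (rule AE_lborel_singleton)
  ultimately have "AE t in lborel. t \<in> {0..<T} \<longrightarrow>
      (\<exists>v\<in>projected_vector_field E A g X f (x t). has_velocity E A x v t {0..<T})"
  proof eventually_elim
    case (elim t)
    show ?case
    proof
      assume t: "t \<in> {0..<T}"
      obtain v where v: "(y has_vector_derivative v) (at t)"
        using elim(1) by (auto simp: vector_derivative_works)
      have pv: "S.projected_velocity (y t) v" using vel v t elim(2) by simp
      let ?v = "tangent_of_coords E A c (x t) v"
      have vE: "v \<in> E"
        using pv coords_tangent_cone_subset[OF x(4)[of t]] by (auto simp: S.projected_velocity_def x(3))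
      have "?v \<in> projected_vector_field E A g X f (x t)"
        unfolding projected_vector_field_local_model[OF model x(1,2)[of t], unfolded x(3), OF IntD2[OF yYr]]
        using pv by blast
      moreover have "has_velocity E A x ?v t {0..<T}"
        unfolding has_velocity_def
      proof (intro conjI ballI)
        show "?v \<in> tangent_space E A (x t)" by (rule tangent_of_coords_in_tangent_space[OF x(4) vE])
        fix d assume d: "d \<in> charts_at E A (x t)"
        have y': "(y has_derivative (\<lambda>s. s *\<^sub>R v)) (at t within {0..<T})"
          using v unfolding has_vector_derivative_def by (rule has_derivative_at_withinI)
        have \<tau>: "(transition c d has_derivative transition_deriv c d (x t)) (at (y t) within y ` {0..<T})"
          using transition_deriv[OF x(4) d] unfolding x(3)
          by (rule has_derivative_subset) (use y(3) in auto)
        have "(\<lambda>s. transition_deriv c d (x t) (s *\<^sub>R v)) = (\<lambda>s. s *\<^sub>R ?v d)"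
          using transition_deriv_linear[OF x(4) d] d by (auto simp: linear_scale tangent_of_coords_def)
        then show "((chart_map d \<circ> x) has_vector_derivative ?v d) (at t within {0..<T})"
          using has_derivative_in_compose[OF y' \<tau>] unfolding has_vector_derivative_def map_x by simp
      qed
      ultimately show "\<exists>v\<in>projected_vector_field E A g X f (x t). has_velocity E A x v t {0..<T}" by blast
    qed
  qed
  moreover have "x 0 = x0" using is_chartD(6)[OF cc(2,3)] by (simp add: x_def y0)
  ultimately have "caratheodory_solution E A g X f x0 T x"
    unfolding caratheodory_solution_def using T x(1) ac by blast
  then show ?thesis by blast
qed

lemma solution_in_coords:
  assumes sol: "caratheodory_solution E A g X f x0 T x" and model: "local_model p c r B K"
    and ab: "0 \<le> a" "a \<le> b" "b < T"
    and inside: "\<And>s. s \<in> {a..b} \<Longrightarrow> x s \<in> chart_dom c \<and> chart_map c (x s) \<in> cball (chart_map c p) r"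
  obtains N where "N \<in> null_sets lborel"
    "\<And>t. t \<in> {a<..<b} - N \<Longrightarrow> \<exists>v. projected_system.projected_velocity (coords c) B (\<lambda>y. f (chart_inv c y) c)
      (chart_map c (x t)) v \<and> ((\<lambda>t. chart_map c (x t)) has_vector_derivative v) (at t)"
    "absolutely_continuous_on_interval a b (\<lambda>t. chart_map c (x t))"
    "continuous_on {a..b} (\<lambda>t. chart_map c (x t))"
    "\<And>s. s \<in> {a..b} \<Longrightarrow> chart_map c (x s) \<in> coords c \<inter> cball (chart_map c p) r"
proof -
  have c: "c \<in> charts_at E A p"
    and sys: "projected_system (coords c) (chart_map c p) r B (\<lambda>y. f (chart_inv c y) c) K"
    using model by (auto simp: local_model_def)
  interpret S: projected_system "coords c" "chart_map c p" r B "\<lambda>y. f (chart_inv c y) c" K by (rule sys)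
  note cc = charts_atD[OF c]
  have X: "x s \<in> X" if "s \<in> {a..b}" for s using sol ab that by (auto simp: caratheodory_solution_def)
  have curve: "continuous_on {0..<T} x" "\<And>c a b. c \<in> charts E A \<Longrightarrow> 0 \<le> a \<and> a \<le> b \<and> b < T \<and> x ` {a..b} \<subseteq> chart_dom c \<Longrightarrow>
        absolutely_continuous_on_interval a b (chart_map c \<circ> x)"
    using sol by (auto simp: caratheodory_solution_def absolutely_continuous_curve_def)
  have "AE t in lborel. t \<in> {0..<T} \<longrightarrow>
      (\<exists>v\<in>projected_vector_field E A g X f (x t). has_velocity E A x v t {0..<T})"
    using sol by (simp add: caratheodory_solution_def)
  then obtain N where N: "{t \<in> space lborel. \<not> (t \<in> {0..<T} \<longrightarrow>
      (\<exists>v\<in>projected_vector_field E A g X f (x t). has_velocity E A x v t {0..<T}))} \<subseteq> N"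
    "emeasure lborel N = 0" "N \<in> sets lborel" by (rule AE_E)
  show thesis
  proof (rule that)
    show "N \<in> null_sets lborel" using N by blast
    show "absolutely_continuous_on_interval a b (\<lambda>t. chart_map c (x t))"
      using curve(2)[OF cc(1), of a b] ab inside by (auto simp: o_def image_subset_iff)
    show "continuous_on {a..b} (\<lambda>t. chart_map c (x t))"
      using inside ab by (intro continuous_on_compose2[OF is_chartD(4)[OF cc(2)]] continuous_on_subset[OF curve(1)]) auto
    show "chart_map c (x s) \<in> coords c \<inter> cball (chart_map c p) r" if "s \<in> {a..b}" for s
      using inside[OF that] X[OF that] by auto
    fix t assume t: "t \<in> {a<..<b} - N"
    then have tab: "t \<in> {a..b}" "t \<in> {0..<T}" using ab by auto
    then obtain v where v: "v \<in> projected_vector_field E A g X f (x t)" "has_velocity E A x v t {0..<T}"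
      using N(1) t by auto
    obtain u where u: "v = tangent_of_coords E A c (x t) u" "S.projected_velocity (chart_map c (x t)) u"
      using v(1) projected_vector_field_local_model[OF model X[OF tab(1)]] inside[OF tab(1)] by blast
    have ct: "c \<in> charts_at E A (x t)" using inside[OF tab(1)] cc by (simp add: charts_at_def)
    have "u \<in> E" using u(2) coords_tangent_cone_subset[OF ct] by (auto simp: S.projected_velocity_def)
    then have "v c = u" using tangent_of_coords_apply[OF ct] u(1) by simp
    then have "((chart_map c \<circ> x) has_vector_derivative u) (at t within {0..<T})"
      using v(2) ct by (auto simp: has_velocity_def)
    \<comment> \<open>Velocities of a solution are taken within {0..<T}; at interior times this is
      the two-sided derivative used in the chart.\<close>
    moreover have "at t within {0..<T} = at t"
      using t ab by (intro at_within_interior) (auto simp: interior_atLeastLessThan)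
    ultimately show "\<exists>v. S.projected_velocity (chart_map c (x t)) v \<and>
        ((\<lambda>t. chart_map c (x t)) has_vector_derivative v) (at t)"
      using u(2) by (auto simp: o_def)
  qed
qed

lemma solution_stays_near:
  assumes sol: "caratheodory_solution E A g X f x0 T x" and a: "0 \<le> a" "a < T"
    and c: "is_chart E c" "x a \<in> chart_dom c" and "r > 0"
  shows "\<exists>\<delta>>0. \<forall>s\<in>{0..<T}. \<bar>s - a\<bar> < \<delta> \<longrightarrow> x s \<in> chart_dom c \<and> chart_map c (x s) \<in> cball (chart_map c (x a)) r"
proof -
  let ?W = "chart_dom c \<inter> chart_map c -` ball (chart_map c (x a)) r"
  have "open ?W" by (rule continuous_open_preimage[OF is_chartD(4,1)[OF c(1)] open_ball])
  moreover have "x a \<in> ?W" using c \<open>r > 0\<close> by simp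
  moreover have "(x \<longlongrightarrow> x a) (at a within {0..<T})"
    using sol a by (auto simp: caratheodory_solution_def absolutely_continuous_curve_def continuous_on_def)
  ultimately have "\<forall>\<^sub>F s in at a within {0..<T}. x s \<in> ?W" by (metis topological_tendstoD)
  then obtain \<delta> where \<delta>: "\<delta> > 0" "\<And>s. s \<in> {0..<T} \<Longrightarrow> s \<noteq> a \<Longrightarrow> dist s a < \<delta> \<Longrightarrow> x s \<in> ?W"
    unfolding eventually_at by blast
  have "x s \<in> chart_dom c \<and> chart_map c (x s) \<in> cball (chart_map c (x a)) r"
    if "s \<in> {0..<T}" "\<bar>s - a\<bar> < \<delta>" for s
  proof -
    have "x s \<in> ?W"
      using \<delta>(2)[OF that(1)] that(2) \<open>x a \<in> ?W\<close> by (cases "s = a") (auto simp: dist_real_def)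
    then show ?thesis by (auto intro: less_imp_le)
  qed
  then show ?thesis using \<delta>(1) by blast
qed

text \<open>The local model is centred at the common point, so both solutions stay in its ball for a
  while and \<open>local_uniqueness\<close> applies. The length gained depends on K and thus on the
  point.\<close>

lemma solutions_agree_further:
  assumes sol1: "caratheodory_solution E A g X f x0 T1 x1" and sol2: "caratheodory_solution E A g X f x0 T2 x2"
    and a: "0 \<le> a" "a < t" "t < T1" "t < T2" and eq: "x1 a = x2 a"
  shows "\<exists>b>a. b \<le> t \<and> (\<forall>s\<in>{a..b}. x1 s = x2 s)"
proof -
  let ?p = "x1 a"
  have "?p \<in> X" using sol1 a by (auto simp: caratheodory_solution_def)
  then obtain c r B K where model: "local_model ?p c r B K" by (rule local_model_exists)
  then have c: "c \<in> charts_at E A ?p"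
    and sys: "projected_system (coords c) (chart_map c ?p) r B (\<lambda>y. f (chart_inv c y) c) K"
    by (auto simp: local_model_def)
  note cc = charts_atD[OF c]
  interpret S: projected_system "coords c" "chart_map c ?p" r B "\<lambda>y. f (chart_inv c y) c" K by (rule sys)
  obtain \<delta>1 where \<delta>1: "\<delta>1 > 0" "\<And>s. s \<in> {0..<T1} \<Longrightarrow> \<bar>s - a\<bar> < \<delta>1 \<Longrightarrow>
      x1 s \<in> chart_dom c \<and> chart_map c (x1 s) \<in> cball (chart_map c ?p) r"
    using solution_stays_near[OF sol1 a(1) _ cc(2,3) S.r] a by auto
  obtain \<delta>2 where \<delta>2: "\<delta>2 > 0" "\<And>s. s \<in> {0..<T2} \<Longrightarrow> \<bar>s - a\<bar> < \<delta>2 \<Longrightarrow>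
      x2 s \<in> chart_dom c \<and> chart_map c (x2 s) \<in> cball (chart_map c ?p) r"
    using solution_stays_near[OF sol2 a(1) _ cc(2) _ S.r] a cc(3) eq by auto
  define m where "m = 1 / (20 * K ^ 6)"
  have "m > 0" using S.K_powers(4) by (simp add: m_def)
  \<comment> \<open>The halved \<delta>1 and \<delta>2 keep both solutions in the ball up to b
    itself, m is the time span of local uniqueness, and t - a keeps b within the range
    considered.\<close>
  define b where "b = a + min (min (\<delta>1 / 2) (\<delta>2 / 2)) (min m (t - a))"
  have b: "a < b" "b \<le> t" "b - a < \<delta>1" "b - a < \<delta>2" "b \<le> a + m"
    using \<delta>1(1) \<delta>2(1) \<open>m > 0\<close> a by (auto simp: b_def min_def)
  have in1: "x1 s \<in> chart_dom c \<and> chart_map c (x1 s) \<in> cball (chart_map c ?p) r" if "s \<in> {a..b}" for s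
    using that a b by (intro \<delta>1(2)) auto
  have in2: "x2 s \<in> chart_dom c \<and> chart_map c (x2 s) \<in> cball (chart_map c ?p) r" if "s \<in> {a..b}" for s
    using that a b by (intro \<delta>2(2)) auto
  have ab: "a \<le> b" "b < T1" "b < T2" using a b by auto
  obtain N1 where N1: "N1 \<in> null_sets lborel"
    "\<And>t. t \<in> {a<..<b} - N1 \<Longrightarrow> \<exists>v. S.projected_velocity (chart_map c (x1 t)) v \<and>
      ((\<lambda>t. chart_map c (x1 t)) has_vector_derivative v) (at t)"
    "absolutely_continuous_on_interval a b (\<lambda>t. chart_map c (x1 t))"
    "continuous_on {a..b} (\<lambda>t. chart_map c (x1 t))"
    "\<And>s. s \<in> {a..b} \<Longrightarrow> chart_map c (x1 s) \<in> S.Yr"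
    by (rule solution_in_coords[OF sol1 model a(1) ab(1,2) in1]) (assumption | rule that)+
  obtain N2 where N2: "N2 \<in> null_sets lborel"
    "\<And>t. t \<in> {a<..<b} - N2 \<Longrightarrow> \<exists>v. S.projected_velocity (chart_map c (x2 t)) v \<and>
      ((\<lambda>t. chart_map c (x2 t)) has_vector_derivative v) (at t)"
    "absolutely_continuous_on_interval a b (\<lambda>t. chart_map c (x2 t))"
    "continuous_on {a..b} (\<lambda>t. chart_map c (x2 t))"
    "\<And>s. s \<in> {a..b} \<Longrightarrow> chart_map c (x2 s) \<in> S.Yr"
    by (rule solution_in_coords[OF sol2 model a(1) ab(1,3) in2]) (assumption | rule that)+
  have "x1 s = x2 s" if s: "s \<in> {a..b}" for s
  proof -
    have "chart_map c (x1 s) = chart_map c (x2 s)"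
    proof (rule S.local_uniqueness[where a = a and b = b])
      show "N1 \<union> N2 \<in> null_sets lborel" using N1(1) N2(1) by (rule null_sets.Un)
      show "b \<le> a + 1 / (20 * K ^ 6)" using b(5) by (simp add: m_def)
    qed (use N1(2-5) N2(2-5) ab(1) s eq in auto)
    then show ?thesis using is_chartD(6)[OF cc(2)] in1[OF s] in2[OF s] by metis
  qed
  then show ?thesis using b by blast
qed

text \<open>No fixed step length is available, so agreement is extended through a supremum: it holds
  before a, at a by continuity, and then beyond a, contradicting the choice of a.\<close>

theorem solution_unique:
  assumes sol1: "caratheodory_solution E A g X f x0 T1 x1" and sol2: "caratheodory_solution E A g X f x0 T2 x2"
    and t: "t \<in> {0..<min T1 T2}"
  shows "x1 t = x2 t"
proof (rule ccontr)
  assume neq: "x1 t \<noteq> x2 t"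
  define Q where "Q = {s \<in> {0..t}. \<forall>u\<in>{0..s}. x1 u = x2 u}"
  have start: "x1 0 = x2 0" using sol1 sol2 by (simp add: caratheodory_solution_def)
  have Q0: "0 \<in> Q" using start t by (simp add: Q_def)
  have bdd: "bdd_above Q" by (auto simp: Q_def bdd_above_def)
  define a where "a = Sup Q"
  have a: "0 \<le> a" "a \<le> t"
    unfolding a_def by (rule cSup_upper[OF Q0 bdd], rule cSup_least) (use Q0 in \<open>auto simp: Q_def\<close>)
  have below: "x1 u = x2 u" if "0 \<le> u" "u < a" for u
  proof -
    obtain s where "s \<in> Q" "u < s" using \<open>u < a\<close> less_cSup_iff[OF _ bdd] Q0 by (auto simp: a_def)
    then show ?thesis using that by (simp add: Q_def)
  qed
  \<comment> \<open>Both solutions have the same left limit at a; the Hausdorff property makes the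
    values there equal.\<close>
  have at_a: "x1 a = x2 a"
  proof (cases "a = 0")
    case False
    then have "a > 0" using a by simp
    have lim: "(x \<longlongrightarrow> x a) (at a within {0..<a})" if "caratheodory_solution E A g X f x0 T x" "t < T" for T x
    proof -
      have "(x \<longlongrightarrow> x a) (at a within {0..<T})"
        using that a by (auto simp: caratheodory_solution_def absolutely_continuous_curve_def continuous_on_def)
      then show ?thesis by (rule tendsto_within_subset) (use that a in auto)
    qed
    have l1: "(x1 \<longlongrightarrow> x1 a) (at a within {0..<a})" and l2: "(x2 \<longlongrightarrow> x2 a) (at a within {0..<a})"
      using lim[OF sol1] lim[OF sol2] t by auto
    have "\<forall>\<^sub>F u in at a within {0..<a}. x2 u = x1 u"
      unfolding eventually_at_filter using below by (intro always_eventually) auto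
    with l2 have l3: "(x1 \<longlongrightarrow> x2 a) (at a within {0..<a})" by (rule Lim_transform_eventually)
    have "at a within {0..<a} \<noteq> bot"
      using \<open>a > 0\<close> by (simp add: at_within_eq_bot_iff)
    then show ?thesis using l1 l3 by (rule tendsto_unique)
  qed (simp add: start)
  then have "a < t" using neq a by (cases "a = t") auto
  moreover have "t < T1" "t < T2" using t by auto
  ultimately obtain b where b: "b > a" "b \<le> t" "\<And>s. s \<in> {a..b} \<Longrightarrow> x1 s = x2 s"
    using solutions_agree_further[OF sol1 sol2 a(1) _ _ _ at_a] by blast
  have "x1 u = x2 u" if "u \<in> {0..b}" for u
    using that below[of u] b(3)[of u] by (cases "u < a") auto
  then have "b \<in> Q" using b a by (simp add: Q_def)
  then show False using cSup_upper[OF _ bdd, of b] b(1) by (simp add: a_def)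
qed

end

theorem theorem7p6:
  fixes E :: "'e::euclidean_space set"
    and A :: "('m::{t2_space,second_countable_topology}, 'e) chart set"
    and g :: "('m, 'e) metric"
    and X :: "'m set"
    and f :: "'m \<Rightarrow> ('m, 'e) tvec"
    and x0 :: 'm
  assumes "C11_manifold E A"
    and "C01_riemannian_metric E A g"
    and "manifold_prox_regular E A X"
    and "C01_vector_field_on E A X f"
    and "x0 \<in> X"
  shows "(\<exists>T x. caratheodory_solution E A g X f x0 T x) \<and>
         (\<forall>T1 x1 T2 x2.
            caratheodory_solution E A g X f x0 T1 x1 \<and> caratheodory_solution E A g X f x0 T2 x2 \<longrightarrow>
            (\<forall>t\<in>{0..<min T1 T2}. x1 t = x2 t))"
proof -
  interpret projected_dynamics E A g X f
    using assms by unfold_locales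
  show ?thesis using solution_exists[OF assms(5)] solution_unique by blast
qed

end
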